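(* For every $p$ with $1 \le p < \infty$ there exist a bounded Jordan domain $\mathbb{Y} \subset \mathbb{C}$ and a homeomorphism $\varphi \colon \partial \mathbb{D} \to \partial \mathbb{Y}$ (onto) such that $\varphi$ satisfies the $p$-Douglas condition (i.e. $\varphi$ admits a continuous extension to $\overline{\mathbb{D}}$ in the Sobolev class $W^{1,p}(\mathbb{D}, \mathbb{C})$), but there is no homeomorphism $h \colon \mathbb{C} \to \mathbb{C}$ (onto) with $h = \varphi$ on $\partial \mathbb{D}$ and $h \in W^{1,1}_{\mathrm{loc}}(\mathbb{C}, \mathbb{C})$.
   Context: $\mathbb{D} \subset \mathbb{C}$ is the open unit disk. A Jordan domain is the bounded component of the complement of a Jordan curve in $\mathbb{C}$. For $1<p<\infty$, a map $\varphi \colon \partial \mathbb{D} \to \mathbb{C}$ satisfies the $p$-Douglas condition if $$\int_{\partial \mathbb{D}} \int_{\partial \mathbb{D}} \frac{|\varphi(x)-\varphi(y)|^p}{|x-y|^p}\, dx\, dy < \infty,$$ where $dx, dy$ denote integration with respect to arclength. For $p=1$, $\varphi$ satisfies the $1$-Douglas condition if $\varphi \in L^1(\partial \mathbb{D})$. *)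

theory Defs
  imports "HOL-Analysis.Analysis"
begin

definition jordan_domain :: "complex set \<Rightarrow> bool" where
  "jordan_domain Y \<longleftrightarrow>
     (\<exists>c. simple_path c \<and> pathfinish c = pathstart c \<and>
          Y \<in> components (- path_image c) \<and> bounded Y)"

definition circle_arclength :: "complex measure" where
  "circle_arclength =
     distr (lebesgue_on {0..<2 * pi}) (restrict_space borel (sphere 0 1)) cis"

text \<open>
  Both cases require measurability, since the nonnegative integral is also defined (as a lower
  integral) for nonmeasurable integrands.  The convention \<^term>\<open>x / 0 = 0\<close> only affects the diagonal,
  which is a null set.
\<close>

definition douglas_condition :: "real \<Rightarrow> (complex \<Rightarrow> complex) \<Rightarrow> bool" where
  "douglas_condition p \<phi> \<longleftrightarrow>
     (if p = 1 then integrable circle_arclength \<phi>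
      else \<phi> \<in> borel_measurable circle_arclength \<and>
        (\<integral>\<^sup>+ x. (\<integral>\<^sup>+ y. ennreal (norm (\<phi> x - \<phi> y) powr p / norm (x - y) powr p)
           \<partial>circle_arclength) \<partial>circle_arclength) < \<infinity>)"

fun times_cont_differentiable :: "nat \<Rightarrow> ('a::euclidean_space \<Rightarrow> real) \<Rightarrow> bool" where
  "times_cont_differentiable 0 f \<longleftrightarrow> continuous_on UNIV f"
| "times_cont_differentiable (Suc k) f \<longleftrightarrow>
     f differentiable_on UNIV \<and>
     (\<forall>v. times_cont_differentiable k (\<lambda>z. frechet_derivative f (at z) v))"

definition test_function :: "'a::euclidean_space set \<Rightarrow> ('a \<Rightarrow> real) \<Rightarrow> bool" where
  "test_function \<Omega> f \<longleftrightarrow>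
     (\<forall>k. times_cont_differentiable k f) \<and>
     compact (closure {z. f z \<noteq> 0}) \<and> closure {z. f z \<noteq> 0} \<subseteq> \<Omega>"

definition in_Lp :: "real \<Rightarrow> 'a::euclidean_space set \<Rightarrow> ('a \<Rightarrow> 'b::euclidean_space) \<Rightarrow> bool" where
  "in_Lp p \<Omega> u \<longleftrightarrow>
     u \<in> borel_measurable (lebesgue_on \<Omega>) \<and>
     integrable (lebesgue_on \<Omega>) (\<lambda>z. norm (u z) powr p)"

text \<open>
  Meaningful for \<open>u\<close> and \<open>v\<close> locally integrable on the open set \<open>\<Omega>\<close>; otherwise the Bochner
  integrals may take the default value 0.
\<close>

definition weak_partial_derivative ::
  "'a::euclidean_space set \<Rightarrow> ('a \<Rightarrow> 'b::euclidean_space) \<Rightarrow> 'a \<Rightarrow> ('a \<Rightarrow> 'b) \<Rightarrow> bool" where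
  "weak_partial_derivative \<Omega> u b v \<longleftrightarrow>
     (\<forall>\<psi>. test_function \<Omega> \<psi> \<longrightarrow>
        (LINT z|lebesgue_on \<Omega>. frechet_derivative \<psi> (at z) b *\<^sub>R u z) =
        - (LINT z|lebesgue_on \<Omega>. \<psi> z *\<^sub>R v z))"

text \<open>
  The Sobolev classes are intended for open \<open>\<Omega>\<close> and \<open>1 \<le> p < \<infinity>\<close>, in which case membership in
  \<open>L\<^sup>p\<close> implies the local integrability needed above.
\<close>

definition in_W1p :: "real \<Rightarrow> 'a::euclidean_space set \<Rightarrow> ('a \<Rightarrow> 'b::euclidean_space) \<Rightarrow> bool" where
  "in_W1p p \<Omega> u \<longleftrightarrow>
     in_Lp p \<Omega> u \<and> (\<forall>b\<in>Basis. \<exists>v. in_Lp p \<Omega> v \<and> weak_partial_derivative \<Omega> u b v)"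

definition in_W1p_loc :: "real \<Rightarrow> 'a::euclidean_space set \<Rightarrow> ('a \<Rightarrow> 'b::euclidean_space) \<Rightarrow> bool" where
  "in_W1p_loc p \<Omega> u \<longleftrightarrow>
     (\<forall>U. open U \<and> compact (closure U) \<and> closure U \<subseteq> \<Omega> \<longrightarrow> in_W1p p U u)"

end

theory Submission imports Defs begin

text \<open>
A homeomorphism of class \<open>W\<^sup>1\<^sup>,\<^sup>1\<close> maps almost every segment to a curve of finite length, and these lengths
are integrable over a family of parallel segments.  The boundary map below forces the images of the
vertical chords of the disc near the point \<open>1\<close> to be so long that this fails.

The domain is a thin channel that follows the graph of \<open>x\<^sup>k cos (\<pi> / x\<^sup>k\<^sup>+\<^sup>2)\<close>.  Between the abscissae \<open>1 / (2 n)\<close>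
and \<open>1 / n\<close> this graph has more than \<open>n\<^sup>k\<^sup>+\<^sup>2\<close> monotone swings of height at least \<open>(2 n)\<^sup>-\<^sup>k\<close>, so its length there is
at least of order \<open>n\<^sup>2\<close>.  The upper half circle is mapped to the lower wall of the channel, at abscissa
\<open>s = 1 - Re z\<close>, and the lower half circle to the upper wall, but at abscissa \<open>s\<^sup>2 / 2\<close>.  Hence, for large \<open>n\<close>, the end points of
the chord \<open>Re z = 1 - s\<close> with \<open>1 / n \<le> s \<le> 2 / n\<close> are mapped to opposite sides of the stretch between
\<open>1 / (2 n)\<close> and \<open>1 / n\<close>.  A homeomorphism of the plane that extends the boundary map sends the chord into the closed
channel, so the image of the chord follows all these swings and has length at least \<open>n\<^sup>2 / 2\<^sup>k\<close>
(\<open>chord_image_variation\<close>).  These chords fill an interval of length \<open>1 / n\<close>, so the integral of the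
lengths is at least \<open>n / 2\<^sup>k\<close>, which is unbounded in \<open>n\<close>.

That a weak derivative in \<open>L\<^sup>1\<close> bounds such integrals is \<open>weak_derivative_variation_bound\<close>.  Its proof tests the weak
derivative against finitely many bump functions on small boxes along a grid of chords; absolute
continuity on lines and Fubini's theorem do not enter.

The boundary map is nevertheless as regular as desired: the wave has slope of order \<open>x\<^sup>-\<^sup>3\<close>, whatever \<open>k\<close>
is, while its height is only \<open>x\<^sup>k\<close>.  Interpolating between the two bounds gives the Hoelder exponent
\<open>1 - 1 / (2 p)\<close> as soon as \<open>k \<ge> 6 p\<close>, and then the Douglas integral is dominated by that of
\<open>\<bar>x - y\<bar>\<^sup>-\<^sup>1\<^sup>/\<^sup>2\<close> (\<open>douglas_condition_if_hoelder\<close>).  In the disc the wave is damped by the factor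
\<open>x\<^sup>k / (x\<^sup>k + d)\<close> with \<open>d = 1 - \<bar>z\<bar>\<^sup>2\<close>, which keeps the gradient of the extension below a multiple of
\<open>d\<^sup>-\<^sup>3\<^sup>/\<^sup>k\<close> (\<open>ripple_deriv_bound\<close>); the \<open>p\<close>-th power of this is at most a multiple of \<open>d\<^sup>-\<^sup>1\<^sup>/\<^sup>2\<close> and hence integrable
(\<open>in_W1p_ball_classical\<close>).
\<close>

section \<open>Smooth steps and bumps\<close>

lemma times_cont_differentiable_continuous: "times_cont_differentiable k f \<Longrightarrow> continuous_on UNIV f"
  by (cases k) (auto intro: differentiable_imp_continuous_on)

lemma times_cont_differentiable_Suc_imp: "times_cont_differentiable (Suc k) f \<Longrightarrow> times_cont_differentiable k f"
proof (induction k arbitrary: f)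
  case 0
  then show ?case by (auto intro: differentiable_imp_continuous_on)
next
  case (Suc k)
  then show ?case by (metis times_cont_differentiable.simps(2))
qed

lemma times_cont_differentiable_intro:
  assumes "\<And>z. (f has_derivative f' z) (at z)" "\<And>v. times_cont_differentiable k (\<lambda>z. f' z v)"
  shows "times_cont_differentiable (Suc k) f"
proof -
  have "frechet_derivative f (at z) = f' z" for z
    using assms(1) frechet_derivative_at by metis
  with assms show ?thesis
    by (auto simp: differentiable_on_def differentiable_def)
qed

lemma times_cont_differentiable_const: "times_cont_differentiable k (\<lambda>z. c)"
proof (induction k arbitrary: c)
  case (Suc k)
  show ?case by (rule times_cont_differentiable_intro[where f' = "\<lambda>_ _. 0"]) (auto simp: Suc)
qed auto

lemma times_cont_differentiable_add:
  "times_cont_differentiable k f \<Longrightarrow> times_cont_differentiable k g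
    \<Longrightarrow> times_cont_differentiable k (\<lambda>z. f z + g z)"
proof (induction k arbitrary: f g)
  case (Suc k)
  show ?case
    by (rule times_cont_differentiable_intro[where f' = "\<lambda>z v. frechet_derivative f (at z) v + frechet_derivative g (at z) v"])
      (use Suc in \<open>auto intro!: has_derivative_add simp: frechet_derivative_works[symmetric] differentiable_on_def\<close>)
qed (auto intro!: continuous_intros)

lemma times_cont_differentiable_mult:
  "times_cont_differentiable k f \<Longrightarrow> times_cont_differentiable k g
    \<Longrightarrow> times_cont_differentiable k (\<lambda>z. f z * g z)"
proof (induction k arbitrary: f g)
  case (Suc k)
  show ?case
  proof (rule times_cont_differentiable_intro[where f' = "\<lambda>z v. f z * frechet_derivative g (at z) v + frechet_derivative f (at z) v * g z"])
    show "((\<lambda>z. f z * g z) has_derivative (\<lambda>v. f z * frechet_derivative g (at z) v + frechet_derivative f (at z) v * g z)) (at z)" for z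
      using Suc.prems by (intro has_derivative_mult) (auto simp: frechet_derivative_works[symmetric] differentiable_on_def)
    show "times_cont_differentiable k (\<lambda>z. f z * frechet_derivative g (at z) v + frechet_derivative f (at z) v * g z)" for v
      using Suc.prems times_cont_differentiable_Suc_imp[of k f] times_cont_differentiable_Suc_imp[of k g] by (intro times_cont_differentiable_add Suc.IH) auto
  qed
qed (auto intro!: continuous_intros)

lemma times_cont_differentiable_Suc_real:
  assumes "\<And>t. (g has_real_derivative g' t) (at t)" "times_cont_differentiable k g'"
  shows "times_cont_differentiable (Suc k) g"
proof (rule times_cont_differentiable_intro[where f' = "\<lambda>t v. v * g' t"])
  show "(g has_derivative (\<lambda>v. v * g' t)) (at t)" for t
    using assms(1)[of t] unfolding has_field_derivative_def mult.commute[of _ "g' t"] .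
  show "times_cont_differentiable k (\<lambda>t. v * g' t)" for v
    by (intro times_cont_differentiable_mult times_cont_differentiable_const assms)
qed

lemma times_cont_differentiable_compose_affine:
  fixes g :: "real \<Rightarrow> real"
  assumes "times_cont_differentiable k g"
  shows "times_cont_differentiable k (\<lambda>z. g (a \<bullet> z + c))"
  using assms
proof (induction k arbitrary: g)
  case 0
  then show ?case by (auto intro!: continuous_on_compose2[of UNIV g] continuous_intros)
next
  case (Suc k)
  define g' where "g' t = frechet_derivative g (at t) 1" for t
  have d: "(g has_real_derivative g' t) (at t)" for t
  proof -
    have "(g has_derivative frechet_derivative g (at t)) (at t)"
      using Suc.prems by (auto simp: frechet_derivative_works[symmetric] differentiable_on_def)
    then show ?thesis
      unfolding g'_def has_field_derivative_def
      using linear_cmul[OF has_derivative_linear, of g _ "at t" _ 1]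
      by (metis (no_types, lifting) ext mult.commute mult.right_neutral real_scaleR_def)
  qed
  show ?case
  proof (rule times_cont_differentiable_intro[where f' = "\<lambda>z v. (a \<bullet> v) * g' (a \<bullet> z + c)"])
    show "((\<lambda>z. g (a \<bullet> z + c)) has_derivative (\<lambda>v. a \<bullet> v * g' (a \<bullet> z + c))) (at z)" for z
      by (rule has_derivative_eq_rhs[OF has_derivative_compose[OF _ d[unfolded has_field_derivative_def]]])
        (auto intro!: derivative_eq_intros)
    show "times_cont_differentiable k (\<lambda>z. a \<bullet> v * g' (a \<bullet> z + c))" for v
      using Suc.prems by (intro times_cont_differentiable_mult times_cont_differentiable_const Suc.IH) (simp add: g'_def)
  qed
qed

text \<open>
The class of all these functions, with \<open>q\<close> ranging over the polynomials, is closed under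
differentiation.  This makes smoothness at \<open>0\<close> a single induction over the order of
differentiability with \<open>q\<close> arbitrary.
\<close>

definition flat_exp :: "real poly \<Rightarrow> real \<Rightarrow> real" where
  "flat_exp q t = (if t > 0 then poly q (1 / t) * exp (- (1 / t)) else 0)"

lemma poly_times_exp_neg_tendsto_0:
  fixes q :: "real poly"
  shows "((\<lambda>x. poly q x * exp (- x)) \<longlongrightarrow> 0) at_top"
proof -
  have 1: "((\<lambda>x::real. \<Sum>i\<le>degree q. coeff q i * (x ^ i / exp x)) \<longlongrightarrow> (\<Sum>i\<le>degree q. coeff q i * 0)) at_top"
    by (intro tendsto_intros tendsto_power_div_exp_0)
  have "(\<lambda>x. poly q x * exp (- x)) = (\<lambda>x. \<Sum>i\<le>degree q. coeff q i * (x ^ i / exp x))"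
    by (auto simp: poly_altdef sum_distrib_right exp_minus divide_inverse mult.assoc)
  with 1 show ?thesis by simp
qed

lemma flat_exp_tendsto_0: "(flat_exp q \<longlongrightarrow> 0) (at 0)"
proof -
  have "((\<lambda>t. poly q (inverse t) * exp (- inverse t)) \<longlongrightarrow> 0) (at_right 0)"
    using filterlim_compose[OF poly_times_exp_neg_tendsto_0 filterlim_inverse_at_top_right] .
  then have r: "(flat_exp q \<longlongrightarrow> 0) (at_right 0)"
    by (rule Lim_transform_eventually)
      (auto simp: flat_exp_def eventually_at_filter divide_inverse intro!: always_eventually)
  have "((\<lambda>t. 0) \<longlongrightarrow> (0::real)) (at_left 0)" by simp
  then have l: "(flat_exp q \<longlongrightarrow> 0) (at_left 0)"
    by (rule Lim_transform_eventually)
      (auto simp: flat_exp_def eventually_at_filter intro!: always_eventually)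
  show ?thesis using l r by (simp add: filterlim_at_split)
qed

lemma flat_exp_deriv:
  "(flat_exp q has_real_derivative flat_exp ((q - pderiv q) * [:0, 0, 1:]) t) (at t)"
proof -
  consider "t > 0" | "t < 0" | "t = 0" by linarith
  then show ?thesis
  proof cases
    case 1
    have "((\<lambda>t. poly q (1 / t) * exp (- (1 / t))) has_real_derivative
        flat_exp ((q - pderiv q) * [:0, 0, 1:]) t) (at t)"
      using 1 by (auto intro!: derivative_eq_intros DERIV_chain2[OF poly_DERIV] simp: flat_exp_def field_simps power2_eq_square)
    then show ?thesis
      by (rule has_field_derivative_transform_within_open[where S = "{0<..}"])
        (use 1 in \<open>auto simp: flat_exp_def\<close>)
  next
    case 2
    have "((\<lambda>t. 0) has_real_derivative flat_exp ((q - pderiv q) * [:0, 0, 1:]) t) (at t)"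
      using 2 by (auto simp: flat_exp_def)
    then show ?thesis
      by (rule has_field_derivative_transform_within_open[where S = "{..<0}"])
        (use 2 in \<open>auto simp: flat_exp_def\<close>)
  next
    case 3
    have "(\<lambda>h. (flat_exp q (0 + h) - flat_exp q 0) / h) = flat_exp (q * [:0, 1:])"
      by (auto simp: flat_exp_def)
    with 3 show ?thesis
      using flat_exp_tendsto_0[of "q * [:0, 1:]"] by (simp add: DERIV_def flat_exp_def)
  qed
qed

lemma flat_exp_times_cont_differentiable: "times_cont_differentiable k (flat_exp q)"
proof (induction k arbitrary: q)
  case 0
  have "isCont (flat_exp q) t" for t using flat_exp_deriv DERIV_isCont by blast
  then show ?case by (simp add: continuous_at_imp_continuous_on)
next
  case (Suc k)
  show ?case by (rule times_cont_differentiable_Suc_real[OF flat_exp_deriv Suc])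
qed

definition bump :: "real \<Rightarrow> real" where
  "bump t = flat_exp 1 (1 \<bullet> t + 0) * flat_exp 1 ((- 1) \<bullet> t + 1)"

lemma bump_times_cont_differentiable: "times_cont_differentiable k bump"
  unfolding bump_def by (intro times_cont_differentiable_mult times_cont_differentiable_compose_affine flat_exp_times_cont_differentiable)

lemma bump_nonneg: "0 \<le> bump t" by (simp add: bump_def flat_exp_def)
lemma bump_pos: "0 < t \<Longrightarrow> t < 1 \<Longrightarrow> 0 < bump t" by (simp add: bump_def flat_exp_def)
lemma bump_zero: "t \<le> 0 \<or> 1 \<le> t \<Longrightarrow> bump t = 0" by (auto simp: bump_def flat_exp_def)

text \<open>
Since \<open>bump\<close> vanishes outside \<open>{0<..<1}\<close>, this function is \<open>0\<close> up to \<open>0\<close> and constant from \<open>1\<close> on.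
The lower limit \<open>-1\<close> instead of \<open>0\<close> makes \<open>0\<close> an interior point of the interval of integration,
which yields the two-sided derivative there.  The step is not normalised to height \<open>1\<close>.
\<close>

definition smooth_step :: "real \<Rightarrow> real" where
  "smooth_step t = integral {-1..t} bump"

lemma bump_continuous: "continuous_on S bump"
  using times_cont_differentiable_continuous[OF bump_times_cont_differentiable] continuous_on_subset by blast

lemma smooth_step_nonpos: "t \<le> 0 \<Longrightarrow> smooth_step t = 0"
  unfolding smooth_step_def
  by (subst integral_cong[where g = "\<lambda>_. 0"]) (auto simp: bump_zero)

lemma smooth_step_deriv: "(smooth_step has_real_derivative bump t) (at t)"
proof (cases "t < 0")
  case True
  have "((\<lambda>t. 0) has_real_derivative bump t) (at t)" using True by (simp add: bump_zero)
  then show ?thesis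
    by (rule has_field_derivative_transform_within_open[where S = "{..<0}"])
      (use True smooth_step_nonpos in auto)
next
  case False
  have "((\<lambda>u. integral {-1..u} bump) has_real_derivative bump t) (at t within {-1..t+1})"
    by (rule integral_has_real_derivative) (use False bump_continuous in auto)
  moreover have "at t within {-1..t+1} = at t"
    using False by (intro at_within_interior) auto
  ultimately show ?thesis by (simp add: smooth_step_def[abs_def])
qed

lemma smooth_step_times_cont_differentiable: "times_cont_differentiable k smooth_step"
  by (rule times_cont_differentiable_Suc_imp[OF times_cont_differentiable_Suc_real[OF smooth_step_deriv bump_times_cont_differentiable]])

lemma smooth_step_mono: "s \<le> t \<Longrightarrow> smooth_step s \<le> smooth_step t"
  by (rule DERIV_nonneg_imp_nondecreasing) (use smooth_step_deriv bump_nonneg in blast)+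

lemma smooth_step_nonneg: "0 \<le> smooth_step t"
  by (metis linear smooth_step_mono smooth_step_nonpos)

lemma smooth_step_ge_1: "1 \<le> t \<Longrightarrow> smooth_step t = smooth_step 1"
proof -
  assume "1 \<le> t"
  have "integral {-1..t} bump = integral {-1..1} bump + integral {1..t} bump"
    using \<open>1 \<le> t\<close> by (intro Henstock_Kurzweil_Integration.integral_combine[symmetric] integrable_continuous_real bump_continuous) auto
  moreover have "integral {1..t} bump = 0"
    by (subst integral_cong[where g = "\<lambda>_. 0"]) (auto simp: bump_zero)
  ultimately show ?thesis by (simp add: smooth_step_def)
qed

lemma smooth_step_le: "smooth_step t \<le> smooth_step 1"
  by (metis linear smooth_step_ge_1 smooth_step_mono)

lemma smooth_step_continuous: "continuous_on S smooth_step"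
  using times_cont_differentiable_continuous[OF smooth_step_times_cont_differentiable] continuous_on_subset by blast

lemma smooth_step_pos: "0 < t \<Longrightarrow> 0 < smooth_step t"
proof -
  assume t: "0 < t"
  have "smooth_step 0 < smooth_step (min t 1)"
  proof (rule DERIV_pos_imp_increasing_open[of 0 "min t 1" smooth_step])
    show "\<exists>y. (smooth_step has_real_derivative y) (at x) \<and> 0 < y" if "0 < x" "x < min t 1" for x
      using that smooth_step_deriv[of x] bump_pos[of x] by auto
    show "continuous_on {0..min t 1} smooth_step"
      by (rule smooth_step_continuous)
  qed (use t in auto)
  also have "\<dots> \<le> smooth_step t" by (rule smooth_step_mono) simp
  finally show ?thesis by (simp add: smooth_step_nonpos)
qed

section \<open>Integration over Euclidean space\<close>

lemma continuous_compact_support_integrable: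
  fixes f :: "'a::euclidean_space \<Rightarrow> 'b::euclidean_space"
  assumes "continuous_on UNIV f" "compact S" "\<And>z. z \<notin> S \<Longrightarrow> f z = 0"
  shows "integrable lborel f"
proof -
  have "integrable lborel (\<lambda>x. indicator S x *\<^sub>R f x)"
    using assms continuous_on_subset by (intro borel_integrable_compact) blast+
  moreover have "(\<lambda>x. indicator S x *\<^sub>R f x) = f"
    using assms(3) by (auto simp: indicator_def)
  ultimately show ?thesis by simp
qed

lemma lebesgue_on_integral_eq_lborel:
  fixes f :: "'a::euclidean_space \<Rightarrow> 'b::euclidean_space"
  assumes "open U" "(\<lambda>z. if z \<in> U then f z else 0) \<in> borel_measurable borel"
  shows "(LINT z|lebesgue_on U. f z) = (LINT z|lborel. (if z \<in> U then f z else 0))"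
proof -
  have "(LINT z|lebesgue_on U. f z) = (LINT z|lebesgue. (if z \<in> U then f z else 0))"
    using assms(1) by (simp add: integral_restrict_space indicator_scaleR_eq_if)
  also have "\<dots> = (LINT z|lborel. (if z \<in> U then f z else 0))"
    using assms(2) by (intro integral_completion) simp
  finally show ?thesis .
qed

lemma lebesgue_on_integral_lborel:
  fixes f :: "'a::euclidean_space \<Rightarrow> 'b::euclidean_space"
  assumes "continuous_on UNIV f" "open U" "\<And>z. z \<notin> U \<Longrightarrow> f z = 0"
  shows "(LINT z|lebesgue_on U. f z) = (LINT z|lborel. f z)"
proof -
  have "(\<lambda>z. if z \<in> U then f z else 0) = f" using assms(3) by auto
  then show ?thesis
    using lebesgue_on_integral_eq_lborel[OF assms(2), of f] assms(1)
    by (simp add: borel_measurable_continuous_onI)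
qed

lemma lborel_integral_affine:
  fixes f :: "'a::euclidean_space \<Rightarrow> 'b::euclidean_space"
  assumes "f \<in> borel_measurable borel" "0 < e"
  shows "(LINT z|lborel. f z) = e ^ DIM('a) *\<^sub>R (LINT z|lborel. f (c + e *\<^sub>R z))"
  using assms
  by (subst lborel_affine[of e c]) (simp_all add: integral_density integral_distr)

lemma lborel_integral_translation:
  fixes f :: "'a::euclidean_space \<Rightarrow> 'b::euclidean_space"
  assumes "f \<in> borel_measurable borel"
  shows "(LINT z|lborel. f (c + z)) = (LINT z|lborel. f z)"
  using assms by (subst (2) lborel_distr_plus[of c, symmetric]) (simp add: integral_distr)

lemma lborel_integrable_translation:
  fixes f :: "'a::euclidean_space \<Rightarrow> 'b::euclidean_space"
  assumes "integrable lborel f"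
  shows "integrable lborel (\<lambda>z. f (c + z))"
proof -
  have "integrable (distr lborel borel ((+) c)) f" using assms by (simp add: lborel_distr_plus)
  then show ?thesis by (subst (asm) integrable_distr_eq) (use assms in auto)
qed

section \<open>Variation along lines of functions with an integrable weak derivative\<close>

text \<open>
A smoothed indicator of the box with real part in \<open>{x..x + e}\<close> and imaginary part in \<open>{s..t}\<close>.  Both
factors are differences of steps because these telescope: the box bumps over a partition add up to a
function that is bounded independently of the partition.
\<close>

definition box_bump :: "real \<Rightarrow> real \<Rightarrow> real \<Rightarrow> real \<Rightarrow> complex \<Rightarrow> real" where
  "box_bump e x s t w =
     (smooth_step ((Re w - x) / e) - smooth_step ((Re w - (x + e)) / e)) *
     (smooth_step ((Im w - s) / e) - smooth_step ((Im w - t) / e))"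

text \<open>
The profile of the derivative of \<open>box_bump\<close> in the direction \<open>\<i>\<close>: that derivative is the difference of two
copies of this kernel, rescaled to size \<open>e\<close> and placed at the lower and the upper end of the box.
\<close>

definition bump_kernel :: "complex \<Rightarrow> real" where
  "bump_kernel z = (smooth_step (Re z) - smooth_step (Re z - 1)) * bump (Im z)"

lemma smooth_step_diff_nonneg: "s \<le> t \<Longrightarrow> 0 < e \<Longrightarrow> 0 \<le> smooth_step ((y - s) / e) - smooth_step ((y - t) / e)"
  by (simp add: smooth_step_mono divide_right_mono)

lemma smooth_step_diff_le: "smooth_step s - smooth_step t \<le> smooth_step 1"
  using smooth_step_le[of s] smooth_step_nonneg[of t] by linarith

lemma smooth_step_diff_zero:
  assumes "smooth_step ((y - s) / e) - smooth_step ((y - t) / e) \<noteq> 0" "s \<le> t" "0 < e"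
  shows "s \<le> y \<and> y \<le> t + e"
proof (rule ccontr)
  assume "\<not> ?thesis"
  then consider "y < s" | "y > t + e" by linarith
  then show False
  proof cases
    case 1
    then have "smooth_step ((y - s) / e) = 0" "smooth_step ((y - t) / e) = 0"
      using assms by (auto intro!: smooth_step_nonpos simp: divide_nonpos_pos)
    with assms show False by simp
  next
    case 2
    then have "smooth_step ((y - s) / e) = smooth_step 1" "smooth_step ((y - t) / e) = smooth_step 1"
      using assms by (auto intro!: smooth_step_ge_1 simp: field_simps)
    with assms show False by simp
  qed
qed

lemma bump_kernel_nonneg: "0 \<le> bump_kernel z"
  unfolding bump_kernel_def using smooth_step_mono[of "Re z - 1" "Re z"] bump_nonneg by (intro mult_nonneg_nonneg) auto

lemma bump_kernel_continuous: "continuous_on S bump_kernel"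
  unfolding bump_kernel_def
  by (intro continuous_intros continuous_on_compose2[OF smooth_step_continuous[of UNIV]]
      continuous_on_compose2[OF bump_continuous[of UNIV]]) auto

lemma bump_kernel_support: "bump_kernel z \<noteq> 0 \<Longrightarrow> z \<in> cball 0 3"
proof -
  assume a: "bump_kernel z \<noteq> 0"
  have "0 \<le> Re z \<and> Re z \<le> 2"
    using smooth_step_diff_zero[of "Re z" 0 1 1] a by (simp add: bump_kernel_def)
  moreover have "0 \<le> Im z \<and> Im z \<le> 1"
    using bump_zero[of "Im z"] a by (fastforce simp: bump_kernel_def)
  ultimately show ?thesis using cmod_le[of z] by simp
qed

definition bump_kernel_mass :: real where "bump_kernel_mass = (LINT z|lborel. bump_kernel z)"

lemma bump_kernel_integrable: "integrable lborel bump_kernel"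
  by (rule continuous_compact_support_integrable[of _ "cball 0 3"]) (use bump_kernel_continuous bump_kernel_support in auto)

lemma bump_kernel_mass_pos: "0 < bump_kernel_mass"
proof -
  have "0 \<le> bump_kernel_mass" unfolding bump_kernel_mass_def by (intro Bochner_Integration.integral_nonneg) (simp add: bump_kernel_nonneg)
  moreover have "bump_kernel_mass \<noteq> 0"
  proof
    assume "bump_kernel_mass = 0"
    then have "AE z in lborel. bump_kernel z = 0"
      unfolding bump_kernel_mass_def using bump_kernel_integrable bump_kernel_nonneg integral_nonneg_eq_0_iff_AE by blast
    moreover have "bump_kernel z \<noteq> 0" if "z \<in> box (Complex 0 0) (Complex 1 1)" for z
    proof -
      have z: "0 < Re z" "Re z < 1" "0 < Im z" "Im z < 1" using that by (auto simp: in_box_complex_iff)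
      then show ?thesis
        using bump_pos[of "Im z"] smooth_step_pos[of "Re z"] smooth_step_nonpos[of "Re z - 1"] by (simp add: bump_kernel_def)
    qed
    ultimately have "AE z in lborel. z \<notin> box (Complex 0 0) (Complex 1 1)"
      by (auto elim: eventually_mono)
    then have "emeasure lborel (box (Complex 0 0) (Complex 1 1)) = 0"
      by (subst (asm) AE_iff_measurable[OF _ refl]) auto
    then show False
      by (simp add: emeasure_lborel_box_eq Basis_complex_def inner_complex_def)
  qed
  ultimately show ?thesis by linarith
qed

text \<open>
The kernel is supported in the disc of radius \<open>3\<close>, so at scale \<open>e\<close> only values of \<open>h\<close> within \<open>3 e\<close> of \<open>c\<close> enter.
\<close>

lemma bump_kernel_average:
  fixes h :: "complex \<Rightarrow> complex"
  assumes h: "continuous_on UNIV h" and e: "0 < e"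
    and om: "\<And>w. dist w c \<le> 3 * e \<Longrightarrow> norm (h w - h c) \<le> \<omega>"
  shows "norm ((LINT w|lborel. bump_kernel ((1 / e) *\<^sub>R (w - c)) *\<^sub>R h w) - (e\<^sup>2 * bump_kernel_mass) *\<^sub>R h c)
           \<le> e\<^sup>2 * bump_kernel_mass * \<omega>"
proof -
  have cont: "continuous_on UNIV (\<lambda>w. bump_kernel ((1 / e) *\<^sub>R (w - c)) *\<^sub>R h w)"
    by (intro continuous_intros h continuous_on_compose2[OF bump_kernel_continuous[of UNIV]]) auto
  have cont': "continuous_on UNIV (\<lambda>z. bump_kernel z *\<^sub>R h (c + e *\<^sub>R z))"
    by (intro continuous_intros bump_kernel_continuous continuous_on_compose2[OF h]) auto
  have int1: "integrable lborel (\<lambda>z. bump_kernel z *\<^sub>R h (c + e *\<^sub>R z))"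
    by (rule continuous_compact_support_integrable[OF cont', of "cball 0 3"]) (use bump_kernel_support in auto)
  have "(LINT w|lborel. bump_kernel ((1 / e) *\<^sub>R (w - c)) *\<^sub>R h w)
       = e\<^sup>2 *\<^sub>R (LINT z|lborel. bump_kernel z *\<^sub>R h (c + e *\<^sub>R z))"
    using e by (subst lborel_integral_affine[of _ e c]) (auto intro: borel_measurable_continuous_onI cont)
  moreover have "(e\<^sup>2 * bump_kernel_mass) *\<^sub>R h c = e\<^sup>2 *\<^sub>R (LINT z|lborel. bump_kernel z *\<^sub>R h c)"
    using bump_kernel_integrable by (simp add: bump_kernel_mass_def)
  ultimately have "norm ((LINT w|lborel. bump_kernel ((1 / e) *\<^sub>R (w - c)) *\<^sub>R h w) - (e\<^sup>2 * bump_kernel_mass) *\<^sub>R h c)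
     = e\<^sup>2 * norm ((LINT z|lborel. bump_kernel z *\<^sub>R h (c + e *\<^sub>R z)) - (LINT z|lborel. bump_kernel z *\<^sub>R h c))"
    by (simp add: scaleR_diff_right[symmetric])
  also have "(LINT z|lborel. bump_kernel z *\<^sub>R h (c + e *\<^sub>R z)) - (LINT z|lborel. bump_kernel z *\<^sub>R h c)
     = (LINT z|lborel. bump_kernel z *\<^sub>R (h (c + e *\<^sub>R z) - h c))"
    using int1 bump_kernel_integrable
    by (subst Bochner_Integration.integral_diff[symmetric]) (auto simp: scaleR_diff_right)
  also have "norm \<dots> \<le> (LINT z|lborel. bump_kernel z * \<omega>)"
  proof (rule Bochner_Integration.integral_norm_bound_integral)
    show "integrable lborel (\<lambda>z. bump_kernel z *\<^sub>R (h (c + e *\<^sub>R z) - h c))"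
      using int1 bump_kernel_integrable by (auto simp: scaleR_diff_right)
    show "integrable lborel (\<lambda>z. bump_kernel z * \<omega>)" using bump_kernel_integrable by simp
    show "norm (bump_kernel z *\<^sub>R (h (c + e *\<^sub>R z) - h c)) \<le> bump_kernel z * \<omega>" for z
    proof (cases "bump_kernel z = 0")
      case False
      then have "dist (c + e *\<^sub>R z) c \<le> 3 * e" using bump_kernel_support[of z] e by (auto simp: dist_norm)
      then show ?thesis using om bump_kernel_nonneg by (simp add: mult_left_mono)
    qed simp
  qed
  finally show ?thesis using e by (simp add: bump_kernel_mass_def mult_left_mono mult.assoc)
qed

lemma box_bump_test_function:
  assumes "x \<in> {-1..1}" "s \<le> t" "-1 \<le> s" "t \<le> 1" "0 < e" "e \<le> 1/4"
  shows "test_function (ball 0 3) (box_bump e x s t)"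
proof -
  have S: "times_cont_differentiable k (\<lambda>w. smooth_step ((Re w - x) / e))"
          "times_cont_differentiable k (\<lambda>w. smooth_step ((Im w - x) / e))" for k x
    using times_cont_differentiable_compose_affine[OF smooth_step_times_cont_differentiable[of k], of "(1 / e) *\<^sub>R (1::complex)" "- x / e"]
      times_cont_differentiable_compose_affine[OF smooth_step_times_cont_differentiable[of k], of "(1 / e) *\<^sub>R \<i>" "- x / e"]
    by (simp_all add: diff_divide_distrib)
  have D: "times_cont_differentiable k (\<lambda>w. f w - g w)"
    if "times_cont_differentiable k f" "times_cont_differentiable k g" for k and f g :: "complex \<Rightarrow> real"
    using times_cont_differentiable_add[OF that(1) times_cont_differentiable_mult[OF times_cont_differentiable_const that(2)], of "-1"] by simp
  have "times_cont_differentiable k (box_bump e x s t)" for k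
    unfolding box_bump_def[abs_def] by (intro times_cont_differentiable_mult D S)
  moreover have sub: "closure {w. box_bump e x s t w \<noteq> 0} \<subseteq> cball 0 (11/4)"
  proof (rule closure_minimal)
    show "{w. box_bump e x s t w \<noteq> 0} \<subseteq> cball 0 (11/4)"
    proof clarify
      fix w assume "box_bump e x s t w \<noteq> 0"
      then have "x \<le> Re w \<and> Re w \<le> (x + e) + e" "s \<le> Im w \<and> Im w \<le> t + e"
        using smooth_step_diff_zero[of "Re w" x e "x + e"] smooth_step_diff_zero[of "Im w" s e t] assms
        by (auto simp: box_bump_def)
      then have "\<bar>Re w\<bar> \<le> 3/2" "\<bar>Im w\<bar> \<le> 5/4"
        using assms by (auto simp: abs_le_iff)
      then show "w \<in> cball 0 (11/4)"
        using cmod_le[of w] by simp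
    qed
  qed auto
  moreover have "bounded {w. box_bump e x s t w \<noteq> 0}"
    by (rule bounded_subset[OF bounded_cball order_trans[OF closure_subset sub]])
  moreover have "closure {w. box_bump e x s t w \<noteq> 0} \<subseteq> ball 0 3"
    by (rule order_trans[OF sub]) auto
  ultimately show ?thesis by (auto simp: test_function_def)
qed

lemma box_bump_deriv:
  assumes "0 < e"
  shows "frechet_derivative (box_bump e x s t) (at w) \<i> =
    (1 / e) * (bump_kernel ((1 / e) *\<^sub>R (w - Complex x s)) - bump_kernel ((1 / e) *\<^sub>R (w - Complex x t)))"
proof -
  have *: "(smooth_step has_derivative (\<lambda>v. v * bump y)) (at y)" for y
    using smooth_step_deriv[of y] unfolding has_field_derivative_def mult.commute[of _ "bump y"] .
  have Re: "((\<lambda>w. smooth_step ((Re w - x) / e)) has_derivative (\<lambda>v. Re v / e * bump ((Re w - x) / e))) (at w)" for x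
    by (rule has_derivative_eq_rhs[OF has_derivative_compose[OF _ *]]) (use assms in \<open>auto intro!: derivative_eq_intros\<close>)
  have Im: "((\<lambda>w. smooth_step ((Im w - x) / e)) has_derivative (\<lambda>v. Im v / e * bump ((Im w - x) / e))) (at w)" for x
    by (rule has_derivative_eq_rhs[OF has_derivative_compose[OF _ *]]) (use assms in \<open>auto intro!: derivative_eq_intros\<close>)
  have "(box_bump e x s t has_derivative (\<lambda>v. 
      (smooth_step ((Re w - x) / e) - smooth_step ((Re w - (x + e)) / e)) * 
        (Im v / e * bump ((Im w - s) / e) - Im v / e * bump ((Im w - t) / e)) +
      (Re v / e * bump ((Re w - x) / e) - Re v / e * bump ((Re w - (x + e)) / e)) *
        (smooth_step ((Im w - s) / e) - smooth_step ((Im w - t) / e)))) (at w)"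
    unfolding box_bump_def[abs_def] by (intro has_derivative_mult has_derivative_diff Re Im)
  then have "frechet_derivative (box_bump e x s t) (at w) \<i> = 
      (smooth_step ((Re w - x) / e) - smooth_step ((Re w - (x + e)) / e)) * 
        (bump ((Im w - s) / e) / e - bump ((Im w - t) / e) / e)"
    by (simp add: frechet_derivative_at[symmetric])
  also have "(Re w - (x + e)) / e = (Re w - x) / e - 1" using assms by (simp add: diff_divide_distrib add_divide_distrib)
  finally show ?thesis using assms by (simp add: bump_kernel_def algebra_simps diff_divide_distrib)
qed

text \<open>
Testing with \<open>box_bump\<close> turns the weak derivative into a difference of two averages of \<open>h\<close>, taken around
the ends of a vertical segment.  These averages differ from the values of \<open>h\<close> at the ends by the
oscillation \<open>\<omega>\<close> of \<open>h\<close> at scale \<open>3 e\<close>.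
\<close>

lemma weak_derivative_increment:
  fixes h v :: "complex \<Rightarrow> complex"
  assumes h: "continuous_on UNIV h" and weak: "weak_partial_derivative (ball 0 3) h \<i> v"
    and v: "integrable (lebesgue_on (ball 0 3)) v"
    and "x \<in> {-1..1}" "s \<le> t" "-1 \<le> s" "t \<le> 1" "0 < e" "e \<le> 1/4"
    and om: "\<And>w z. z \<in> cball 0 2 \<Longrightarrow> dist w z \<le> 3 * e \<Longrightarrow> norm (h w - h z) \<le> \<omega>"
  shows "e * bump_kernel_mass * norm (h (Complex x t) - h (Complex x s))
     \<le> (LINT w|lebesgue_on (ball 0 3). box_bump e x s t w * norm (v w)) + 2 * (e * bump_kernel_mass * \<omega>)"
proof -
  define B where "B y w = bump_kernel ((1 / e) *\<^sub>R (w - Complex x y)) *\<^sub>R h w" for y w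
  define A where "A y = (LINT w|lborel. B y w)" for y
  have in2: "Complex x y \<in> cball 0 2" if "y \<in> {s..t}" for y
  proof -
    have "\<bar>x\<bar> \<le> 1" "\<bar>y\<bar> \<le> 1" using that assms by (auto simp: abs_le_iff)
    then show ?thesis using cmod_le[of "Complex x y"] by simp
  qed
  have A: "norm (A y - (e\<^sup>2 * bump_kernel_mass) *\<^sub>R h (Complex x y)) \<le> e\<^sup>2 * bump_kernel_mass * \<omega>" if "y \<in> {s..t}" for y
    unfolding A_def B_def using in2[OF that] assms by (intro bump_kernel_average) auto
  have Bcont: "continuous_on UNIV (B y)" for y
    unfolding B_def[abs_def] by (intro continuous_intros h continuous_on_compose2[OF bump_kernel_continuous[of UNIV]]) auto
  have Bsupp: "B y w = 0" if "w \<notin> cball (Complex x y) (3 * e)" for y w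
  proof (rule ccontr)
    assume "B y w \<noteq> 0"
    then have "norm ((1 / e) *\<^sub>R (w - Complex x y)) \<le> 3" using bump_kernel_support by (force simp: B_def)
    then have "norm (w - Complex x y) \<le> 3 * e" unfolding norm_scaleR using assms by (simp add: field_simps)
    with that show False by (simp add: dist_norm norm_minus_commute)
  qed
  have Bint: "integrable lborel (B y)" for y
    by (rule continuous_compact_support_integrable[OF Bcont, of "cball (Complex x y) (3 * e)"]) (use Bsupp in auto)
  have Bsupp': "B y w = 0" if "w \<notin> ball 0 3" "y \<in> {s..t}" for y w
  proof (rule Bsupp)
    show "w \<notin> cball (Complex x y) (3 * e)"
    proof
      assume "w \<in> cball (Complex x y) (3 * e)"
      then have "norm (w - Complex x y) \<le> 3/4" using assms by (simp add: dist_norm norm_minus_commute)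
      then have "norm w \<le> 3/4 + norm (Complex x y)" by norm
      moreover have "norm (Complex x y) \<le> 2" using in2[OF that(2)] by simp
      ultimately show False using that by simp
    qed
  qed
  have "(LINT w|lebesgue_on (ball 0 3). frechet_derivative (box_bump e x s t) (at w) \<i> *\<^sub>R h w)
      = (LINT w|lebesgue_on (ball 0 3). (1 / e) *\<^sub>R (B s w - B t w))"
    using assms by (intro Bochner_Integration.integral_cong refl)
      (simp add: box_bump_deriv B_def scaleR_diff_left scaleR_diff_right diff_divide_distrib)
  also have "\<dots> = (LINT w|lborel. (1 / e) *\<^sub>R (B s w - B t w))"
    by (rule lebesgue_on_integral_lborel) (auto intro!: continuous_intros Bcont simp: Bsupp' assms)
  also have "\<dots> = (1 / e) *\<^sub>R (A s - A t)"
    using Bint by (simp add: A_def)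
  finally have "(1 / e) *\<^sub>R (A s - A t) = - (LINT w|lebesgue_on (ball 0 3). box_bump e x s t w *\<^sub>R v w)"
    using weak box_bump_test_function[of x s t e] assms unfolding weak_partial_derivative_def by simp
  then have "norm (A s - A t) / e = norm (LINT w|lebesgue_on (ball 0 3). box_bump e x s t w *\<^sub>R v w)"
    using assms by (metis (no_types, lifting) abs_of_pos divide_real_def mult.commute norm_minus_cancel norm_scaleR zero_less_divide_1_iff mult_1)
  also have "\<dots> \<le> (LINT w|lebesgue_on (ball 0 3). norm (box_bump e x s t w *\<^sub>R v w))"
    by (rule integral_norm_bound)
  also have "\<dots> = (LINT w|lebesgue_on (ball 0 3). box_bump e x s t w * norm (v w))"
  proof (rule Bochner_Integration.integral_cong)
    have "0 \<le> box_bump e x s t w" for w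
      unfolding box_bump_def using assms by (intro mult_nonneg_nonneg smooth_step_diff_nonneg) auto
    then show "norm (box_bump e x s t w *\<^sub>R v w) = box_bump e x s t w * norm (v w)" for w by simp
  qed simp
  finally have 1: "norm (A s - A t) \<le> e * (LINT w|lebesgue_on (ball 0 3). box_bump e x s t w * norm (v w))"
    using assms by (simp add: field_simps)
  define E where "E = e\<^sup>2 * bump_kernel_mass"
  have E: "0 \<le> E" using bump_kernel_mass_pos by (simp add: E_def)
  have "E * norm (h (Complex x t) - h (Complex x s)) = norm (E *\<^sub>R h (Complex x t) - E *\<^sub>R h (Complex x s))"
    using E by (simp flip: scaleR_diff_right)
  also have "\<dots> \<le> norm (A s - A t) + E * \<omega> + E * \<omega>"
  proof -
    define p where "p y = A y - E *\<^sub>R h (Complex x y)" for y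
    have p: "norm (p s) \<le> E * \<omega>" "norm (p t) \<le> E * \<omega>"
      using A[of s] A[of t] assms by (auto simp: p_def E_def)
    have "E *\<^sub>R h (Complex x t) - E *\<^sub>R h (Complex x s) = (p s - p t) - (A s - A t)"
      by (simp add: p_def)
    also have "norm \<dots> \<le> (norm (p s) + norm (p t)) + norm (A s - A t)"
      by (meson add_mono_thms_linordered_semiring(3) norm_triangle_ineq4 order_trans)
    finally show ?thesis using p by linarith
  qed
  also have "\<dots> \<le> e * (LINT w|lebesgue_on (ball 0 3). box_bump e x s t w * norm (v w)) + 2 * (E * \<omega>)"
    using 1 by simp
  finally have "e * (e * bump_kernel_mass * norm (h (Complex x t) - h (Complex x s)))
     \<le> e * ((LINT w|lebesgue_on (ball 0 3). box_bump e x s t w * norm (v w)) + 2 * (e * bump_kernel_mass * \<omega>))"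
    by (simp add: E_def power2_eq_square algebra_simps)
  then show ?thesis using assms by simp
qed

text \<open>
On each line of a grid of mesh \<open>e\<close>, the increments of \<open>h\<close> along the partition of that line are bounded by
integrals of \<open>norm v\<close> against box bumps.  The sum of these box bumps over all lines and all partition intervals
telescopes in both directions and is at most \<open>(smooth_step 1)\<^sup>2\<close>.  The partitions may depend on the line
in any way, but their number \<open>K\<close> of intervals may not: this makes the total error vanish with the
modulus of continuity of \<open>h\<close> as \<open>e\<close> tends to \<open>0\<close>.
\<close>

lemma weak_derivative_variation_bound:
  fixes h v :: "complex \<Rightarrow> complex"
  assumes h: "continuous_on UNIV h" and weak: "weak_partial_derivative (ball 0 3) h \<i> v"
    and v: "integrable (lebesgue_on (ball 0 3)) v"
    and ab: "a \<in> {-1..1}" "b \<in> {-1..1}" "a < b"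
    and var: "\<And>x. x \<in> {a..b} \<Longrightarrow> \<exists>t::nat \<Rightarrow> real. mono t \<and> (\<forall>k. t k \<in> {-1..1}) \<and>
        L \<le> (\<Sum>k<K. norm (h (Complex x (t (Suc k))) - h (Complex x (t k))))"
  shows "L * (b - a) \<le> (smooth_step 1)\<^sup>2 / bump_kernel_mass * (LINT w|lebesgue_on (ball 0 3). norm (v w))"
proof -
  obtain t where t: "\<And>x. x \<in> {a..b} \<Longrightarrow> mono (t x)"
      "\<And>x k. x \<in> {a..b} \<Longrightarrow> t x k \<in> {-1..1}"
      "\<And>x. x \<in> {a..b} \<Longrightarrow> L \<le> (\<Sum>k<K. norm (h (Complex x (t x (Suc k))) - h (Complex x (t x k))))"
    using var by metis
  define N where "N = (LINT w|lebesgue_on (ball 0 3). norm (v w))"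
  define S where "S = smooth_step 1"
  define \<kappa> where "\<kappa> = bump_kernel_mass"
  have \<kappa>: "0 < \<kappa>" using bump_kernel_mass_pos by (simp add: \<kappa>_def)
  have S: "0 < S" using smooth_step_pos by (simp add: S_def)
  have meas: "box_bump e x r s \<in> borel_measurable (lebesgue_on (ball 0 3))" for e x r s
  proof (rule continuous_imp_measurable_on_sets_lebesgue)
    show "continuous_on (ball 0 3) (box_bump e x r s)"
      unfolding box_bump_def[abs_def] divide_inverse
      by (intro continuous_intros continuous_on_compose2[OF smooth_step_continuous[of UNIV]]) auto
  qed auto
  have bd: "L * (b - a) * \<kappa> \<le> S\<^sup>2 * N + 2 * \<kappa> * (b - a) * K * \<omega>" if "0 < \<omega>" for \<omega>
  proof -
    have "uniformly_continuous_on (cball 0 3) h"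
      using h continuous_on_subset by (blast intro: compact_uniformly_continuous compact_cball)
    then obtain d where d: "d > 0"
      "\<And>w z. z \<in> cball 0 3 \<Longrightarrow> w \<in> cball 0 3 \<Longrightarrow> dist w z < d \<Longrightarrow> dist (h w) (h z) < \<omega>"
      using \<open>0 < \<omega>\<close> unfolding uniformly_continuous_on_def by meson
    \<comment> \<open>The mesh \<open>e\<close> of the grid has to satisfy \<open>4 e < 1\<close> and \<open>4 e < d\<close>.\<close>
    obtain J :: nat where J: "(b - a) * (4 + 4 / d) < J" using reals_Archimedean2 by blast
    define e where "e = (b - a) / J"
    have "0 < (b - a) * (4 + 4 / d)" using ab d(1) by (intro mult_pos_pos add_pos_pos) auto
    then have J0: "0 < real J" using J by linarith
    then have e: "0 < e" using ab by (simp add: e_def)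
    have "e * (4 + 4 / d) < 1" using J J0 by (simp add: e_def field_simps)
    moreover have "e * (4 + 4 / d) = 4 * e + 4 * e / d" by (simp add: field_simps)
    moreover have "0 < 4 * e / d" "0 < 4 * e" using e d by auto
    ultimately have e4: "4 * e < 1" and "4 * e / d < 1" by linarith+
    then have ed: "4 * e < d" using d(1) by (simp add: field_simps)
    have om: "norm (h w - h z) \<le> \<omega>" if "z \<in> cball 0 2" "dist w z \<le> 3 * e" for w z
    proof -
      have "norm w \<le> norm z + dist w z" by norm
      then have "w \<in> cball 0 3" "dist w z < d" using that e e4 ed by auto
      then show ?thesis using d(2)[of z w] that by (simp add: dist_norm)
    qed
    define x where "x j = a + real j * e" for j :: nat
    have xin: "x j \<in> {a..b}" if "j < J" for j
    proof -
      have "real j * e \<le> real J * e" using that e by (intro mult_right_mono) auto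
      moreover have "0 \<le> real j * e" using e by simp
      moreover have "real J * e = b - a" using J0 by (simp add: e_def)
      ultimately show ?thesis by (simp add: x_def)
    qed
    have xs: "x (Suc j) = x j + e" for j by (simp add: x_def algebra_simps)
    define I where "I j k = (LINT w|lebesgue_on (ball 0 3). box_bump e (x j) (t (x j) k) (t (x j) (Suc k)) w * norm (v w))" for j k
    have bb: "\<bar>box_bump e y r s w\<bar> \<le> S * S" if "r \<le> s" for y r s w
      using that e smooth_step_diff_nonneg[of r s e] smooth_step_diff_nonneg[of y "y + e" e]
      unfolding box_bump_def abs_mult S_def
      by (intro mult_mono) (auto intro: smooth_step_diff_le smooth_step_nonneg)
    have int: "integrable (lebesgue_on (ball 0 3)) (\<lambda>w. box_bump e y r s w * norm (v w))" if "r \<le> s" for y r s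
      by (rule Bochner_Integration.integrable_bound[of _ "\<lambda>w. (S * S) * norm (v w)"])
        (use v bb[OF that] S in \<open>auto intro!: borel_measurable_times meas mult_mono simp: abs_mult\<close>)
    have one: "e * \<kappa> * norm (h (Complex (x j) (t (x j) (Suc k))) - h (Complex (x j) (t (x j) k)))
        \<le> I j k + 2 * (e * \<kappa> * \<omega>)" if "j < J" for j k
      unfolding I_def \<kappa>_def
      using e e4 ab xin[OF that] t(1,2)[OF xin[OF that]] om
      by (intro weak_derivative_increment[OF h weak v]) (auto simp: mono_iff_le_Suc)
    have row: "e * \<kappa> * L \<le> (\<Sum>k<K. I j k) + K * (2 * (e * \<kappa> * \<omega>))" if "j < J" for j
    proof -
      have "e * \<kappa> * L \<le> e * \<kappa> * (\<Sum>k<K. norm (h (Complex (x j) (t (x j) (Suc k))) - h (Complex (x j) (t (x j) k))))"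
        using t(3)[OF xin[OF that]] e \<kappa> by (intro mult_left_mono) auto
      also have "\<dots> \<le> (\<Sum>k<K. I j k + 2 * (e * \<kappa> * \<omega>))"
        unfolding sum_distrib_left by (intro sum_mono one that)
      finally show ?thesis by (simp add: sum.distrib)
    qed
    have "(b - a) * \<kappa> * L = (\<Sum>j<J. e * \<kappa> * L)" using J0 by (simp add: e_def)
    also have "\<dots> \<le> (\<Sum>j<J. (\<Sum>k<K. I j k) + K * (2 * (e * \<kappa> * \<omega>)))"
      by (intro sum_mono row) auto
    also have "\<dots> = (\<Sum>j<J. \<Sum>k<K. I j k) + 2 * \<kappa> * (b - a) * K * \<omega>"
      using J0 by (simp add: sum.distrib e_def)
    also have "(\<Sum>j<J. \<Sum>k<K. I j k) = (LINT w|lebesgue_on (ball 0 3). 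
        (\<Sum>j<J. \<Sum>k<K. box_bump e (x j) (t (x j) k) (t (x j) (Suc k)) w * norm (v w)))"
      unfolding I_def using t(1)[OF xin]
      by (subst Bochner_Integration.integral_sum; (intro Bochner_Integration.integrable_sum int sum.cong refl)?)
        (auto simp: mono_iff_le_Suc intro!: sum.cong Bochner_Integration.integral_sum[symmetric] int)
    also have "\<dots> \<le> (LINT w|lebesgue_on (ball 0 3). (S * S) * norm (v w))"
    proof (rule integral_mono)
      show "integrable (lebesgue_on (ball 0 3))
         (\<lambda>w. \<Sum>j<J. \<Sum>k<K. box_bump e (x j) (t (x j) k) (t (x j) (Suc k)) w * norm (v w))"
        using t(1)[OF xin] by (intro Bochner_Integration.integrable_sum int) (auto simp: mono_iff_le_Suc)
      show "integrable (lebesgue_on (ball 0 3)) (\<lambda>w. (S * S) * norm (v w))" using v by simp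
      fix w
      define X where "X j = smooth_step ((Re w - x j) / e)" for j
      define T where "T j k = smooth_step ((Im w - t (x j) k) / e)" for j k
      have "(\<Sum>k<K. box_bump e (x j) (t (x j) k) (t (x j) (Suc k)) w) \<le> (X j - X (Suc j)) * S" if "j < J" for j
      proof -
        have "(\<Sum>k<K. box_bump e (x j) (t (x j) k) (t (x j) (Suc k)) w) = (X j - X (Suc j)) * (\<Sum>k<K. T j k - T j (Suc k))"
          by (simp add: box_bump_def X_def T_def xs sum_distrib_left)
        also have "(\<Sum>k<K. T j k - T j (Suc k)) = T j 0 - T j K" by (rule sum_lessThan_telescope')
        also have "(X j - X (Suc j)) * (T j 0 - T j K) \<le> (X j - X (Suc j)) * S"
          using e smooth_step_diff_nonneg[of "x j" "x j + e" e]
          by (intro mult_left_mono) (auto simp: X_def T_def S_def xs smooth_step_diff_le)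
        finally show ?thesis .
      qed
      then have "(\<Sum>j<J. \<Sum>k<K. box_bump e (x j) (t (x j) k) (t (x j) (Suc k)) w) \<le> (\<Sum>j<J. (X j - X (Suc j)) * S)"
        by (intro sum_mono) auto
      also have "\<dots> = (X 0 - X J) * S" by (simp flip: sum_distrib_right add: sum_lessThan_telescope')
      also have "\<dots> \<le> S * S" using S by (intro mult_right_mono) (auto simp: X_def S_def smooth_step_diff_le)
      finally have "(\<Sum>j<J. \<Sum>k<K. box_bump e (x j) (t (x j) k) (t (x j) (Suc k)) w) * norm (v w) \<le> (S * S) * norm (v w)"
        by (intro mult_right_mono) auto
      then show "(\<Sum>j<J. \<Sum>k<K. box_bump e (x j) (t (x j) k) (t (x j) (Suc k)) w * norm (v w)) \<le> (S * S) * norm (v w)"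
        by (simp add: sum_distrib_right)
    qed
    also have "\<dots> = S\<^sup>2 * N" by (simp add: N_def power2_eq_square)
    finally show ?thesis by (simp add: mult_ac)
  qed
  have "L * (b - a) * \<kappa> \<le> S\<^sup>2 * N"
  proof (rule field_le_epsilon)
    fix \<delta> :: real assume "0 < \<delta>"
    define c where "c = 2 * \<kappa> * (b - a) * K"
    have c: "0 \<le> c" using \<kappa> ab by (simp add: c_def)
    have "L * (b - a) * \<kappa> \<le> S\<^sup>2 * N + c * (\<delta> / (c + 1))"
    proof -
      have "0 < \<delta> / (c + 1)" using c \<open>0 < \<delta>\<close> by simp
      from bd[OF this] show ?thesis by (simp add: c_def)
    qed
    also have "c * (\<delta> / (c + 1)) \<le> \<delta>" using c \<open>0 < \<delta>\<close> by (simp add: field_simps)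
    finally show "L * (b - a) * \<kappa> \<le> S\<^sup>2 * N + \<delta>" by simp
  qed
  then show ?thesis using \<kappa> by (simp add: N_def S_def \<kappa>_def field_simps)
qed

section \<open>Classical derivatives and Sobolev classes\<close>

lemma has_vector_derivative_along_line:
  fixes F :: "'a::real_normed_vector \<Rightarrow> 'b::real_normed_vector"
  assumes "((\<lambda>t. F ((z + s *\<^sub>R b) + t *\<^sub>R b)) has_vector_derivative D) (at 0)"
  shows "((\<lambda>t. F (z + t *\<^sub>R b)) has_vector_derivative D) (at s)"
proof -
  have "(((\<lambda>t. F ((z + s *\<^sub>R b) + t *\<^sub>R b)) \<circ> (\<lambda>t. t - s)) has_vector_derivative 1 *\<^sub>R D) (at s)"
    by (rule vector_diff_chain_at) (use assms in \<open>auto intro!: derivative_eq_intros\<close>)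
  then show ?thesis by (simp add: o_def algebra_simps)
qed

lemma line_increment_bound:
  fixes F :: "'a::real_normed_vector \<Rightarrow> 'b::real_normed_vector"
  assumes der: "\<And>z. ((\<lambda>t. F (z + t *\<^sub>R b)) has_vector_derivative F' z) (at 0)"
    and bnd: "\<And>z. norm (F' z) \<le> C"
  shows "norm (F (z + t *\<^sub>R b) - F z) \<le> C * \<bar>t\<bar>"
proof -
  have C: "0 \<le> C" using bnd[of z] norm_ge_zero order_trans by blast
  have "norm (F (z + t *\<^sub>R b) - F (z + 0 *\<^sub>R b)) \<le> C * norm (t - 0)"
  proof (rule differentiable_bound[of UNIV])
    show "((\<lambda>t. F (z + t *\<^sub>R b)) has_derivative (\<lambda>r. r *\<^sub>R F' (z + s *\<^sub>R b))) (at s within UNIV)" for s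
      using has_vector_derivative_along_line[OF der, of z s] unfolding has_vector_derivative_def .
    show "onorm (\<lambda>r. r *\<^sub>R F' (z + s *\<^sub>R b)) \<le> C" for s
      by (rule onorm_bound) (use bnd[of "z + s *\<^sub>R b"] C in \<open>auto simp: mult.commute[of C] intro!: mult_left_mono\<close>)
  qed auto
  then show ?thesis by simp
qed

lemma difference_quotients_tendsto:
  fixes F :: "'a::real_normed_vector \<Rightarrow> 'b::real_normed_vector"
  assumes "((\<lambda>t. F (z + t *\<^sub>R b)) has_vector_derivative D) (at 0)"
  shows "(\<lambda>n. real (Suc n) *\<^sub>R (F (z + (1 / real (Suc n)) *\<^sub>R b) - F z)) \<longlonglongrightarrow> D"
proof -
  have "((\<lambda>t. (F (z + t *\<^sub>R b) - F z) /\<^sub>R t) \<longlongrightarrow> D) (at 0)"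
  proof -
    have "((\<lambda>t. norm ((F (z + t *\<^sub>R b) - F z) - t *\<^sub>R D) / norm t) \<longlongrightarrow> 0) (at 0)"
      using assms unfolding has_vector_derivative_def has_derivative_iff_norm by simp
    then have "((\<lambda>t. norm ((F (z + t *\<^sub>R b) - F z) /\<^sub>R t - D)) \<longlongrightarrow> 0) (at 0)"
    proof (rule Lim_transform_eventually)
      have "norm ((F (z + t *\<^sub>R b) - F z) - t *\<^sub>R D) / norm t = norm ((F (z + t *\<^sub>R b) - F z) /\<^sub>R t - D)"
        if "t \<noteq> 0" for t
      proof -
        have "(F (z + t *\<^sub>R b) - F z) /\<^sub>R t - D = inverse t *\<^sub>R ((F (z + t *\<^sub>R b) - F z) - t *\<^sub>R D)"
          using that by (simp add: scaleR_diff_right)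
        then show ?thesis by (simp add: divide_inverse mult.commute)
      qed
      then show "\<forall>\<^sub>F t in at 0. norm ((F (z + t *\<^sub>R b) - F z) - t *\<^sub>R D) / norm t = norm ((F (z + t *\<^sub>R b) - F z) /\<^sub>R t - D)"
        by (auto simp: eventually_at_filter)
    qed
    then show ?thesis by (rule LIM_zero_cancel[OF tendsto_norm_zero_cancel])
  qed
  moreover have "filterlim (\<lambda>n. 1 / real (Suc n)) (at 0) sequentially"
    unfolding filterlim_at using LIMSEQ_Suc[OF lim_1_over_n[where 'a = real]] by simp
  ultimately have "(\<lambda>n. (F (z + (1 / real (Suc n)) *\<^sub>R b) - F z) /\<^sub>R (1 / real (Suc n))) \<longlonglongrightarrow> D"
    by (rule filterlim_compose)
  then show ?thesis by simp
qed

text \<open>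
The difference quotients of \<open>F\<close> have integral \<open>0\<close> by translation invariance, and they converge to \<open>F'\<close> dominated by
a multiple of the indicator of a ball.
\<close>

lemma integral_directional_derivative_0:
  fixes F :: "'a::euclidean_space \<Rightarrow> 'b::euclidean_space"
  assumes cont: "continuous_on UNIV F" and S: "compact S" "\<And>z. z \<notin> S \<Longrightarrow> F z = 0"
    and der: "\<And>z. ((\<lambda>t. F (z + t *\<^sub>R b)) has_vector_derivative F' z) (at 0)"
    and bnd: "\<And>z. norm (F' z) \<le> C"
  shows "integrable lborel F'" "(LINT z|lborel. F' z) = 0"
proof -
  obtain R where R: "\<And>z. z \<in> S \<Longrightarrow> norm z \<le> R" using S(1) compact_imp_bounded bounded_iff by metis
  have meas: "F \<in> borel_measurable borel" using cont by (rule borel_measurable_continuous_onI)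
  have int: "integrable lborel F" by (rule continuous_compact_support_integrable[OF cont S])
  define s where "s n z = real (Suc n) *\<^sub>R (F (z + (1 / real (Suc n)) *\<^sub>R b) - F z)" for n z
  have lim: "(\<lambda>n. s n z) \<longlonglongrightarrow> F' z" for z
    unfolding s_def by (rule difference_quotients_tendsto[OF der])
  have smeas: "s n \<in> borel_measurable lborel" for n
    unfolding s_def[abs_def] using meas by measurable
  have F'meas: "F' \<in> borel_measurable lborel"
    by (rule borel_measurable_LIMSEQ_metric[OF smeas lim])
  define w :: "'a \<Rightarrow> real" where "w z = indicator (cball 0 (R + norm b)) z * C" for z
  have w: "integrable lborel w" unfolding w_def
    by (intro integrable_mult_left integrable_real_indicator) (use emeasure_lborel_cball_finite[of "0::'a" "R + norm b"] in \<open>auto simp: less_top[symmetric]\<close>)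
  have C: "0 \<le> C" using bnd norm_ge_zero order_trans by blast
  have sw: "norm (s n z) \<le> w z" for n z
  proof (cases "norm z \<le> R + norm b")
    case True
    have "norm (s n z) \<le> real (Suc n) * (C * \<bar>1 / real (Suc n)\<bar>)"
      unfolding s_def norm_scaleR using line_increment_bound[OF der bnd, of z "1 / real (Suc n)"]
      by (intro mult_mono) auto
    then show ?thesis using True by (simp add: w_def)
  next
    case False
    have "norm ((1 / real (Suc n)) *\<^sub>R b) \<le> norm b" unfolding norm_scaleR by (rule mult_left_le_one_le) auto
    moreover have "norm z \<le> norm (z + (1 / real (Suc n)) *\<^sub>R b) + norm ((1 / real (Suc n)) *\<^sub>R b)"
      using norm_triangle_ineq4[of "z + (1 / real (Suc n)) *\<^sub>R b" "(1 / real (Suc n)) *\<^sub>R b"] by simp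
    ultimately have "\<not> norm (z + (1 / real (Suc n)) *\<^sub>R b) \<le> R" using False by linarith
    then have "z + (1 / real (Suc n)) *\<^sub>R b \<notin> S" using R by blast
    moreover have "z \<notin> S" using False R[of z] norm_ge_zero[of b] by linarith
    ultimately have "s n z = 0" using S(2) by (simp add: s_def)
    then show ?thesis using C by (simp add: w_def)
  qed
  have sw': "AE z in lborel. norm (s n z) \<le> w z" for n using sw by simp
  have lim': "AE z in lborel. (\<lambda>n. s n z) \<longlonglongrightarrow> F' z" using lim by simp
  show "integrable lborel F'"
    by (rule integrable_dominated_convergence[OF F'meas smeas w lim' sw'])
  have "(\<lambda>n. LINT z|lborel. s n z) \<longlonglongrightarrow> (LINT z|lborel. F' z)"
    by (rule integral_dominated_convergence[OF F'meas smeas w lim' sw'])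
  moreover have "(LINT z|lborel. s n z) = 0" for n
  proof -
    have "(LINT z|lborel. s n z) = real (Suc n) *\<^sub>R ((LINT z|lborel. F ((1 / real (Suc n)) *\<^sub>R b + z)) - (LINT z|lborel. F z))"
      unfolding s_def using int lborel_integrable_translation[OF int]
      by (simp add: add.commute[of _ "_ *\<^sub>R b"] del: of_nat_Suc)
    then show ?thesis by (simp only: lborel_integral_translation[OF meas]) simp
  qed
  ultimately show "(LINT z|lborel. F' z) = 0" by (simp add: LIMSEQ_const_iff)
qed

text \<open>
Integration by parts: the product of \<open>u\<close> with a test function, extended by \<open>0\<close>, is continuous with
compact support, and its derivative along \<open>b\<close> is bounded and has integral \<open>0\<close>.
\<close>

lemma weak_partial_derivative_classical:
  fixes u v :: "'a::euclidean_space \<Rightarrow> 'b::euclidean_space"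
  assumes \<Omega>: "open \<Omega>" and cont: "continuous_on \<Omega> u"
    and der: "\<And>z. z \<in> \<Omega> \<Longrightarrow> ((\<lambda>t. u (z + t *\<^sub>R b)) has_vector_derivative v z) (at 0)"
    and bnd: "\<And>K. compact K \<Longrightarrow> K \<subseteq> \<Omega> \<Longrightarrow> \<exists>C. \<forall>z\<in>K. norm (v z) \<le> C"
  shows "weak_partial_derivative \<Omega> u b v"
  unfolding weak_partial_derivative_def
proof (intro allI impI)
  fix \<psi> assume "test_function \<Omega> \<psi>"
  define K where "K = closure {z. \<psi> z \<noteq> 0}"
  define D where "D z = frechet_derivative \<psi> (at z) b" for z
  have K: "compact K" "K \<subseteq> \<Omega>" and tcd: "\<And>k. times_cont_differentiable k \<psi>"
    using \<open>test_function \<Omega> \<psi>\<close> by (auto simp: test_function_def K_def)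
  have \<psi>0: "\<psi> z = 0" if "z \<notin> K" for z using that closure_subset by (force simp: K_def)
  have \<psi>d: "(\<psi> has_derivative frechet_derivative \<psi> (at z)) (at z)" for z
    using tcd[of 1] by (auto simp: frechet_derivative_works[symmetric] differentiable_on_def)
  have \<psi>c: "continuous_on S \<psi>" for S
    using tcd[of 0] continuous_on_subset by auto
  have Dc: "continuous_on S D" for S
    using tcd[of 1] continuous_on_subset unfolding D_def[abs_def] by auto
  have oK: "open (- K)" using K compact_imp_closed by blast
  have D0: "D z = 0" if "z \<notin> K" for z
  proof -
    have "(\<psi> has_derivative (\<lambda>_. 0)) (at z)"
      by (rule has_derivative_transform_within_open[OF has_derivative_const oK]) (use that \<psi>0 in auto)
    then show ?thesis by (simp add: D_def frechet_derivative_at[symmetric])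
  qed
  have \<psi>line: "((\<lambda>t. \<psi> (z + t *\<^sub>R b)) has_vector_derivative D z) (at 0)" for z
  proof -
    have "((\<lambda>t. \<psi> (z + t *\<^sub>R b)) has_derivative (\<lambda>t. frechet_derivative \<psi> (at z) (t *\<^sub>R b))) (at 0)"
      by (rule has_derivative_compose[where g = \<psi>]) (auto intro!: derivative_eq_intros simp: \<psi>d)
    then show ?thesis
      using linear_cmul[OF has_derivative_linear[OF \<psi>d[of z]]]
      by (simp add: has_vector_derivative_def D_def)
  qed
  have glue: "continuous_on UNIV (\<lambda>z. if z \<in> \<Omega> then g z else 0)"
    if "continuous_on \<Omega> g" "\<And>z. z \<notin> K \<Longrightarrow> g z = 0" for g :: "'a \<Rightarrow> 'b"
  proof -
    have "continuous_on \<Omega> (\<lambda>z. if z \<in> \<Omega> then g z else 0)" using that(1) by (simp cong: continuous_on_cong)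
    moreover have "continuous_on (- K) (\<lambda>z. if z \<in> \<Omega> then g z else 0)"
      using continuous_on_const[of "-K" 0] by (rule continuous_on_eq) (use that(2) in auto)
    ultimately have "continuous_on (\<Omega> \<union> - K) (\<lambda>z. if z \<in> \<Omega> then g z else 0)"
      using \<Omega> oK by (intro continuous_on_open_Un) auto
    moreover have "\<Omega> \<union> - K = UNIV" using K by auto
    ultimately show ?thesis by simp
  qed
  define F where "F z = (if z \<in> \<Omega> then \<psi> z *\<^sub>R u z else 0)" for z
  define G where "G z = (if z \<in> \<Omega> then D z *\<^sub>R u z else 0)" for z
  define F' where "F' z = (if z \<in> \<Omega> then D z *\<^sub>R u z + \<psi> z *\<^sub>R v z else 0)" for z
  have Fc: "continuous_on UNIV F" unfolding F_def
    by (rule glue) (auto intro!: continuous_intros \<psi>c cont simp: \<psi>0)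
  have Gc: "continuous_on UNIV G" unfolding G_def
    by (rule glue) (auto intro!: continuous_intros Dc cont simp: D0)
  have F0: "F z = 0" if "z \<notin> K" for z using that by (simp add: F_def \<psi>0)
  have Fline: "((\<lambda>t. F (z + t *\<^sub>R b)) has_vector_derivative F' z) (at 0)" for z
  proof (cases "z \<in> \<Omega>")
    case True
    have "((\<lambda>t. \<psi> (z + t *\<^sub>R b) *\<^sub>R u (z + t *\<^sub>R b)) has_vector_derivative
        (\<psi> (z + 0 *\<^sub>R b) *\<^sub>R v z + D z *\<^sub>R u (z + 0 *\<^sub>R b))) (at 0)"
      using \<psi>line[of z] der[OF True]
      by (intro has_vector_derivative_scaleR) (auto simp: has_real_derivative_iff_has_vector_derivative)
    then have "((\<lambda>t. \<psi> (z + t *\<^sub>R b) *\<^sub>R u (z + t *\<^sub>R b)) has_vector_derivative F' z) (at 0)"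
      using True by (simp add: F'_def add.commute)
    then show ?thesis
    proof (rule has_vector_derivative_transform_within_open)
      show "open ((\<lambda>t. z + t *\<^sub>R b) -` \<Omega>)" by (intro open_vimage \<Omega> continuous_intros)
    qed (use True in \<open>auto simp: F_def\<close>)
  next
    case False
    then have "z \<notin> K" using K by auto
    have "((\<lambda>t. 0) has_vector_derivative F' z) (at 0)" using False by (simp add: F'_def)
    then show ?thesis
    proof (rule has_vector_derivative_transform_within_open)
      show "open ((\<lambda>t. z + t *\<^sub>R b) -` (- K))" by (intro open_vimage oK continuous_intros)
    qed (use \<open>z \<notin> K\<close> F0 in auto)
  qed
  have bK: "\<exists>C. \<forall>z\<in>K. norm (f z) \<le> C" if "continuous_on K f" for f :: "'a \<Rightarrow> 'c::real_normed_vector"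
    using compact_imp_bounded[OF compact_continuous_image[OF that K(1)]] by (auto simp: bounded_iff)
  obtain C1 where C1: "\<And>z. z \<in> K \<Longrightarrow> norm (D z *\<^sub>R u z) \<le> C1"
    using bK[OF continuous_on_scaleR[OF Dc continuous_on_subset[OF cont K(2)]]] by blast
  obtain C2 where C2: "\<And>z. z \<in> K \<Longrightarrow> \<bar>\<psi> z\<bar> \<le> C2"
    using bK[OF \<psi>c] by auto
  obtain C3 where C3: "\<And>z. z \<in> K \<Longrightarrow> norm (v z) \<le> C3" using bnd[OF K] by auto
  have F'bnd: "norm (F' z) \<le> \<bar>C1\<bar> + \<bar>C2\<bar> * \<bar>C3\<bar>" for z
  proof (cases "z \<in> K")
    case True
    have "norm (F' z) \<le> norm (D z *\<^sub>R u z) + norm (\<psi> z *\<^sub>R v z)"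
      by (simp add: F'_def norm_triangle_ineq del: norm_scaleR)
    also have "norm (\<psi> z *\<^sub>R v z) \<le> \<bar>C2\<bar> * \<bar>C3\<bar>"
      unfolding norm_scaleR using C2[OF True] C3[OF True] by (intro mult_mono) auto
    finally show ?thesis using C1[OF True] by linarith
  next
    case False
    then show ?thesis by (simp add: F'_def \<psi>0 D0)
  qed
  note I = integral_directional_derivative_0[OF Fc K(1) F0 Fline F'bnd]
  have Gi: "integrable lborel G"
    by (rule continuous_compact_support_integrable[OF Gc K(1)]) (simp add: G_def D0)
  have H: "(\<lambda>z. F' z - G z) = (\<lambda>z. if z \<in> \<Omega> then \<psi> z *\<^sub>R v z else 0)"
    by (auto simp: F'_def G_def)
  have "(LINT z|lebesgue_on \<Omega>. D z *\<^sub>R u z) = (LINT z|lborel. G z)"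
    unfolding G_def using Gc by (intro lebesgue_on_integral_eq_lborel \<Omega>) (simp add: G_def borel_measurable_continuous_onI)
  moreover have "(LINT z|lebesgue_on \<Omega>. \<psi> z *\<^sub>R v z) = (LINT z|lborel. F' z - G z)"
    unfolding H
  proof (rule lebesgue_on_integral_eq_lborel[OF \<Omega>])
    show "(\<lambda>z. if z \<in> \<Omega> then \<psi> z *\<^sub>R v z else 0) \<in> borel_measurable borel"
      unfolding H[symmetric] using I(1) Gi by auto
  qed
  ultimately show "(LINT z|lebesgue_on \<Omega>. frechet_derivative \<psi> (at z) b *\<^sub>R u z) = - (LINT z|lebesgue_on \<Omega>. \<psi> z *\<^sub>R v z)"
    using I Gi by (simp add: D_def)
qed

text \<open>
On the annulus where \<open>1 - \<bar>z\<bar>\<^sup>2\<close> lies between \<open>4\<^sup>-\<^sup>n\<^sup>-\<^sup>1\<close> and \<open>4\<^sup>-\<^sup>n\<close> the integrand is at most \<open>2\<^sup>n\<^sup>+\<^sup>1\<close>, while the area of the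
annulus is of order \<open>4\<^sup>-\<^sup>n\<close>.
\<close>

lemma integrable_inverse_sqrt_boundary_distance:
  "integrable (lebesgue_on (ball 0 1)) (\<lambda>z::complex. (1 - (norm z)\<^sup>2) powr (- 1/2))"
proof -
  define w where "w z = (1 - (norm z)\<^sup>2) powr (- 1/2)" for z :: complex
  define A where "A n = {z::complex. (1/4) ^ Suc n < 1 - (norm z)\<^sup>2 \<and> 1 - (norm z)\<^sup>2 \<le> (1/4) ^ n}" for n
  define V where "V = unit_ball_vol 2"
  have wm: "w \<in> borel_measurable borel" unfolding w_def by measurable
  have Am: "A n \<in> sets lborel" for n unfolding A_def by measurable
  have Ae: "emeasure lborel (A n) \<le> ennreal (V * (1/4) ^ n)" for n
  proof -
    define r where "r m = sqrt (1 - (1/4) ^ m)" for m :: nat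
    have p: "(1/4::real) ^ m \<le> 1" for m by (simp add: power_le_one)
    have r2: "(r m)\<^sup>2 = 1 - (1/4) ^ m" "0 \<le> r m" for m using p by (auto simp: r_def)
    have iff: "norm z < r m \<longleftrightarrow> (1/4) ^ m < 1 - (norm z)\<^sup>2" for z :: complex and m
      using r2[of m] power_mono_iff[of "r m" "norm z" 2] by (auto simp: not_le[symmetric])
    have "A n \<subseteq> ball 0 (r (Suc n)) - ball 0 (r n)"
      by (auto simp: A_def iff not_less simp del: power_Suc)
    then have "emeasure lborel (A n) \<le> emeasure lborel (ball (0::complex) (r (Suc n)) - ball 0 (r n))"
      by (intro emeasure_mono) auto
    also have "\<dots> = emeasure lborel (ball (0::complex) (r (Suc n))) - emeasure lborel (ball (0::complex) (r n))"
    proof (rule emeasure_Diff)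
      have "(1/4::real) ^ Suc n \<le> (1/4) ^ n" by simp
      then have "r n \<le> r (Suc n)" unfolding r_def by (intro real_sqrt_le_mono) linarith
      then show "ball (0::complex) (r n) \<subseteq> ball 0 (r (Suc n))" by auto
      show "emeasure lborel (ball (0::complex) (r n)) \<noteq> \<infinity>"
        using emeasure_lborel_ball_finite[of "0::complex" "r n"] by simp
    qed auto
    also have "\<dots> = ennreal (V * (r (Suc n))\<^sup>2) - ennreal (V * (r n)\<^sup>2)"
      using r2(2) by (simp add: emeasure_ball V_def)
    also have "\<dots> = ennreal (V * (r (Suc n))\<^sup>2 - V * (r n)\<^sup>2)"
      by (intro ennreal_minus) (simp add: V_def)
    also have "\<dots> \<le> ennreal (V * (1/4) ^ n)"
    proof (rule ennreal_leI)
      have "V * (r (Suc n))\<^sup>2 - V * (r n)\<^sup>2 = V * ((1/4) ^ n - (1/4) ^ Suc n)"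
        unfolding r2 by (simp add: algebra_simps)
      also have "\<dots> \<le> V * (1/4) ^ n" by (intro mult_left_mono) (auto simp: V_def)
      finally show "V * (r (Suc n))\<^sup>2 - V * (r n)\<^sup>2 \<le> V * (1/4) ^ n" .
    qed
    finally show ?thesis .
  qed
  have wA: "w z \<le> 2 ^ Suc n" if "z \<in> A n" for z n
  proof -
    have "w z \<le> ((1/4) ^ Suc n) powr (- 1/2)"
      unfolding w_def using that by (intro powr_mono2') (auto simp: A_def simp del: power_Suc)
    also have "\<dots> = 2 ^ Suc n"
    proof -
      have "((1/4::real) ^ Suc n) = (2 powr (- 2)) powr real (Suc n)"
        using powr_realpow[of "1/4::real" "Suc n"] by (simp add: powr_minus del: power_Suc of_nat_Suc)
      also have "\<dots> powr (- 1/2) = 2 powr real (Suc n)"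
        by (simp add: powr_powr del: power_Suc of_nat_Suc)
      finally show ?thesis by (simp add: powr_realpow del: power_Suc of_nat_Suc)
    qed
    finally show ?thesis .
  qed
  have cover: "\<exists>n. z \<in> A n" if "norm z < 1" for z
  proof -
    define d where "d = 1 - (norm z)\<^sup>2"
    have d: "0 < d" "d \<le> 1" using that by (auto simp: d_def abs_square_less_1)
    obtain m where m: "(1/4) ^ m < d" using real_arch_pow_inv[OF d(1), of "1/4"] by auto
    define N where "N = (LEAST m. (1/4) ^ m < d)"
    have N: "(1/4) ^ N < d" unfolding N_def using m by (rule LeastI)
    then have "N \<noteq> 0" using d by (cases N) auto
    then obtain n where n: "N = Suc n" by (cases N) auto
    have "\<not> (1/4) ^ n < d" using not_less_Least[of n "\<lambda>m. (1/4) ^ m < d"] n by (simp add: N_def)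
    then show ?thesis using N n by (auto simp: A_def d_def not_less simp del: power_Suc)
  qed
  have "(\<integral>\<^sup>+ z. ennreal (indicator (ball 0 1) z *\<^sub>R w z) \<partial>lborel)
      \<le> (\<integral>\<^sup>+ z. (\<Sum>n. ennreal (2 ^ Suc n) * indicator (A n) z) \<partial>lborel)"
  proof (intro nn_integral_mono)
    fix z :: complex
    show "ennreal (indicator (ball 0 1) z *\<^sub>R w z) \<le> (\<Sum>n. ennreal (2 ^ Suc n) * indicator (A n) z)"
    proof (cases "norm z < 1")
      case True
      then obtain n where n: "z \<in> A n" using cover by blast
      have "ennreal (w z) \<le> ennreal (2 ^ Suc n) * indicator (A n) z"
        using n wA[OF n] by (simp add: ennreal_leI del: power_Suc)
      also have "\<dots> \<le> (\<Sum>n. ennreal (2 ^ Suc n) * indicator (A n) z)"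
      proof -
        define f where "f = (\<lambda>n. ennreal (2 ^ Suc n) * indicator (A n) z)"
        have "sum f {n} \<le> suminf f" by (intro sum_le_suminf summableI) auto
        then have "f n \<le> suminf f" by simp
        then show ?thesis unfolding f_def .
      qed
      finally show ?thesis using True by simp
    qed simp
  qed
  also have "\<dots> = (\<Sum>n. ennreal (2 ^ Suc n) * emeasure lborel (A n))"
    using Am by (subst nn_integral_suminf) (auto simp: nn_integral_cmult_indicator)
  also have "\<dots> \<le> (\<Sum>n. ennreal (2 * V * (1/2) ^ n))"
  proof (intro suminf_le allI summableI)
    fix n
    have "ennreal (2 ^ Suc n) * emeasure lborel (A n) \<le> ennreal (2 ^ Suc n) * ennreal (V * (1/4) ^ n)"
      by (intro mult_left_mono Ae) auto
    also have "\<dots> = ennreal (2 ^ Suc n * (V * (1/4) ^ n))" by (simp add: ennreal_mult'' V_def)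
    also have "2 ^ Suc n * (V * (1/4) ^ n) = 2 * V * (1/2) ^ n"
      by (simp add: power_mult_distrib[symmetric] flip: power_mult_distrib)
    finally show "ennreal (2 ^ Suc n) * emeasure lborel (A n) \<le> ennreal (2 * V * (1/2) ^ n)" .
  qed
  also have "\<dots> = ennreal (\<Sum>n. 2 * V * (1/2) ^ n)"
    by (intro suminf_ennreal2 summable_mult summable_geometric) (auto simp: V_def)
  also have "\<dots> < \<infinity>" by simp
  finally have fin: "(\<integral>\<^sup>+ z. ennreal (indicator (ball 0 1) z *\<^sub>R w z) \<partial>lborel) < \<infinity>" .
  have "integrable lborel (\<lambda>z. indicator (ball 0 1) z *\<^sub>R w z)"
  proof (rule integrableI_nonneg)
    show "(\<lambda>z. indicator (ball 0 1) z *\<^sub>R w z) \<in> borel_measurable lborel"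
      using wm by (intro borel_measurable_scaleR borel_measurable_indicator) auto
    show "AE z in lborel. 0 \<le> indicator (ball 0 1) z *\<^sub>R w z" by (simp add: w_def)
  qed (rule fin)
  then have "integrable lebesgue (\<lambda>z. indicator (ball 0 1) z *\<^sub>R w z)"
    by (subst integrable_completion) auto
  then show ?thesis unfolding w_def[symmetric] by (subst integrable_restrict_space) auto
qed

text \<open>
A directional derivative is a pointwise limit of difference quotients.
\<close>

lemma directional_derivative_measurable:
  fixes u v :: "'a::euclidean_space \<Rightarrow> 'b::euclidean_space"
  assumes \<Omega>: "open \<Omega>" and cont: "continuous_on \<Omega> u"
    and der: "\<And>z. z \<in> \<Omega> \<Longrightarrow> ((\<lambda>t. u (z + t *\<^sub>R b)) has_vector_derivative v z) (at 0)"
  shows "v \<in> borel_measurable (lebesgue_on \<Omega>)"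
proof -
  define U where "U z = indicator \<Omega> z *\<^sub>R u z" for z
  have U: "U \<in> borel_measurable borel" unfolding U_def
    using \<Omega> cont by (intro borel_measurable_continuous_on_indicator) auto
  have "v \<in> borel_measurable (restrict_space borel \<Omega>)"
  proof (rule borel_measurable_LIMSEQ_metric)
    show "(\<lambda>z. real (Suc n) *\<^sub>R (U (z + (1 / real (Suc n)) *\<^sub>R b) - U z)) \<in> borel_measurable (restrict_space borel \<Omega>)" for n
      by (intro measurable_restrict_space1 borel_measurable_scaleR borel_measurable_diff
          measurable_compose[OF _ U] borel_measurable_const U) measurable
    show "(\<lambda>n. real (Suc n) *\<^sub>R (U (z + (1 / real (Suc n)) *\<^sub>R b) - U z)) \<longlonglongrightarrow> v z"
      if "z \<in> space (restrict_space borel \<Omega>)" for z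
    proof (rule difference_quotients_tendsto)
      have z: "z \<in> \<Omega>" using that by (simp add: space_restrict_space)
      show "((\<lambda>t. U (z + t *\<^sub>R b)) has_vector_derivative v z) (at 0)"
        using der[OF z]
      proof (rule has_vector_derivative_transform_within_open)
        show "open ((\<lambda>t. z + t *\<^sub>R b) -` \<Omega>)" by (intro open_vimage \<Omega> continuous_intros)
      qed (use z in \<open>auto simp: U_def\<close>)
    qed
  qed
  then have "(\<lambda>z. indicator \<Omega> z *\<^sub>R v z) \<in> borel_measurable borel"
    using \<Omega> by (subst (asm) borel_measurable_restrict_space_iff) auto
  then have "(\<lambda>z. indicator \<Omega> z *\<^sub>R v z) \<in> borel_measurable lebesgue"
    by (intro measurable_completion) simp
  then show ?thesis
    using \<Omega> by (subst borel_measurable_restrict_space_iff) auto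
qed

text \<open>
The bound on \<open>v\<close> serves twice: it makes \<open>v\<close> an \<open>L\<^sup>p\<close> function and bounds it on compact subsets of the disc.
\<close>

lemma in_W1p_ball_classical:
  fixes u :: "complex \<Rightarrow> complex"
  assumes cont: "continuous_on (cball 0 1) u"
    and der: "\<And>z b. norm z < 1 \<Longrightarrow> b \<in> Basis \<Longrightarrow> ((\<lambda>t. u (z + t *\<^sub>R b)) has_vector_derivative v b z) (at 0)"
    and bnd: "\<And>z b. norm z < 1 \<Longrightarrow> b \<in> Basis \<Longrightarrow> norm (v b z) powr p \<le> C * (1 - (norm z)\<^sup>2) powr (- 1/2)"
    and p: "1 \<le> p"
  shows "in_W1p p (ball 0 1) u"
proof -
  have cont': "continuous_on (ball 0 1) u" using cont by (rule continuous_on_subset) auto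
  have "bounded (u ` cball 0 1)" by (intro compact_imp_bounded compact_continuous_image cont) auto
  then obtain B where "\<forall>w\<in>u ` cball 0 1. norm w \<le> B" unfolding bounded_iff by blast
  then have B: "norm (u z) \<le> B" if "norm z \<le> 1" for z using that by simp
  have um: "u \<in> borel_measurable (lebesgue_on (ball 0 1))"
    by (rule continuous_imp_measurable_on_sets_lebesgue[OF cont']) auto
  have fin: "finite_measure (lebesgue_on (ball (0::complex) 1))"
    by (rule finite_measureI) (use emeasure_lborel_ball_finite[of "0::complex" 1] in \<open>simp add: emeasure_restrict_space\<close>)
  have u: "in_Lp p (ball 0 1) u"
    unfolding in_Lp_def
  proof (intro conjI um finite_measure.integrable_const_bound[OF fin])
    show "AE z in lebesgue_on (ball 0 1). norm (norm (u z) powr p) \<le> B powr p"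
    proof (rule AE_I2)
      fix z :: complex assume "z \<in> space (lebesgue_on (ball 0 1))"
      then have "norm (u z) powr p \<le> B powr p" using B[of z] p by (intro powr_mono2) auto
      then show "norm (norm (u z) powr p) \<le> B powr p" by simp
    qed
    show "(\<lambda>z. norm (u z) powr p) \<in> borel_measurable (lebesgue_on (ball 0 1))" using um by measurable
  qed
  have "in_Lp p (ball 0 1) (v b) \<and> weak_partial_derivative (ball 0 1) u b (v b)" if b: "b \<in> Basis" for b
  proof
    have vm: "v b \<in> borel_measurable (lebesgue_on (ball 0 1))"
      by (rule directional_derivative_measurable[OF open_ball cont', of b]) (use der b in auto)
    show "in_Lp p (ball 0 1) (v b)"
      unfolding in_Lp_def
    proof (intro conjI vm)
      show "integrable (lebesgue_on (ball 0 1)) (\<lambda>z. norm (v b z) powr p)"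
      proof (rule Bochner_Integration.integrable_bound)
        show "integrable (lebesgue_on (ball 0 1)) (\<lambda>z::complex. C * (1 - (norm z)\<^sup>2) powr (- 1/2))"
          using integrable_inverse_sqrt_boundary_distance by simp
        show "(\<lambda>z. norm (v b z) powr p) \<in> borel_measurable (lebesgue_on (ball 0 1))" using vm by measurable
        show "AE z in lebesgue_on (ball 0 1). norm (norm (v b z) powr p) \<le> norm (C * (1 - (norm z)\<^sup>2) powr (- 1/2))"
        proof (rule AE_I2)
          fix z :: complex assume "z \<in> space (lebesgue_on (ball 0 1))"
          then have "norm (v b z) powr p \<le> C * (1 - (norm z)\<^sup>2) powr (- 1/2)" using bnd[OF _ b] by simp
          then show "norm (norm (v b z) powr p) \<le> norm (C * (1 - (norm z)\<^sup>2) powr (- 1/2))"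
            by simp
        qed
      qed
    qed
    show "weak_partial_derivative (ball 0 1) u b (v b)"
    proof (rule weak_partial_derivative_classical[OF open_ball cont'])
      fix K :: "complex set" assume K: "compact K" "K \<subseteq> ball 0 1"
      have "continuous_on K (\<lambda>z. C * (1 - (norm z)\<^sup>2) powr (- 1/2))"
      proof (intro continuous_intros ballI)
        fix z assume "z \<in> K"
        then have "(norm z)\<^sup>2 < 1" using K(2) by (auto simp: abs_square_less_1)
        then show "1 - (norm z)\<^sup>2 \<noteq> 0" by simp
      qed
      then have "bounded ((\<lambda>z. C * (1 - (norm z)\<^sup>2) powr (- 1/2)) ` K)"
        by (intro compact_imp_bounded compact_continuous_image K)
      then obtain M where "\<forall>y\<in>(\<lambda>z. C * (1 - (norm z)\<^sup>2) powr (- 1/2)) ` K. norm y \<le> M"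
        unfolding bounded_iff by blast
      then have M: "C * (1 - (norm z)\<^sup>2) powr (- 1/2) \<le> M" if "z \<in> K" for z
        using that abs_le_D1 by fastforce
      have "norm (v b z) \<le> max 1 M" if "z \<in> K" for z
      proof (cases "norm (v b z) \<le> 1")
        case False
        then have "norm (v b z) \<le> norm (v b z) powr p"
          using p powr_mono[of 1 p "norm (v b z)"] by simp
        also have "\<dots> \<le> M" 
        proof -
          have "norm z < 1" using K(2) that by auto
          then show ?thesis using bnd[OF _ b, of z] M[OF that] by linarith
        qed
        finally show ?thesis by simp
      qed simp
      then show "\<exists>C. \<forall>z\<in>K. norm (v b z) \<le> C" by blast
    qed (use der b in auto)
  qed
  then show ?thesis using u unfolding in_W1p_def by blast
qed

section \<open>The boundary map and its extension to the disc\<close>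

text \<open>
The abscissa in the channel at which \<open>z\<close> is placed.  On the upper half circle it equals \<open>1 - Re z\<close>, on the lower half
circle \<open>(1 - Re z)\<^sup>2 / 2\<close>; the two agree at \<open>1\<close> and at \<open>-1\<close>.  This common formula is continuously differentiable in
the whole plane.
\<close>

definition position :: "complex \<Rightarrow> real" where
  "position z = ((1 - Re z)\<^sup>2 + (max (Im z) 0)\<^sup>2) / 2"

text \<open>
The height of the image of \<open>z\<close> above the lower wall of the channel.  It vanishes on the upper half circle.
The exponent makes the channel thin compared with the height \<open>x\<^sup>k\<close> of the oscillations at
abscissa \<open>x\<close>.
\<close>

definition gap :: "nat \<Rightarrow> complex \<Rightarrow> real" where
  "gap k z = max (- Im z) 0 ^ (4 * (k + 1))"

text \<open>
The wave \<open>x\<^sup>k cos (\<pi> / x\<^sup>k\<^sup>+\<^sup>2)\<close>, damped by the factor \<open>x\<^sup>k / (x\<^sup>k + d)\<close>.  The parameter \<open>d\<close> is the distance to the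
circle in the form \<open>1 - \<bar>z\<bar>\<^sup>2\<close>.
\<close>

definition ripple :: "nat \<Rightarrow> real \<Rightarrow> real \<Rightarrow> real" where
  "ripple k x d = x ^ (2 * k) * cos (pi / x ^ (k + 2)) / (x ^ k + d)"

definition channel_map :: "nat \<Rightarrow> complex \<Rightarrow> complex" where
  "channel_map k z = Complex (position z) (ripple k (position z) (1 - (norm z)\<^sup>2) + gap k z)"

lemma position_nonneg: "0 \<le> position z" by (simp add: position_def)

lemma position_le_2: "norm z \<le> 1 \<Longrightarrow> position z \<le> 2"
proof -
  assume "norm z \<le> 1"
  then have "(norm z)\<^sup>2 \<le> 1" "\<bar>Re z\<bar> \<le> 1" using abs_Re_le_cmod[of z] by (auto simp: abs_square_le_1)
  then have "(Re z)\<^sup>2 + (Im z)\<^sup>2 \<le> 1" "- 1 \<le> Re z" by (auto simp: cmod_power2)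
  moreover have "(max (Im z) 0)\<^sup>2 \<le> (Im z)\<^sup>2" by (auto simp: max_def)
  ultimately show ?thesis by (simp add: position_def power2_diff)
qed

lemma position_pos: "norm z < 1 \<Longrightarrow> 0 < position z"
proof -
  assume "norm z < 1"
  then have "Re z < 1" using complex_Re_le_cmod[of z] by simp
  then have "0 < (1 - Re z)\<^sup>2" by simp
  then show ?thesis by (simp add: position_def add_pos_nonneg)
qed

lemma ripple_bound: "0 \<le> x \<Longrightarrow> 0 \<le> d \<Longrightarrow> 0 < k \<Longrightarrow> \<bar>ripple k x d\<bar> \<le> x ^ k"
proof (cases "x = 0")
  case False
  assume "0 \<le> x" "0 \<le> d"
  with False have x: "0 < x ^ k" by simp
  have "\<bar>ripple k x d\<bar> = x ^ (2 * k) * \<bar>cos (pi / x ^ (k + 2))\<bar> / (x ^ k + d)"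
    using x \<open>0 \<le> x\<close> \<open>0 \<le> d\<close> by (simp add: ripple_def abs_mult)
  also have "\<dots> \<le> x ^ (2 * k) * 1 / (x ^ k)"
    using x \<open>0 \<le> d\<close> \<open>0 \<le> x\<close> by (intro frac_le mult_mono) auto
  also have "\<dots> = x ^ k" using x by (simp add: mult_2 power_add)
  finally show ?thesis .
qed (simp add: ripple_def power_0_left)

text \<open>
The only critical point is \<open>1\<close>, where the position vanishes and the quotient in the ripple takes the default
value \<open>0\<close>; there the bound \<open>x\<^sup>k\<close> for the ripple gives continuity.
\<close>

lemma channel_map_continuous:
  assumes "0 < k"
  shows "continuous_on (cball 0 1) (channel_map k)"
proof -
  have pc: "continuous_on S position" for S
    unfolding position_def by (intro continuous_intros) auto
  have gc: "continuous_on S (gap k)" for S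
    unfolding gap_def by (intro continuous_intros)
  have "continuous_on (cball 0 1) (\<lambda>z. ripple k (position z) (1 - (norm z)\<^sup>2))"
    unfolding continuous_on_def
  proof
    fix z :: complex assume z: "z \<in> cball 0 1"
    have "(position \<longlongrightarrow> position z) (at z within cball 0 1)" using pc z by (auto simp: continuous_on_def)
    moreover have d: "0 \<le> 1 - (norm w)\<^sup>2" if "w \<in> cball 0 1" for w :: complex
      using that by (simp add: abs_square_le_1)
    ultimately show "((\<lambda>z. ripple k (position z) (1 - (norm z)\<^sup>2)) \<longlongrightarrow> ripple k (position z) (1 - (norm z)\<^sup>2)) (at z within cball 0 1)"
    proof (cases "position z = 0")
      case False
      then have "position z ^ k + (1 - (norm z)\<^sup>2) \<noteq> 0"
        using d[OF z] position_nonneg[of z] by (intro less_imp_neq[symmetric] add_pos_nonneg) auto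
      then show ?thesis
        using False \<open>(position \<longlongrightarrow> position z) (at z within cball 0 1)\<close>
        unfolding ripple_def by (intro tendsto_intros) auto
    next
      case True
      have "((\<lambda>w. position w ^ k) \<longlongrightarrow> position z ^ k) (at z within cball 0 1)"
        using \<open>(position \<longlongrightarrow> position z) (at z within cball 0 1)\<close> by (intro tendsto_intros)
      moreover have "position z ^ k = 0" using True assms by simp
      ultimately have "((\<lambda>w. position w ^ k) \<longlongrightarrow> 0) (at z within cball 0 1)" by (simp only:)
      then have "((\<lambda>z. ripple k (position z) (1 - (norm z)\<^sup>2)) \<longlongrightarrow> 0) (at z within cball 0 1)"
      proof (rule Lim_null_comparison[rotated])
        show "\<forall>\<^sub>F w in at z within cball 0 1. norm (ripple k (position w) (1 - (norm w)\<^sup>2)) \<le> position w ^ k"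
          unfolding eventually_at_filter using d ripple_bound[OF position_nonneg _ assms]
          by (intro always_eventually) auto
      qed
      moreover have "ripple k (position z) (1 - (norm z)\<^sup>2) = 0" using True assms by (simp add: ripple_def power_0_left)
      ultimately show ?thesis by (simp only:)
    qed
  qed
  then show ?thesis unfolding channel_map_def Complex_eq by (intro continuous_intros pc gc)
qed

lemma positive_part_power_deriv:
  "((\<lambda>y. max y 0 ^ Suc (Suc n)) has_real_derivative real (n + 2) * max y 0 ^ Suc n) (at y)"
proof -
  consider "y > 0" | "y < 0" | "y = 0" by linarith
  then show ?thesis
  proof cases
    case 1
    have "((\<lambda>y. y ^ Suc (Suc n)) has_real_derivative real (n + 2) * max y 0 ^ Suc n) (at y)"
      using 1 DERIV_pow[of "Suc (Suc n)" y UNIV] by simp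
    then show ?thesis
      by (rule has_field_derivative_transform_within_open[where S = "{0<..}"]) (use 1 in auto)
  next
    case 2
    have "((\<lambda>y. 0) has_real_derivative real (n + 2) * max y 0 ^ Suc n) (at y)" using 2 by simp
    then show ?thesis
      by (rule has_field_derivative_transform_within_open[where S = "{..<0}"]) (use 2 in auto)
  next
    case 3
    have "((\<lambda>h. h ^ n * max h 0) \<longlongrightarrow> 0 ^ n * max 0 0) (at (0::real))" by (intro tendsto_intros)
    then have "((\<lambda>h. h ^ n * max h 0) \<longlongrightarrow> 0) (at (0::real))" by simp
    then have "((\<lambda>h. (max (0 + h) 0 ^ Suc (Suc n) - max 0 0 ^ Suc (Suc n)) / h) \<longlongrightarrow> 0) (at (0::real))"
      by (rule Lim_transform_eventually)
        (auto simp: eventually_at_filter max_def field_simps intro!: always_eventually)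
    with 3 show ?thesis by (simp add: DERIV_def)
  qed
qed

definition position_deriv :: "complex \<Rightarrow> complex \<Rightarrow> real" where
  "position_deriv b z = max (Im z) 0 * Im b - (1 - Re z) * Re b"

text \<open>
The derivative of the ripple along a curve on which \<open>x\<close> and \<open>d\<close> have the derivatives \<open>x'\<close> and \<open>d'\<close>.
\<close>

definition ripple_deriv :: "nat \<Rightarrow> real \<Rightarrow> real \<Rightarrow> real \<Rightarrow> real \<Rightarrow> real" where
  "ripple_deriv k x d x' d' =
     (2 * real k * x ^ (2 * k - 1) * cos (pi / x ^ (k + 2)) + pi * (real k + 2) * x ^ (k - 3) * sin (pi / x ^ (k + 2))) * x'
       / (x ^ k + d)
     - x ^ (2 * k) * cos (pi / x ^ (k + 2)) * (k * x ^ (k - 1) * x' + d') / (x ^ k + d)\<^sup>2"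

lemma ripple_has_derivative:
  assumes X: "(X has_real_derivative x') (at t)" and D: "(D has_real_derivative d') (at t)"
    and "0 < X t" "0 < D t" "3 \<le> k"
  shows "((\<lambda>t. ripple k (X t) (D t)) has_real_derivative ripple_deriv k (X t) (D t) x' d') (at t)"
proof -
  define x where "x = X t"
  have x: "0 < x" using assms by (simp add: x_def)
  have N: "((\<lambda>x. x ^ (2 * k) * cos (pi / x ^ (k + 2))) has_real_derivative
      (2 * real k * x ^ (2 * k - 1) * cos (pi / x ^ (k + 2)) + pi * (real k + 2) * x ^ (k - 3) * sin (pi / x ^ (k + 2)))) (at x)"
  proof -
    have "((\<lambda>x. x ^ (2 * k) * cos (pi / x ^ (k + 2))) has_real_derivative
      (x ^ (2 * k) * (- sin (pi / x ^ (k + 2)) * (- (pi * (real (k + 2) * x ^ (k + 1))) / (x ^ (k + 2) * x ^ (k + 2))))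
        + real (2 * k) * x ^ (2 * k - 1) * cos (pi / x ^ (k + 2)))) (at x)"
    proof -
      have P: "((\<lambda>x. x ^ (k + 2)) has_real_derivative real (k + 2) * x ^ (k + 1)) (at x)"
        using DERIV_pow[of "k + 2" x UNIV] by simp
      have "((\<lambda>x. pi / x ^ (k + 2)) has_real_derivative - (pi * (real (k + 2) * x ^ (k + 1))) / (x ^ (k + 2) * x ^ (k + 2))) (at x)"
        using DERIV_divide[OF DERIV_const[of pi] P] x by simp
      from DERIV_mult[OF DERIV_pow[of "2 * k" x] DERIV_chain2[OF DERIV_cos this]]
      show ?thesis by (simp add: mult_ac add.commute)
    qed
    moreover have "x ^ (2 * k) * (- sin (pi / x ^ (k + 2)) * (- (pi * (real (k + 2) * x ^ (k + 1))) / (x ^ (k + 2) * x ^ (k + 2))))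
       = pi * (real k + 2) * x ^ (k - 3) * sin (pi / x ^ (k + 2))"
    proof -
      have "x ^ (2 * k) * x ^ (k + 1) = x ^ (k - 3) * (x ^ (k + 2) * x ^ (k + 2))"
        unfolding power_add[symmetric] using assms(5) by (intro arg_cong[where f = "\<lambda>n. x ^ n"]) simp
      then have "x ^ (2 * k) * x ^ (k + 1) / (x ^ (k + 2) * x ^ (k + 2)) = x ^ (k - 3)"
        using x by (intro nonzero_divide_eq_eq[THEN iffD2]) auto
      moreover have "a * (- s * (- (p * (r * b)) / c)) = p * r * (a * b / c) * s" for a s p r b c :: real
        by simp
      ultimately show ?thesis by (simp only: of_nat_add of_nat_numeral)
    qed
    ultimately show ?thesis by (simp only: add.commute of_nat_add of_nat_mult of_nat_numeral)
  qed
  have den: "x ^ k + D t \<noteq> 0" using x assms by (intro less_imp_neq[symmetric] add_pos_pos) auto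
  have "((\<lambda>t. X t ^ (2 * k) * cos (pi / X t ^ (k + 2))) has_real_derivative
      (2 * real k * x ^ (2 * k - 1) * cos (pi / x ^ (k + 2)) + pi * (real k + 2) * x ^ (k - 3) * sin (pi / x ^ (k + 2))) * x') (at t)"
    using DERIV_chain2[OF N[unfolded x_def] X] by (simp add: x_def)
  moreover have "((\<lambda>t. X t ^ k + D t) has_real_derivative k * x ^ (k - 1) * x' + d') (at t)"
    using X D by (auto intro!: derivative_eq_intros simp: x_def)
  ultimately have "((\<lambda>t. ripple k (X t) (D t)) has_real_derivative
     ((2 * real k * x ^ (2 * k - 1) * cos (pi / x ^ (k + 2)) + pi * (real k + 2) * x ^ (k - 3) * sin (pi / x ^ (k + 2))) * x' * (X t ^ k + D t)
       - (X t ^ (2 * k) * cos (pi / X t ^ (k + 2))) * (k * x ^ (k - 1) * x' + d')) / ((X t ^ k + D t) * (X t ^ k + D t))) (at t)"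
    unfolding ripple_def using den by (intro DERIV_divide) (auto simp: x_def)
  then show ?thesis
    using den unfolding ripple_deriv_def x_def[symmetric] by (simp add: diff_divide_distrib power2_eq_square add.commute)
qed

text \<open>
The steep term is of order \<open>x\<^sup>k\<^sup>-\<^sup>3 / (x\<^sup>k + d)\<close>.  Here \<open>x\<^sup>k\<^sup>-\<^sup>3\<close> is the power \<open>1 - 3 / k\<close> of \<open>x\<^sup>k\<close> and so at most that power of
\<open>x\<^sup>k + d\<close>, which leaves \<open>(x\<^sup>k + d)\<^sup>-\<^sup>3\<^sup>/\<^sup>k\<close>.  In the term that comes from differentiating the denominator, the
factor \<open>x\<^sup>2\<^sup>k\<close> of the ripple compensates the square of the denominator.
\<close>

lemma ripple_deriv_bound:
  assumes x: "0 < x" "x \<le> 2" and d: "0 < d" "d \<le> 1" and "\<bar>x'\<bar> \<le> 3" "\<bar>d'\<bar> \<le> 4" and k: "3 \<le> k"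
  shows "\<bar>ripple_deriv k x d x' d'\<bar> \<le> ((2 * real k * 2 ^ (k + 2) + pi * (real k + 2)) * 3 + (real k * 2 ^ (k - 1) * 3 + 4)) * d powr (- (3 / k))"
proof -
  define D where "D = x ^ k + d"
  define c where "c = cos (pi / x ^ (k + 2))"
  define s where "s = sin (pi / x ^ (k + 2))"
  define a where "a = - (3 / real k)"
  have D: "x ^ k \<le> D" "d \<le> D" "0 < D" using x d by (auto simp: D_def add_pos_pos)
  have cs: "\<bar>c\<bar> \<le> 1" "\<bar>s\<bar> \<le> 1" by (auto simp: c_def s_def)
  have a: "- 1 \<le> a" "a \<le> 0" using k by (auto simp: a_def field_simps)
  have da: "1 \<le> d powr a" using powr_mono2'[of a d 1] d a by simp
  have "x ^ (k - 3) / D \<le> d powr a"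
  proof -
    have "x ^ (k - 3) = x powr (real k * (1 + a))"
    proof -
      have "real k * (1 + a) = real (k - 3)" using k by (simp add: a_def algebra_simps of_nat_diff)
      then show ?thesis using x by (simp add: powr_realpow)
    qed
    also have "\<dots> = (x ^ k) powr (1 + a)" using x by (simp add: powr_powr[symmetric] powr_realpow)
    also have "\<dots> \<le> D powr (1 + a)" using D x a by (intro powr_mono2) auto
    also have "\<dots> = D * D powr a" using D by (simp add: powr_add)
    also have "\<dots> \<le> D * d powr a" using D d a by (intro mult_left_mono powr_mono2') auto
    finally show ?thesis using D by (simp add: field_simps)
  qed
  have "\<bar>(2 * real k * x ^ (2 * k - 1) * c + pi * (real k + 2) * x ^ (k - 3) * s) * x' / D\<bar>
      \<le> (2 * real k * 2 ^ (k + 2) + pi * (real k + 2)) * 3 * d powr a"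
  proof -
    have "\<bar>2 * real k * x ^ (2 * k - 1) * c + pi * (real k + 2) * x ^ (k - 3) * s\<bar>
        \<le> 2 * real k * x ^ (2 * k - 1) * \<bar>c\<bar> + pi * (real k + 2) * x ^ (k - 3) * \<bar>s\<bar>"
      using x by (intro order_trans[OF abs_triangle_ineq]) (simp add: abs_mult)
    also have "\<dots> \<le> 2 * real k * x ^ (2 * k - 1) * 1 + pi * (real k + 2) * x ^ (k - 3) * 1"
      using x cs by (intro add_mono mult_left_mono) auto
    also have "\<dots> = (2 * real k * x ^ (k + 2) + pi * (real k + 2)) * x ^ (k - 3)"
    proof -
      have "x ^ (2 * k - 1) = x ^ (k + 2) * x ^ (k - 3)"
        unfolding power_add[symmetric] using k by (intro arg_cong[where f = "\<lambda>n. x ^ n"]) simp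
      then show ?thesis by (simp add: algebra_simps del: power_Suc add_2_eq_Suc add_2_eq_Suc')
    qed
    also have "\<dots> \<le> (2 * real k * 2 ^ (k + 2) + pi * (real k + 2)) * x ^ (k - 3)"
      using x by (intro mult_right_mono add_mono mult_left_mono power_mono) auto
    finally have *: "\<bar>2 * real k * x ^ (2 * k - 1) * c + pi * (real k + 2) * x ^ (k - 3) * s\<bar> \<le> (2 * real k * 2 ^ (k + 2) + pi * (real k + 2)) * x ^ (k - 3)" .
    have "\<bar>(2 * real k * x ^ (2 * k - 1) * c + pi * (real k + 2) * x ^ (k - 3) * s) * x' / D\<bar>
      = \<bar>2 * real k * x ^ (2 * k - 1) * c + pi * (real k + 2) * x ^ (k - 3) * s\<bar> * \<bar>x'\<bar> / D"
      using D by (simp add: abs_mult)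
    also have "\<dots> \<le> ((2 * real k * 2 ^ (k + 2) + pi * (real k + 2)) * x ^ (k - 3)) * 3 / D"
      using * D assms x by (intro divide_right_mono mult_mono) auto
    also have "\<dots> = (2 * real k * 2 ^ (k + 2) + pi * (real k + 2)) * 3 * (x ^ (k - 3) / D)" by simp
    also have "\<dots> \<le> (2 * real k * 2 ^ (k + 2) + pi * (real k + 2)) * 3 * d powr a"
      using \<open>x ^ (k - 3) / D \<le> d powr a\<close> by (intro mult_left_mono) auto
    finally show ?thesis .
  qed
  moreover have "\<bar>x ^ (2 * k) * c * (k * x ^ (k - 1) * x' + d') / D\<^sup>2\<bar> \<le> (real k * 2 ^ (k - 1) * 3 + 4) * d powr a"
  proof -
    have "\<bar>k * x ^ (k - 1) * x' + d'\<bar> \<le> k * x ^ (k - 1) * \<bar>x'\<bar> + \<bar>d'\<bar>"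
      using x by (intro order_trans[OF abs_triangle_ineq]) (simp add: abs_mult)
    also have "\<dots> \<le> real k * 2 ^ (k - 1) * 3 + 4"
      using x assms by (intro add_mono mult_mono power_mono) auto
    finally have *: "\<bar>k * x ^ (k - 1) * x' + d'\<bar> \<le> real k * 2 ^ (k - 1) * 3 + 4" .
    have "x ^ (2 * k) \<le> D\<^sup>2" unfolding mult.commute[of 2] power_mult using D x by (intro power_mono) auto
    then have **: "x ^ (2 * k) / D\<^sup>2 \<le> 1" using D by simp
    have "\<bar>x ^ (2 * k) * c * (k * x ^ (k - 1) * x' + d') / D\<^sup>2\<bar> = (x ^ (2 * k) / D\<^sup>2) * \<bar>c\<bar> * \<bar>k * x ^ (k - 1) * x' + d'\<bar>"
      using x by (simp add: abs_mult)
    also have "\<dots> \<le> 1 * 1 * (real k * 2 ^ (k - 1) * 3 + 4)"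
      using * ** cs x by (intro mult_mono) auto
    also have "\<dots> \<le> (real k * 2 ^ (k - 1) * 3 + 4) * d powr a" using mult_left_mono[OF da, of "real k * 2 ^ (k - 1) * 3 + 4"] by simp
    finally show ?thesis .
  qed
  ultimately show ?thesis
    unfolding ripple_deriv_def D_def[symmetric] c_def[symmetric] s_def[symmetric] a_def[symmetric]
    by (simp only: distrib_right) (intro order_trans[OF abs_triangle_ineq4] add_mono)
qed

definition channel_map_deriv :: "nat \<Rightarrow> complex \<Rightarrow> complex \<Rightarrow> complex" where
  "channel_map_deriv k b z = Complex (position_deriv b z)
     (ripple_deriv k (position z) (1 - (norm z)\<^sup>2) (position_deriv b z) (- 2 * (Re z * Re b + Im z * Im b))
      - (4 * k + 4) * max (- Im z) 0 ^ (4 * k + 3) * Im b)"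

lemma channel_map_has_derivative:
  assumes "norm z < 1" "3 \<le> k"
  shows "((\<lambda>t. channel_map k (z + t *\<^sub>R b)) has_vector_derivative channel_map_deriv k b z) (at 0)"
proof -
  define z' where "z' t = z + t *\<^sub>R b" for t :: real
  have X: "((\<lambda>t. position (z' t)) has_real_derivative position_deriv b z) (at 0)"
  proof -
    have "((\<lambda>t. max (Im z + t * Im b) 0 ^ Suc (Suc 0)) has_real_derivative
        real (0 + 2) * max (Im z + 0 * Im b) 0 ^ Suc 0 * Im b) (at 0)"
      by (rule DERIV_chain2[OF positive_part_power_deriv]) (auto intro!: derivative_eq_intros)
    then have 2: "((\<lambda>t. (max (Im z + t * Im b) 0)\<^sup>2) has_real_derivative 2 * max (Im z) 0 * Im b) (at 0)"
      by (simp add: numeral_2_eq_2)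
    have 1: "((\<lambda>t. (1 - (Re z + t * Re b))\<^sup>2) has_real_derivative - (2 * (1 - Re z) * Re b)) (at 0)"
      by (auto intro!: derivative_eq_intros)
    show ?thesis
    proof (rule DERIV_cong)
      show "((\<lambda>t. position (z' t)) has_real_derivative (- (2 * (1 - Re z) * Re b) + 2 * max (Im z) 0 * Im b) / 2) (at 0)"
        using DERIV_cdivide[OF DERIV_add[OF 1 2], of 2] unfolding position_def z'_def by simp
    qed (simp add: position_deriv_def field_simps)
  qed
  have G: "((\<lambda>t. gap k (z' t)) has_real_derivative - ((4 * k + 4) * max (- Im z) 0 ^ (4 * k + 3) * Im b)) (at 0)"
  proof -
    have 4: "4 * (k + 1) = Suc (Suc (4 * k + 2))" "4 * k + 3 = Suc (4 * k + 2)" by auto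
    have "((\<lambda>t. max (- (Im z + t * Im b)) 0 ^ Suc (Suc (4 * k + 2))) has_real_derivative
       real (4 * k + 2 + 2) * max (- (Im z + 0 * Im b)) 0 ^ Suc (4 * k + 2) * (- Im b)) (at 0)"
      by (rule DERIV_chain2[OF positive_part_power_deriv]) (auto intro!: derivative_eq_intros)
    then show ?thesis
      unfolding gap_def z'_def 4 by (simp add: algebra_simps del: power_Suc)
  qed
  have "((\<lambda>t. 1 - ((Re z + t * Re b)\<^sup>2 + (Im z + t * Im b)\<^sup>2)) has_real_derivative
      - 2 * (Re z * Re b + Im z * Im b)) (at 0)"
    by (auto intro!: derivative_eq_intros simp: algebra_simps)
  then have D: "((\<lambda>t. 1 - (norm (z' t))\<^sup>2) has_real_derivative - 2 * (Re z * Re b + Im z * Im b)) (at 0)"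
    unfolding z'_def by (simp add: cmod_power2)
  have "((\<lambda>t. ripple k (position (z' t)) (1 - (norm (z' t))\<^sup>2)) has_real_derivative
     ripple_deriv k (position (z' 0)) (1 - (norm (z' 0))\<^sup>2) (position_deriv b z) (- 2 * (Re z * Re b + Im z * Im b))) (at 0)"
    by (rule ripple_has_derivative[OF X D]) (use assms position_pos in \<open>auto simp: z'_def abs_square_less_1\<close>)
  from DERIV_add[OF this G] have
    "((\<lambda>t. ripple k (position (z' t)) (1 - (norm (z' t))\<^sup>2) + gap k (z' t)) has_real_derivative Im (channel_map_deriv k b z)) (at 0)"
    by (simp add: channel_map_deriv_def z'_def)
  moreover have "((\<lambda>t. position (z' t)) has_real_derivative Re (channel_map_deriv k b z)) (at 0)"
    using X by (simp add: channel_map_deriv_def)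
  ultimately show ?thesis
    unfolding has_vector_derivative_complex_iff channel_map_def z'_def by simp
qed

lemma channel_map_in_W1p:
  assumes p: "1 \<le> p" and k: "6 * p \<le> real k"
  shows "in_W1p p (ball 0 1) (channel_map k)"
proof -
  have k3: "3 \<le> k" using assms by linarith
  define M where "M = (2 * real k * 2 ^ (k + 2) + pi * (real k + 2)) * 3 + (real k * 2 ^ (k - 1) * 3 + 4)"
  define L where "L = 3 + M + (4 * real k + 4)"
  have L: "0 \<le> M" "0 \<le> L" by (auto simp: M_def L_def)
  show ?thesis
  proof (rule in_W1p_ball_classical[where v = "channel_map_deriv k" and C = "L powr p"])
    show "continuous_on (cball 0 1) (channel_map k)" using k3 by (intro channel_map_continuous) auto
    show "((\<lambda>t. channel_map k (z + t *\<^sub>R b)) has_vector_derivative channel_map_deriv k b z) (at 0)"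
      if "norm z < 1" for z b using channel_map_has_derivative[OF that k3] .
    fix z b :: complex assume z: "norm z < 1" and "b \<in> Basis"
    then have b: "\<bar>Re b\<bar> \<le> 1" "\<bar>Im b\<bar> \<le> 1" by (auto simp: Basis_complex_def)
    have zz: "\<bar>Re z\<bar> \<le> 1" "\<bar>Im z\<bar> \<le> 1" using z abs_Re_le_cmod[of z] abs_Im_le_cmod[of z] by auto
    define d where "d = 1 - (norm z)\<^sup>2"
    have d: "0 < d" "d \<le> 1" using z by (auto simp: d_def abs_square_less_1)
    have da: "1 \<le> d powr (- (3 / k))" using powr_mono2'[of "- (3 / k)" d 1] d by simp
    have pd: "\<bar>position_deriv b z\<bar> \<le> 3"
    proof -
      have "\<bar>position_deriv b z\<bar> \<le> \<bar>max (Im z) 0\<bar> * \<bar>Im b\<bar> + \<bar>1 - Re z\<bar> * \<bar>Re b\<bar>"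
        unfolding position_deriv_def abs_mult[symmetric] by (rule abs_triangle_ineq4)
      also have "\<dots> \<le> 1 * 1 + 2 * 1" using zz b by (intro add_mono mult_mono) auto
      finally show ?thesis by simp
    qed
    have dd: "\<bar>- 2 * (Re z * Re b + Im z * Im b)\<bar> \<le> 4"
    proof -
      have "\<bar>Re z * Re b\<bar> \<le> 1 * 1" "\<bar>Im z * Im b\<bar> \<le> 1 * 1"
        unfolding abs_mult using zz b by (intro mult_mono; simp)+
      moreover have "\<bar>- 2 * (p + q)\<bar> \<le> 4" if "\<bar>p\<bar> \<le> 1 * 1" "\<bar>q\<bar> \<le> 1 * 1" for p q :: real
        using that by (simp add: abs_le_iff)
      ultimately show ?thesis by blast
    qed
    have gd: "\<bar>(4 * k + 4) * max (- Im z) 0 ^ (4 * k + 3) * Im b\<bar> \<le> 4 * real k + 4"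
    proof -
      have "\<bar>(4 * real k + 4) * max (- Im z) 0 ^ (4 * k + 3) * Im b\<bar> = (4 * real k + 4) * max (- Im z) 0 ^ (4 * k + 3) * \<bar>Im b\<bar>"
        by (simp add: abs_mult)
      also have "\<dots> \<le> (4 * real k + 4) * 1 * 1" using zz b by (intro mult_mono power_le_one) auto
      finally show ?thesis by simp
    qed
    have "norm (channel_map_deriv k b z) \<le> \<bar>position_deriv b z\<bar> +
       (\<bar>ripple_deriv k (position z) d (position_deriv b z) (- 2 * (Re z * Re b + Im z * Im b))\<bar> + \<bar>(4 * k + 4) * max (- Im z) 0 ^ (4 * k + 3) * Im b\<bar>)"
      unfolding channel_map_deriv_def d_def
      by (intro order_trans[OF cmod_le] add_mono order_refl order_trans[OF _ abs_triangle_ineq4]) auto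
    also have "\<dots> \<le> 3 * d powr (- (3 / k)) + (M * d powr (- (3 / k)) + (4 * real k + 4) * d powr (- (3 / k)))"
    proof (intro add_mono)
      show "\<bar>position_deriv b z\<bar> \<le> 3 * d powr (- (3 / k))" using pd da by linarith
      show "\<bar>ripple_deriv k (position z) d (position_deriv b z) (- 2 * (Re z * Re b + Im z * Im b))\<bar> \<le> M * d powr (- (3 / k))"
        using ripple_deriv_bound[OF position_pos[OF z] position_le_2[OF less_imp_le[OF z]] d pd dd k3] unfolding M_def .
      have "4 * real k + 4 \<le> (4 * real k + 4) * d powr (- (3 / k))"
        using mult_left_mono[OF da, of "4 * real k + 4"] by simp
      then show "\<bar>(4 * k + 4) * max (- Im z) 0 ^ (4 * k + 3) * Im b\<bar> \<le> (4 * real k + 4) * d powr (- (3 / k))"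
        by (rule order_trans[OF gd])
    qed
    also have "\<dots> = L * d powr (- (3 / k))" by (simp add: L_def algebra_simps)
    finally have "norm (channel_map_deriv k b z) powr p \<le> (L * d powr (- (3 / k))) powr p"
      using p by (intro powr_mono2) auto
    also have "\<dots> = L powr p * d powr (- (3 * p / k))" using L d by (simp add: powr_mult powr_powr)
    also have "\<dots> \<le> L powr p * d powr (- 1 / 2)"
    proof (intro mult_left_mono powr_mono')
      show "- 1 / 2 \<le> - (3 * p / real k)" using k k3 by (simp add: field_simps)
    qed (use d in auto)
    finally show "norm (channel_map_deriv k b z) powr p \<le> L powr p * (1 - (norm z)\<^sup>2) powr (- 1/2)"
      by (simp add: d_def)
  qed (rule p)
qed

section \<open>Hoelder continuity of the boundary map\<close>

text \<open>
The boundary values of the ripple.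
\<close>

definition wave :: "nat \<Rightarrow> real \<Rightarrow> real" where
  "wave k x = x ^ k * cos (pi / x ^ (k + 2))"

lemma ripple_0: "0 < k \<Longrightarrow> ripple k x 0 = wave k x"
  by (cases "x = 0") (auto simp: ripple_def wave_def power_0_left mult_2 power_add)

lemma channel_map_sphere:
  "norm z = 1 \<Longrightarrow> 0 < k \<Longrightarrow> channel_map k z = Complex (position z) (wave k (position z) + gap k z)"
  by (simp add: channel_map_def ripple_0)

lemma wave_bound: "0 \<le> x \<Longrightarrow> \<bar>wave k x\<bar> \<le> x ^ k"
  by (simp add: wave_def abs_mult mult_left_le)

lemma wave_deriv:
  assumes "0 < x"
  shows "(wave k has_real_derivative k * x ^ (k - 1) * cos (pi / x ^ (k + 2)) + pi * (real k + 2) / x ^ 3 * sin (pi / x ^ (k + 2))) (at x)"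
proof -
  have P: "((\<lambda>x. x ^ (k + 2)) has_real_derivative real (k + 2) * x ^ (k + 1)) (at x)"
    using DERIV_pow[of "k + 2" x UNIV] by simp
  have "((\<lambda>x. pi / x ^ (k + 2)) has_real_derivative - (pi * (real (k + 2) * x ^ (k + 1))) / (x ^ (k + 2) * x ^ (k + 2))) (at x)"
    using DERIV_divide[OF DERIV_const[of pi] P] assms by simp
  from DERIV_mult[OF DERIV_pow[of k x] DERIV_chain2[OF DERIV_cos this]]
  have "(wave k has_real_derivative
       real k * x ^ (k - Suc 0) * cos (pi / x ^ (k + 2)) +
       - sin (pi / x ^ (k + 2)) * (- (pi * (real (k + 2) * x ^ (k + 1))) / (x ^ (k + 2) * x ^ (k + 2))) * x ^ k) (at x)"
    unfolding wave_def[abs_def] .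
  moreover have "- sin (pi / x ^ (k + 2)) * (- (pi * (real (k + 2) * x ^ (k + 1))) / (x ^ (k + 2) * x ^ (k + 2))) * x ^ k
      = pi * (real k + 2) / x ^ 3 * sin (pi / x ^ (k + 2))"
  proof -
    have "x ^ (k + 2) * x ^ (k + 2) = x ^ (k + 1) * x ^ k * x ^ 3"
      unfolding power_add[symmetric] by (intro arg_cong[where f = "\<lambda>n. x ^ n"]) simp
    moreover have "a / (a * b) = 1 / b" if "a \<noteq> 0" for a b :: real using that by simp
    ultimately have "x ^ (k + 1) * x ^ k / (x ^ (k + 2) * x ^ (k + 2)) = 1 / x ^ 3"
      using assms by simp
    note E = this
    have "- s * (- (p * (r * a)) / c) * b = p * r * (a * b / c) * s" for a s p r b c :: real
      by simp
    then have "- sin (pi / x ^ (k + 2)) * (- (pi * (real (k + 2) * x ^ (k + 1))) / (x ^ (k + 2) * x ^ (k + 2))) * x ^ k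
       = pi * real (k + 2) * (x ^ (k + 1) * x ^ k / (x ^ (k + 2) * x ^ (k + 2))) * sin (pi / x ^ (k + 2))" .
    also have "\<dots> = pi * (real k + 2) / x ^ 3 * sin (pi / x ^ (k + 2))"
      unfolding E by (simp add: add.commute)
    finally show ?thesis .
  qed
  ultimately show ?thesis by simp
qed

lemma wave_lipschitz:
  assumes "0 < x" "x \<le> y" "y \<le> 2"
  shows "\<bar>wave k y - wave k x\<bar> \<le> (8 * (real k * 2 ^ (k - 1)) + pi * (real k + 2)) / x ^ 3 * (y - x)"
proof -
  define D where "D w = real k * w ^ (k - 1) * cos (pi / w ^ (k + 2)) + pi * (real k + 2) / w ^ 3 * sin (pi / w ^ (k + 2))" for w :: real
  have "norm (wave k y - wave k x) \<le> (8 * (real k * 2 ^ (k - 1)) + pi * (real k + 2)) / x ^ 3 * norm (y - x)"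
  proof (rule field_differentiable_bound[of "{x..y}" "wave k" D])
    fix w assume w: "w \<in> {x..y}"
    show "(wave k has_field_derivative D w) (at w within {x..y})"
      unfolding D_def by (rule has_field_derivative_at_within[OF wave_deriv]) (use w assms in auto)
    have w0: "0 < w" "w \<le> 2" "x \<le> w" using w assms by auto
    have x3: "0 < x ^ 3" using assms by simp
    have "x ^ 3 \<le> 2 ^ 3" using assms by (intro power_mono) auto
    then have x8: "1 \<le> 8 / x ^ 3" using x3 by simp
    have c1: "\<bar>real k * w ^ (k - 1) * cos (pi / w ^ (k + 2))\<bar> \<le> (real k * 2 ^ (k - 1)) * (8 / x ^ 3)"
    proof -
      have "\<bar>real k * w ^ (k - 1) * cos (pi / w ^ (k + 2))\<bar> = real k * w ^ (k - 1) * \<bar>cos (pi / w ^ (k + 2))\<bar>"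
        using w0 by (simp add: abs_mult)
      also have "\<dots> \<le> real k * 2 ^ (k - 1) * 1"
        using w0 by (intro mult_mono power_mono) auto
      also have "\<dots> \<le> (real k * 2 ^ (k - 1)) * (8 / x ^ 3)" using x8 by (intro mult_left_mono) auto
      finally show ?thesis .
    qed
    have c2: "\<bar>pi * (real k + 2) / w ^ 3 * sin (pi / w ^ (k + 2))\<bar> \<le> pi * (real k + 2) / x ^ 3"
    proof -
      have "\<bar>pi * (real k + 2) / w ^ 3 * sin (pi / w ^ (k + 2))\<bar> = pi * (real k + 2) / w ^ 3 * \<bar>sin (pi / w ^ (k + 2))\<bar>"
        using w0 by (simp add: abs_mult)
      also have "\<dots> \<le> pi * (real k + 2) / w ^ 3 * 1"
        using w0 by (intro mult_left_mono) auto
      also have "\<dots> \<le> pi * (real k + 2) / x ^ 3"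
      proof -
        have "x ^ 3 \<le> w ^ 3" using w0 assms by (intro power_mono) auto
        then show ?thesis using x3 w0 by (simp add: divide_left_mono)
      qed
      finally show ?thesis .
    qed
    have "\<bar>real k * w ^ (k - 1) * cos (pi / w ^ (k + 2)) + pi * (real k + 2) / w ^ 3 * sin (pi / w ^ (k + 2))\<bar>
       \<le> (real k * 2 ^ (k - 1)) * (8 / x ^ 3) + pi * (real k + 2) / x ^ 3"
      by (rule order_trans[OF abs_triangle_ineq add_mono[OF c1 c2]])
    also have "\<dots> = (8 * (real k * 2 ^ (k - 1)) + pi * (real k + 2)) / x ^ 3"
      by (simp add: add_divide_distrib)
    finally show "norm (D w) \<le> (8 * (real k * 2 ^ (k - 1)) + pi * (real k + 2)) / x ^ 3"
      by (simp only: D_def real_norm_def)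
  qed (use assms in auto)
  then show ?thesis using assms by simp
qed

text \<open>
Let \<open>x < y\<close>.  If \<open>y - x \<ge> x\<close>, then the heights at both points are bounded by multiples of \<open>y - x\<close>.  Otherwise \<open>y < 2 x\<close>,
and the increment is bounded both by a multiple of \<open>(y - x) / x\<^sup>3\<close> and by a multiple of \<open>x\<^sup>k\<close>.  Taking the first
bound to the power \<open>p - 1/2\<close> and the second to the power \<open>1/2\<close> leaves the exponent \<open>k / 2 - 3 (p - 1/2)\<close> of \<open>x\<close>,
which is nonnegative.
\<close>

lemma wave_hoelder:
  assumes p: "1 \<le> p" and k: "6 * p \<le> real k"
  obtains C where "0 \<le> C" "\<And>x y. x \<in> {0..2} \<Longrightarrow> y \<in> {0..2} \<Longrightarrow> \<bar>wave k x - wave k y\<bar> powr p \<le> C * \<bar>x - y\<bar> powr (p - 1/2)"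
proof -
  define C1 where "C1 = 8 * (real k * 2 ^ (k - 1)) + pi * (real k + 2)"
  define C where "C = max (2 * (2 ^ Suc k) powr p) (C1 powr (p - 1/2) * (2 ^ Suc k) powr (1/2) * 2 powr (real k / 2 - 3 * (p - 1/2)))"
  have C1: "0 \<le> C1" by (simp add: C1_def)
  have C: "0 \<le> C" by (simp add: C_def le_max_iff_disj)
  have k1: "0 < k" using assms by (cases k) auto
  have main: "\<bar>wave k y - wave k x\<bar> powr p \<le> C * (y - x) powr (p - 1/2)" if "0 \<le> x" "x < y" "y \<le> 2" for x y
  proof (cases "y - x \<ge> x")
    case True
    define t where "t = y - x"
    have t: "0 < t" "y \<le> 2 * t" "t \<le> 2" using that True by (auto simp: t_def)
    have "\<bar>wave k y - wave k x\<bar> \<le> y ^ k + x ^ k"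
      using wave_bound[of x k] wave_bound[of y k] that by linarith
    also have "\<dots> \<le> 2 * y ^ k" using that power_mono[of x y k] by simp
    also have "y ^ k = 2 ^ k * (y / 2) ^ k" by (simp add: power_divide)
    also have "(y / 2) ^ k \<le> y / 2" using k1 that power_decreasing[of 1 k "y / 2"] by simp
    also have "2 * (2 ^ k * (y / 2)) \<le> 2 ^ Suc k * t" using t by simp
    finally have "\<bar>wave k y - wave k x\<bar> \<le> 2 ^ Suc k * t" by simp
    then have "\<bar>wave k y - wave k x\<bar> powr p \<le> (2 ^ Suc k * t) powr p" using p by (intro powr_mono2) auto
    also have "\<dots> = (2 ^ Suc k) powr p * t powr (p - 1/2) * t powr (1/2)"
      using t by (simp add: powr_mult powr_add[symmetric] del: power_Suc)
    also have "\<dots> \<le> (2 ^ Suc k) powr p * t powr (p - 1/2) * 2"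
    proof (intro mult_left_mono)
      have "t powr (1/2) \<le> 2 powr (1/2)" using t by (intro powr_mono2) auto
      also have "\<dots> \<le> 2 powr 1" by (intro powr_mono) auto
      finally show "t powr (1/2) \<le> 2" by simp
    qed auto
    also have "\<dots> = (2 * (2 ^ Suc k) powr p) * t powr (p - 1/2)" by simp
    also have "\<dots> \<le> C * t powr (p - 1/2)" by (intro mult_right_mono) (auto simp: C_def)
    finally show ?thesis by (simp add: t_def)
  next
    case False
    define t where "t = y - x"
    define w where "w = \<bar>wave k y - wave k x\<bar>"
    have t: "0 < t" "0 < x" "y < 2 * x" "x \<le> 2" using that False by (auto simp: t_def)
    have "w \<le> y ^ k + x ^ k"
      using wave_bound[of x k] wave_bound[of y k] that unfolding w_def by linarith
    also have "\<dots> \<le> 2 * (2 * x) ^ k" using that t power_mono[of x y k] power_mono[of y "2 * x" k] by simp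
    finally have w1: "w \<le> 2 ^ Suc k * x ^ k" by (simp add: power_mult_distrib)
    have w2: "w \<le> C1 * t / x ^ 3" using wave_lipschitz[of x y k] t that by (simp add: w_def t_def C1_def)
    have "w powr p = w powr (p - 1/2) * w powr (1/2)" by (simp flip: powr_add)
    also have "\<dots> \<le> (C1 * t / x ^ 3) powr (p - 1/2) * (2 ^ Suc k * x ^ k) powr (1/2)"
      using w1 w2 p by (intro mult_mono powr_mono2) (auto simp: w_def)
    also have "(C1 * t / x ^ 3) powr (p - 1/2) = C1 powr (p - 1/2) * t powr (p - 1/2) * x powr (- 3 * (p - 1/2))"
    proof -
      have "C1 * t / x ^ 3 = C1 * t * x powr (- 3)" using t by (simp add: powr_minus powr_numeral divide_inverse)
      then show ?thesis using C1 t by (simp add: powr_mult powr_powr)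
    qed
    also have "(2 ^ Suc k * x ^ k) powr (1/2) = (2 ^ Suc k) powr (1/2) * x powr (real k / 2)"
    proof -
      have "x ^ k = x powr real k" using t by (simp add: powr_realpow)
      then show ?thesis using t by (simp add: powr_mult powr_powr del: power_Suc)
    qed
    also have "C1 powr (p - 1/2) * t powr (p - 1/2) * x powr (- 3 * (p - 1/2)) * ((2 ^ Suc k) powr (1/2) * x powr (real k / 2))
      = C1 powr (p - 1/2) * (2 ^ Suc k) powr (1/2) * x powr (real k / 2 - 3 * (p - 1/2)) * t powr (p - 1/2)"
    proof -
      have "x powr (real k / 2 - 3 * (p - 1/2)) = x powr (- 3 * (p - 1/2)) * x powr (real k / 2)"
        unfolding powr_add[symmetric] by (simp add: algebra_simps)
      then show ?thesis by (simp only: mult_ac)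
    qed
    also have "\<dots> \<le> C1 powr (p - 1/2) * (2 ^ Suc k) powr (1/2) * 2 powr (real k / 2 - 3 * (p - 1/2)) * t powr (p - 1/2)"
      using t k by (intro mult_right_mono mult_left_mono powr_mono2) auto
    also have "\<dots> \<le> C * t powr (p - 1/2)" by (intro mult_right_mono) (auto simp: C_def)
    finally show ?thesis by (simp add: t_def w_def)
  qed
  show ?thesis
  proof (rule that[OF C])
    fix x y :: real assume xy: "x \<in> {0..2}" "y \<in> {0..2}"
    consider "x < y" | "y < x" | "x = y" by linarith
    then show "\<bar>wave k x - wave k y\<bar> powr p \<le> C * \<bar>x - y\<bar> powr (p - 1/2)"
      using main[of x y] main[of y x] xy p by cases (auto simp: abs_minus_commute)
  qed
qed

lemma position_lipschitz:
  assumes "norm z \<le> 1" "norm w \<le> 1"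
  shows "\<bar>position z - position w\<bar> \<le> 3 * norm (z - w)"
proof -
  have b: "\<bar>Re z\<bar> \<le> 1" "\<bar>Re w\<bar> \<le> 1" "\<bar>Im z\<bar> \<le> 1" "\<bar>Im w\<bar> \<le> 1"
    using assms abs_Re_le_cmod[of z] abs_Im_le_cmod[of z] abs_Re_le_cmod[of w] abs_Im_le_cmod[of w] by auto
  define a c where "a = max (Im z) 0" and "c = max (Im w) 0"
  have d: "\<bar>Re z - Re w\<bar> \<le> norm (z - w)" "\<bar>a - c\<bar> \<le> norm (z - w)"
    using abs_Re_le_cmod[of "z - w"] abs_Im_le_cmod[of "z - w"] by (auto simp: a_def c_def)
  have "position z - position w = (Re w - Re z) * (2 - Re z - Re w) / 2 + (a - c) * (a + c) / 2"
    by (simp add: position_def a_def c_def field_simps power2_eq_square)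
  also have "\<bar>\<dots>\<bar> \<le> \<bar>Re w - Re z\<bar> * \<bar>2 - Re z - Re w\<bar> / 2 + \<bar>a - c\<bar> * \<bar>a + c\<bar> / 2"
    by (rule order_trans[OF abs_triangle_ineq]) (simp add: abs_mult)
  also have "\<dots> \<le> norm (z - w) * 4 / 2 + norm (z - w) * 2 / 2"
  proof (intro add_mono divide_right_mono mult_mono)
    have "0 \<le> a" "a \<le> 1" "0 \<le> c" "c \<le> 1" using b by (auto simp: a_def c_def)
    then show "\<bar>a + c\<bar> \<le> 2" by linarith
  qed (use b d in auto)
  finally show ?thesis by simp
qed

lemma gap_lipschitz:
  assumes "norm z \<le> 1" "norm w \<le> 1"
  shows "\<bar>gap k z - gap k w\<bar> \<le> (4 * real k + 4) * norm (z - w)"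
proof -
  have b: "\<bar>Im z\<bar> \<le> 1" "\<bar>Im w\<bar> \<le> 1"
    using assms abs_Im_le_cmod[of z] abs_Im_le_cmod[of w] by auto
  have "norm (gap k z - gap k w) \<le> real (4 * (k + 1)) * norm (max (- Im z) 0 - max (- Im w) 0)"
    unfolding gap_def using b by (intro norm_power_diff) auto
  also have "\<dots> \<le> real (4 * (k + 1)) * norm (z - w)"
    using abs_Im_le_cmod[of "z - w"] by (intro mult_left_mono) auto
  finally show ?thesis by (simp add: add.commute)
qed

lemma powr_sum_le:
  fixes a b c :: real
  assumes "0 \<le> a" "0 \<le> b" "0 \<le> c" "0 \<le> p"
  shows "(a + b + c) powr p \<le> 3 powr p * (a powr p + b powr p + c powr p)"
proof -
  define m where "m = max a (max b c)"
  have "(a + b + c) powr p \<le> (3 * m) powr p" using assms by (intro powr_mono2) (auto simp: m_def)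
  also have "\<dots> = 3 powr p * m powr p" using assms by (simp add: powr_mult m_def)
  also have "m powr p \<le> a powr p + b powr p + c powr p" by (auto simp: m_def max_def)
  finally show ?thesis by simp
qed

lemma channel_map_hoelder:
  assumes p: "1 \<le> p" and k: "6 * p \<le> real k"
  obtains C where "0 \<le> C" "\<And>z w. norm z = 1 \<Longrightarrow> norm w = 1 \<Longrightarrow>
     norm (channel_map k z - channel_map k w) powr p \<le> C * norm (z - w) powr (p - 1/2)"
proof -
  obtain C where C: "0 \<le> C" "\<And>x y. x \<in> {0..2} \<Longrightarrow> y \<in> {0..2} \<Longrightarrow> \<bar>wave k x - wave k y\<bar> powr p \<le> C * \<bar>x - y\<bar> powr (p - 1/2)"
    using wave_hoelder[OF assms] by blast
  define G where "G = 4 * real k + 4"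
  define K where "K = 3 powr p * (3 powr p * 2 + C * 3 powr (p - 1/2) + G powr p * 2)"
  have k1: "0 < k" using assms by (cases k) auto
  show ?thesis
  proof (rule that)
    show "0 \<le> K" using C by (simp add: K_def)
    fix z w :: complex assume zw: "norm z = 1" "norm w = 1"
    define r where "r = norm (z - w)"
    have r: "0 \<le> r" "r \<le> 2" using zw norm_triangle_ineq4[of z w] by (auto simp: r_def)
    have rp: "r powr p \<le> 2 * r powr (p - 1/2)"
    proof -
      have "r powr (1/2) \<le> 2 powr (1/2)" using r by (intro powr_mono2) auto
      also have "\<dots> \<le> 2 powr 1" by (intro powr_mono) auto
      finally have "r powr (1/2) * r powr (p - 1/2) \<le> 2 * r powr (p - 1/2)" by (intro mult_right_mono) auto
      then show ?thesis by (simp flip: powr_add)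
    qed
    define a b c where "a = \<bar>position z - position w\<bar>" and "b = \<bar>wave k (position z) - wave k (position w)\<bar>" and "c = \<bar>gap k z - gap k w\<bar>"
    have "norm (channel_map k z - channel_map k w) \<le> a + b + c"
      using zw k1 by (intro order_trans[OF cmod_le]) (simp add: channel_map_sphere a_def b_def c_def)
    then have "norm (channel_map k z - channel_map k w) powr p \<le> (a + b + c) powr p"
      using p by (intro powr_mono2) auto
    also have "\<dots> \<le> 3 powr p * (a powr p + b powr p + c powr p)"
      using p by (intro powr_sum_le) (auto simp: a_def b_def c_def)
    also have "\<dots> \<le> 3 powr p * (3 powr p * (2 * r powr (p - 1/2)) + C * (3 powr (p - 1/2) * r powr (p - 1/2)) + G powr p * (2 * r powr (p - 1/2)))"
    proof (intro mult_left_mono add_mono)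
      have a: "a \<le> 3 * r" using position_lipschitz[of z w] zw by (simp add: a_def r_def)
      then have "a powr p \<le> (3 * r) powr p" using p by (intro powr_mono2) (auto simp: a_def)
      also have "\<dots> = 3 powr p * r powr p" using r by (simp add: powr_mult)
      also have "\<dots> \<le> 3 powr p * (2 * r powr (p - 1/2))" by (intro mult_left_mono rp) auto
      finally show "a powr p \<le> 3 powr p * (2 * r powr (p - 1/2))" .
      have "b powr p \<le> C * a powr (p - 1/2)"
        unfolding a_def b_def using zw by (intro C(2)) (auto simp: position_nonneg intro: position_le_2)
      also have "\<dots> \<le> C * (3 * r) powr (p - 1/2)"
        using a C(1) p by (intro mult_left_mono powr_mono2) (auto simp: a_def)
      also have "\<dots> = C * (3 powr (p - 1/2) * r powr (p - 1/2))" using r by (simp add: powr_mult)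
      finally show "b powr p \<le> C * (3 powr (p - 1/2) * r powr (p - 1/2))" .
      have c: "c \<le> G * r" using gap_lipschitz[of z w k] zw by (simp add: c_def r_def G_def)
      then have "c powr p \<le> (G * r) powr p" using p by (intro powr_mono2) (auto simp: c_def)
      also have "\<dots> = G powr p * r powr p" using r by (simp add: powr_mult G_def)
      also have "\<dots> \<le> G powr p * (2 * r powr (p - 1/2))" by (intro mult_left_mono rp) auto
      finally show "c powr p \<le> G powr p * (2 * r powr (p - 1/2))" .
    qed auto
    also have "\<dots> = K * r powr (p - 1/2)" by (simp add: K_def algebra_simps)
    finally show "norm (channel_map k z - channel_map k w) powr p \<le> K * norm (z - w) powr (p - 1/2)"
      by (simp add: r_def)
  qed
qed

section \<open>The Douglas condition\<close>

lemma sin_ge_quarter: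
  assumes "0 \<le> x" "x \<le> pi / 2"
  shows "x / 4 \<le> sin x"
proof (cases "x \<le> pi / 3")
  case True
  have "x / 2 \<le> sin x"
  proof (cases "x = 0")
    case False
    with assms have "0 < x" by simp
    then obtain c where c: "0 < c" "c < x" "sin x - sin 0 = (x - 0) * cos c"
      using MVT2[of 0 x sin cos] DERIV_sin by blast
    have "1 / 2 \<le> cos c"
      using cos_monotone_0_pi_le[of c "pi / 3"] c True pi_gt_zero by (simp add: cos_60)
    then have "x * (1 / 2) \<le> x * cos c" using \<open>0 < x\<close> by (intro mult_left_mono) auto
    then show ?thesis using c by simp
  qed simp
  then show ?thesis using assms by simp
next
  case False
  have "sin (pi / 6) \<le> sin x"
    using False assms pi_gt_zero by (intro sin_monotone_2pi_le) auto
  then show ?thesis using assms pi_less_4 by (simp add: sin_30)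
qed

text \<open>
Chords are comparable with arcs; \<open>u\<close> is the representative of the angle in \<open>{-\<pi>..\<pi>}\<close>.
\<close>

lemma dist_cis_ge:
  assumes "\<bar>u\<bar> \<le> pi" "s - t = u + 2 * pi * real_of_int n"
  shows "\<bar>u\<bar> / 4 \<le> norm (cis s - cis t)"
proof -
  have "cis s = cis t * cis (u + 2 * pi * real_of_int n)" using assms(2) by (simp add: cis_mult flip: assms(2))
  also have "cis (u + 2 * pi * real_of_int n) = cis u" by (simp add: cis_mult[symmetric])
  finally have "norm (cis s - cis t) = norm (cis t * (cis u - 1))" by (simp add: algebra_simps)
  also have "\<dots> = norm (cis u - 1)" by (simp add: norm_mult)
  also have "\<dots> = 2 * \<bar>sin (u / 2)\<bar>"
  proof -
    have "(norm (cis u - 1))\<^sup>2 = (cos u - 1)\<^sup>2 + (sin u)\<^sup>2" by (simp add: cmod_power2)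
    also have "\<dots> = 2 - 2 * cos u" using sin_cos_squared_add[of u] by (simp add: power2_diff)
    also have "cos u = 1 - 2 * (sin (u / 2))\<^sup>2" using cos_double_sin[of "u / 2"] by simp
    finally have "(norm (cis u - 1))\<^sup>2 = (2 * \<bar>sin (u / 2)\<bar>)\<^sup>2" by (simp add: power_mult_distrib)
    then show ?thesis by (rule power2_eq_imp_eq) auto
  qed
  finally have *: "norm (cis s - cis t) = 2 * \<bar>sin (u / 2)\<bar>" .
  have "\<bar>u\<bar> / 2 / 4 \<le> sin (\<bar>u\<bar> / 2)" by (rule sin_ge_quarter) (use assms in auto)
  also have "\<dots> \<le> \<bar>sin (u / 2)\<bar>" by (cases "u \<ge> 0") auto
  finally show ?thesis using * by simp
qed

text \<open>
The cut makes the function integrable over the line.  Only arguments in \<open>{-\<pi>..\<pi>}\<close> matter for the estimates, and \<open>16\<close>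
is an arbitrary bound beyond \<open>\<pi>\<close>.
\<close>

definition cut_inverse_sqrt :: "real \<Rightarrow> real" where
  "cut_inverse_sqrt u = indicator {-16..16} u * \<bar>u\<bar> powr (- 1/2)"

lemma cut_inverse_sqrt_nonneg: "0 \<le> cut_inverse_sqrt u" by (simp add: cut_inverse_sqrt_def)

lemma cut_inverse_sqrt_measurable: "cut_inverse_sqrt \<in> borel_measurable borel"
  unfolding cut_inverse_sqrt_def by measurable

lemma cut_inverse_sqrt_integral: "(\<integral>\<^sup>+ u. ennreal (cut_inverse_sqrt u) \<partial>lborel) < \<infinity>"
proof -
  define h where "h u = ennreal (indicator {0..16} u * u powr (- 1/2))" for u :: real
  have hm[measurable]: "h \<in> borel_measurable borel" unfolding h_def by measurable
  have "((\<lambda>u::real. u powr (- 1/2)) has_integral (16 powr (- 1/2 + 1) / (- 1/2 + 1))) {0..16}"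
    by (rule has_integral_powr_from_0) auto
  from nn_integral_has_integral_lebesgue[OF _ this]
  have h: "(\<integral>\<^sup>+ u. h u \<partial>lborel) < \<infinity>" by (simp add: h_def)
  have "(\<integral>\<^sup>+ u. ennreal (cut_inverse_sqrt u) \<partial>lborel) \<le> (\<integral>\<^sup>+ u. h u + h (- u) \<partial>lborel)"
  proof (intro nn_integral_mono)
    fix u :: real
    show "ennreal (cut_inverse_sqrt u) \<le> h u + h (- u)"
    proof (cases "u \<ge> 0")
      case True
      then have "ennreal (cut_inverse_sqrt u) = h u" by (auto simp: cut_inverse_sqrt_def h_def indicator_def)
      then show ?thesis by simp
    next
      case False
      then have "ennreal (cut_inverse_sqrt u) = h (- u)" by (auto simp: cut_inverse_sqrt_def h_def indicator_def)
      then show ?thesis by simp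
    qed
  qed
  also have "\<dots> = (\<integral>\<^sup>+ u. h u \<partial>lborel) + (\<integral>\<^sup>+ u. h (- u) \<partial>lborel)"
    by (intro nn_integral_add) auto
  also have "(\<integral>\<^sup>+ u. h (- u) \<partial>lborel) = (\<integral>\<^sup>+ u. h u \<partial>lborel)"
    using nn_integral_real_affine[OF hm, of "-1" 0] by simp
  also have "(\<integral>\<^sup>+ u. h u \<partial>lborel) + (\<integral>\<^sup>+ u. h u \<partial>lborel) < \<infinity>" using h by simp
  finally show ?thesis .
qed

text \<open>
The three terms account for the three possible representatives of the difference of two angles: one
of them lies in \<open>{-\<pi>..\<pi>}\<close>.
\<close>

lemma inverse_sqrt_chord_le:
  assumes "s \<in> {0..<2 * pi}" "t \<in> {0..<2 * pi}"
  shows "norm (cis s - cis t) powr (- 1/2) \<le> 2 * (cut_inverse_sqrt (s - t) + cut_inverse_sqrt (s - 2 * pi - t) + cut_inverse_sqrt (s + 2 * pi - t))"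
proof -
  have main: "norm (cis s - cis t) powr (- 1/2) \<le> 2 * cut_inverse_sqrt u"
    if "\<bar>u\<bar> \<le> pi" "s - t = u + 2 * pi * real_of_int n" for u n
  proof (cases "u = 0")
    case True
    have "cis s = cis t * cis (s - t)" by (simp add: cis_mult)
    also have "cis (s - t) = 1" using that True by simp
    finally show ?thesis by (simp add: cut_inverse_sqrt_nonneg)
  next
    case False
    have "norm (cis s - cis t) powr (- 1/2) \<le> (\<bar>u\<bar> / 4) powr (- 1/2)"
      using dist_cis_ge[OF that] False by (intro powr_mono2') auto
    also have "\<dots> = \<bar>u\<bar> powr (- 1/2) / (4 powr (- 1/2))" by (simp add: powr_divide)
    also have "4 powr (- 1/2) = (1/2 :: real)" by (simp add: powr_minus powr_half_sqrt)
    also have "\<bar>u\<bar> powr (- 1/2) / (1/2) = 2 * cut_inverse_sqrt u"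
      using that(1) pi_less_4 by (auto simp: cut_inverse_sqrt_def indicator_def abs_le_iff)
    finally show ?thesis .
  qed
  consider "\<bar>s - t\<bar> \<le> pi" | "s - t > pi" | "s - t < - pi" by linarith
  then show ?thesis
  proof cases
    case 1
    then show ?thesis using main[of "s - t" 0] cut_inverse_sqrt_nonneg[of "s - 2 * pi - t"] cut_inverse_sqrt_nonneg[of "s + 2 * pi - t"] by simp
  next
    case 2
    then have "\<bar>s - 2 * pi - t\<bar> \<le> pi" using assms by (auto simp: abs_le_iff)
    then show ?thesis using main[of "s - 2 * pi - t" 1] cut_inverse_sqrt_nonneg[of "s - t"] cut_inverse_sqrt_nonneg[of "s + 2 * pi - t"] by simp
  next
    case 3
    then have "\<bar>s + 2 * pi - t\<bar> \<le> pi" using assms by (auto simp: abs_le_iff)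
    then show ?thesis using main[of "s + 2 * pi - t" "- 1"] cut_inverse_sqrt_nonneg[of "s - t"] cut_inverse_sqrt_nonneg[of "s - 2 * pi - t"] by simp
  qed
qed

lemma cis_measurable: "cis \<in> measurable (lebesgue_on {0..<2 * pi}) (restrict_space borel (sphere 0 1))"
proof (rule measurable_restrict_space2)
  show "cis \<in> borel_measurable (lebesgue_on {0..<2 * pi})"
    by (rule continuous_imp_measurable_on_sets_lebesgue) (auto intro!: continuous_intros)
qed auto

lemma space_circle_arclength: "space circle_arclength = sphere 0 1"
  by (simp add: circle_arclength_def space_restrict_space)

lemma measurable_circle_arclength:
  "measurable circle_arclength N = measurable (restrict_space borel (sphere 0 1)) N"
  by (simp add: circle_arclength_def)

lemma finite_circle_arclength: "finite_measure circle_arclength"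
proof
  have "emeasure (lebesgue_on {0..<2 * pi}) {0..<2 * pi} = emeasure lebesgue {0..<2 * pi}"
    by (rule emeasure_restrict_space) auto
  then have "emeasure circle_arclength (sphere 0 1) = ennreal (2 * pi)"
    unfolding circle_arclength_def
  proof (subst emeasure_distr[OF cis_measurable])
    show "sphere 0 1 \<in> sets (restrict_space borel (sphere (0::complex) 1))"
      by (simp add: sets_restrict_space_iff)
    have "cis -` sphere 0 1 \<inter> space (lebesgue_on {0..<2 * pi}) = {0..<2 * pi}" by auto
    moreover have "emeasure lebesgue {0..<2 * pi} = ennreal (2 * pi)" by simp
    ultimately show "emeasure (lebesgue_on {0..<2 * pi}) (cis -` sphere 0 1 \<inter> space (lebesgue_on {0..<2 * pi})) = ennreal (2 * pi)"
      using \<open>emeasure (lebesgue_on {0..<2 * pi}) {0..<2 * pi} = emeasure lebesgue {0..<2 * pi}\<close> by (simp only:)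
  qed
  then show "emeasure circle_arclength (space circle_arclength) \<noteq> \<infinity>"
    by (simp add: space_circle_arclength)
qed

lemma nn_integral_circle_arclength:
  assumes "f \<in> borel_measurable (restrict_space borel (sphere 0 1))"
  shows "(\<integral>\<^sup>+ z. f z \<partial>circle_arclength) = (\<integral>\<^sup>+ t. f (cis t) * indicator {0..<2 * pi} t \<partial>lborel)"
proof -
  have "(\<integral>\<^sup>+ z. f z \<partial>circle_arclength) = (\<integral>\<^sup>+ t. f (cis t) \<partial>lebesgue_on {0..<2 * pi})"
    unfolding circle_arclength_def by (rule nn_integral_distr[OF cis_measurable]) (use assms in simp)
  also have "\<dots> = (\<integral>\<^sup>+ t. f (cis t) * indicator {0..<2 * pi} t \<partial>lebesgue)"
    by (rule nn_integral_restrict_space) auto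
  finally show ?thesis by (simp add: nn_integral_completion)
qed

lemma inner_chord_integral_le:
  assumes "norm z = 1"
  shows "(\<integral>\<^sup>+ w. ennreal (norm (z - w) powr (- 1/2)) \<partial>circle_arclength) \<le> 6 * (\<integral>\<^sup>+ u. ennreal (cut_inverse_sqrt u) \<partial>lborel)"
proof -
  note cut_inverse_sqrt_measurable[measurable]
  obtain s where s: "z = cis s" "0 \<le> s" "s < 2 * pi"
    using assms complex_unimodular_polar[of z] by (metis cis.ctr complex_eqI cis.sel)
  define S where "S a t = ennreal (cut_inverse_sqrt (a - t))" for a t
  have Sm[measurable]: "S a \<in> borel_measurable borel" for a unfolding S_def by measurable
  have S: "(\<integral>\<^sup>+ t. S a t \<partial>lborel) = (\<integral>\<^sup>+ u. ennreal (cut_inverse_sqrt u) \<partial>lborel)" for a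
    unfolding S_def using nn_integral_real_affine[of "\<lambda>u. ennreal (cut_inverse_sqrt u)" "-1" a] by simp
  have "(\<integral>\<^sup>+ w. ennreal (norm (z - w) powr (- 1/2)) \<partial>circle_arclength)
      = (\<integral>\<^sup>+ t. ennreal (norm (z - cis t) powr (- 1/2)) * indicator {0..<2 * pi} t \<partial>lborel)"
    by (rule nn_integral_circle_arclength) (intro measurable_restrict_space1, measurable)
  also have "\<dots> \<le> (\<integral>\<^sup>+ t. 2 * (S s t + S (s - 2 * pi) t + S (s + 2 * pi) t) \<partial>lborel)"
  proof (intro nn_integral_mono)
    fix t
    show "ennreal (norm (z - cis t) powr (- 1/2)) * indicator {0..<2 * pi} t \<le> 2 * (S s t + S (s - 2 * pi) t + S (s + 2 * pi) t)"
    proof (cases "t \<in> {0..<2 * pi}")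
      case True
      have "ennreal (norm (z - cis t) powr (- 1/2)) \<le> ennreal (2 * (cut_inverse_sqrt (s - t) + cut_inverse_sqrt (s - 2 * pi - t) + cut_inverse_sqrt (s + 2 * pi - t)))"
        unfolding s(1) using inverse_sqrt_chord_le[of s t] True s by (intro ennreal_leI) auto
      also have "\<dots> = 2 * (S s t + S (s - 2 * pi) t + S (s + 2 * pi) t)"
      proof -
        have "ennreal (2 * (a + b + c)) = 2 * (ennreal a + ennreal b + ennreal c)" if "0 \<le> a" "0 \<le> b" "0 \<le> c" for a b c
          using that by (subst ennreal_mult) auto
        then show ?thesis unfolding S_def using cut_inverse_sqrt_nonneg by blast
      qed
      finally show ?thesis using True by simp
    qed simp
  qed
  also have "\<dots> = 2 * ((\<integral>\<^sup>+ t. S s t \<partial>lborel) + (\<integral>\<^sup>+ t. S (s - 2 * pi) t \<partial>lborel) + (\<integral>\<^sup>+ t. S (s + 2 * pi) t \<partial>lborel))"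
    by (simp add: nn_integral_cmult nn_integral_add)
  also have "\<dots> = 6 * (\<integral>\<^sup>+ u. ennreal (cut_inverse_sqrt u) \<partial>lborel)" unfolding S by (simp add: distrib_right[symmetric] mult.assoc[symmetric] flip: mult_2)
  finally show ?thesis .
qed

text \<open>
The hypothesis bounds the integrand of the Douglas condition by a multiple of \<open>\<bar>z - w\<bar>\<^sup>-\<^sup>1\<^sup>/\<^sup>2\<close>, whose integral over
\<open>w\<close> is bounded uniformly in \<open>z\<close>.
\<close>

lemma douglas_condition_if_hoelder:
  fixes \<phi> :: "complex \<Rightarrow> complex"
  assumes cont: "continuous_on (sphere 0 1) \<phi>" and p: "1 \<le> p" and C: "0 \<le> C"
    and hoelder: "\<And>z w. norm z = 1 \<Longrightarrow> norm w = 1 \<Longrightarrow> norm (\<phi> z - \<phi> w) powr p \<le> C * norm (z - w) powr (p - 1/2)"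
  shows "douglas_condition p \<phi>"
proof -
  have meas: "\<phi> \<in> borel_measurable circle_arclength"
    unfolding measurable_circle_arclength using cont by (rule borel_measurable_continuous_on_restrict)
  show ?thesis
  proof (cases "p = 1")
    case True
    have "bounded (\<phi> ` sphere 0 1)" by (intro compact_imp_bounded compact_continuous_image cont) auto
    then obtain B where "\<forall>w\<in>\<phi> ` sphere 0 1. norm w \<le> B" unfolding bounded_iff by blast
    then have "integrable circle_arclength \<phi>"
      by (intro finite_measure.integrable_const_bound[OF finite_circle_arclength, of _ B] meas AE_I2)
        (auto simp: space_circle_arclength)
    then show ?thesis using True by (simp add: douglas_condition_def)
  next
    case False
    define J where "J = (\<integral>\<^sup>+ u. ennreal (cut_inverse_sqrt u) \<partial>lborel)"
    have quot: "norm (\<phi> z - \<phi> w) powr p / norm (z - w) powr p \<le> C * norm (z - w) powr (- 1/2)"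
      if "norm z = 1" "norm w = 1" for z w
    proof (cases "z = w")
      case False
      have "norm (\<phi> z - \<phi> w) powr p / norm (z - w) powr p \<le> C * norm (z - w) powr (p - 1/2) / norm (z - w) powr p"
        using hoelder[OF that] by (intro divide_right_mono) auto
      also have "\<dots> = C * norm (z - w) powr (p - 1/2 - p)" using False by (simp only: powr_diff times_divide_eq_right)
      finally show ?thesis by simp
    qed simp
    have inner: "(\<integral>\<^sup>+ w. ennreal (norm (\<phi> z - \<phi> w) powr p / norm (z - w) powr p) \<partial>circle_arclength) \<le> ennreal C * (6 * J)"
      if "norm z = 1" for z
    proof -
      have "(\<integral>\<^sup>+ w. ennreal (norm (\<phi> z - \<phi> w) powr p / norm (z - w) powr p) \<partial>circle_arclength)
         \<le> (\<integral>\<^sup>+ w. ennreal C * ennreal (norm (z - w) powr (- 1/2)) \<partial>circle_arclength)"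
        using quot[OF that] C
        by (intro nn_integral_mono) (auto simp: space_circle_arclength ennreal_mult[symmetric] intro!: ennreal_leI)
      also have "\<dots> = ennreal C * (\<integral>\<^sup>+ w. ennreal (norm (z - w) powr (- 1/2)) \<partial>circle_arclength)"
      proof (rule nn_integral_cmult)
        show "(\<lambda>w. ennreal (norm (z - w) powr (- 1/2))) \<in> borel_measurable circle_arclength"
          unfolding measurable_circle_arclength by (intro measurable_restrict_space1, measurable)
      qed
      also have "\<dots> \<le> ennreal C * (6 * J)"
        unfolding J_def by (intro mult_left_mono inner_chord_integral_le that) auto
      finally show ?thesis .
    qed
    have "(\<integral>\<^sup>+ z. (\<integral>\<^sup>+ w. ennreal (norm (\<phi> z - \<phi> w) powr p / norm (z - w) powr p) \<partial>circle_arclength) \<partial>circle_arclength)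
       \<le> (\<integral>\<^sup>+ z. ennreal C * (6 * J) \<partial>circle_arclength)"
      using inner by (intro nn_integral_mono) (auto simp: space_circle_arclength)
    also have "\<dots> = ennreal C * (6 * J) * emeasure circle_arclength (space circle_arclength)" by simp
    also have "\<dots> < \<infinity>"
      using cut_inverse_sqrt_integral finite_measure.emeasure_finite[OF finite_circle_arclength]
      by (auto simp: J_def ennreal_mult_eq_top_iff less_top[symmetric])
    finally show ?thesis using False meas by (simp add: douglas_condition_def)
  qed
qed

section \<open>The Jordan curve and the channel that it bounds\<close>

lemma position_upper: "norm z = 1 \<Longrightarrow> 0 \<le> Im z \<Longrightarrow> position z = 1 - Re z"
proof -
  assume "norm z = 1" "0 \<le> Im z"
  then have "(Re z)\<^sup>2 + (Im z)\<^sup>2 = 1" by (simp add: cmod_power2[symmetric])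
  then show ?thesis using \<open>0 \<le> Im z\<close> by (simp add: position_def power2_diff)
qed

lemma position_lower: "Im z \<le> 0 \<Longrightarrow> position z = (1 - Re z)\<^sup>2 / 2"
  by (simp add: position_def)

lemma gap_upper: "0 \<le> Im z \<Longrightarrow> gap k z = 0"
  by (simp add: gap_def)

lemma gap_lower: "Im z < 0 \<Longrightarrow> 0 < gap k z"
  unfolding gap_def by (intro zero_less_power) simp

lemma gap_nonneg: "0 \<le> gap k z"
  by (simp add: gap_def)

text \<open>
On the lower half circle \<open>(Im z)\<^sup>2 \<le> 2 (1 - Re z)\<close>, and the square of the right-hand side is eight times the position.
\<close>

lemma gap_le: "norm z = 1 \<Longrightarrow> gap k z \<le> (8 * position z) ^ (k + 1)"
proof (cases "0 \<le> Im z")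
  case True
  then show ?thesis using position_nonneg[of z] by (simp add: gap_upper)
next
  case False
  assume n: "norm z = 1"
  have "\<bar>Re z\<bar> \<le> 1" using abs_Re_le_cmod[of z] n by simp
  have "(Im z)\<^sup>2 = 1 - (Re z)\<^sup>2" using n cmod_power2[of z] by simp
  also have "\<dots> = (1 - Re z) * (1 + Re z)" by (simp add: algebra_simps power2_eq_square)
  also have "\<dots> \<le> (1 - Re z) * 2" using \<open>\<bar>Re z\<bar> \<le> 1\<close> by (intro mult_left_mono) auto
  finally have "((Im z)\<^sup>2)\<^sup>2 \<le> ((1 - Re z) * 2)\<^sup>2" by (intro power_mono) auto
  also have "\<dots> = 8 * position z" using False by (simp add: position_lower power_mult_distrib[symmetric]) (simp add: power2_eq_square algebra_simps)
  finally have "(Im z) ^ 4 \<le> 8 * position z" by simp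
  then have "((Im z) ^ 4) ^ (k + 1) \<le> (8 * position z) ^ (k + 1)" by (intro power_mono) auto
  moreover have "gap k z = ((Im z) ^ 4) ^ (k + 1)"
  proof -
    have "max (- Im z) 0 = - Im z" using False by simp
    then show ?thesis unfolding gap_def power_mult by simp
  qed
  ultimately show ?thesis by simp
qed

text \<open>
The gap tells apart the two half circles, and on each of them the position determines \<open>Re z\<close>.
\<close>

lemma channel_map_inj: "0 < k \<Longrightarrow> inj_on (channel_map k) (sphere 0 1)"
proof (rule inj_onI)
  fix z w assume k: "0 < k" and zw: "z \<in> sphere 0 1" "w \<in> sphere 0 1" and eq: "channel_map k z = channel_map k w"
  then have nz: "norm z = 1" "norm w = 1" by auto
  have pe: "position z = position w" and ge: "gap k z = gap k w"
    using eq channel_map_sphere[OF nz(1) k] channel_map_sphere[OF nz(2) k] by auto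
  have sq: "(Re z)\<^sup>2 + (Im z)\<^sup>2 = 1" "(Re w)\<^sup>2 + (Im w)\<^sup>2 = 1"
    using nz by (simp_all add: cmod_power2[symmetric])
  have re: "Re z \<le> 1" "Re w \<le> 1" using nz complex_Re_le_cmod[of z] complex_Re_le_cmod[of w] by auto
  consider "0 \<le> Im z" "0 \<le> Im w" | "Im z < 0" "Im w < 0"
    using ge gap_upper[of z k] gap_upper[of w k] gap_lower[of z k] gap_lower[of w k] by fastforce
  then show "z = w"
  proof cases
    case 1
    then have "Re z = Re w" using pe position_upper nz by simp
    moreover from this have "(Im z)\<^sup>2 = (Im w)\<^sup>2" using sq by simp
    then have "Im z = Im w" using 1 by (simp add: power2_eq_iff_nonneg)
    ultimately show ?thesis by (simp add: complex_eq_iff)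
  next
    case 2
    then have "(1 - Re z)\<^sup>2 = (1 - Re w)\<^sup>2" using pe by (simp add: position_lower)
    then have "Re z = Re w" using re by (simp add: power2_eq_iff_nonneg)
    moreover from this have "(- Im z)\<^sup>2 = (- Im w)\<^sup>2" using sq by simp
    then have "- Im z = - Im w" using 2 by (subst (asm) power2_eq_iff_nonneg) auto
    ultimately show ?thesis by (simp add: complex_eq_iff)
  qed
qed

lemma sphere_loop:
  "simple_path (\<lambda>t. cis (2 * pi * t))" "path_image (\<lambda>t. cis (2 * pi * t)) = sphere 0 1"
proof -
  show "simple_path (\<lambda>t. cis (2 * pi * t))"
    unfolding simple_path_def path_def loop_free_def
  proof (intro conjI ballI impI)
    show "continuous_on {0..1} (\<lambda>t. cis (2 * pi * t))" by (intro continuous_intros)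
    fix s t :: real assume st: "s \<in> {0..1}" "t \<in> {0..1}" and eq: "cis (2 * pi * s) = cis (2 * pi * t)"
    have "cis (2 * pi * s - 2 * pi * t) = 1" using eq by (simp flip: cis_divide)
    then have "cos (2 * pi * s - 2 * pi * t) = 1" by (simp add: complex_eq_iff)
    then obtain n :: int where "2 * pi * s - 2 * pi * t = of_int n * 2 * pi" using cos_one_2pi_int by blast
    then have "2 * pi * (s - t) = 2 * pi * of_int n" by (simp add: algebra_simps)
    then have n: "s - t = of_int n" by simp
    then have "-1 \<le> (of_int n :: real)" "(of_int n :: real) \<le> 1" using st by auto
    then have "n \<in> {-1, 0, 1}" by auto
    then show "s = t \<or> s = 0 \<and> t = 1 \<or> s = 1 \<and> t = 0" using n st by auto
  qed
  show "path_image (\<lambda>t. cis (2 * pi * t)) = sphere 0 1"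
  proof
    show "path_image (\<lambda>t. cis (2 * pi * t)) \<subseteq> sphere 0 1" by (auto simp: path_image_def)
    show "sphere 0 1 \<subseteq> path_image (\<lambda>t. cis (2 * pi * t))"
    proof
      fix z :: complex assume "z \<in> sphere 0 1"
      then obtain s where s: "z = cis s" "0 \<le> s" "s < 2 * pi"
        using complex_unimodular_polar[of z] by (metis cis.ctr complex_eqI cis.sel mem_sphere_0)
      then have "z = cis (2 * pi * (s / (2 * pi)))" "s / (2 * pi) \<in> {0..1}" by (auto simp: divide_le_eq)
      then show "z \<in> path_image (\<lambda>t. cis (2 * pi * t))" unfolding path_image_def by blast
    qed
  qed
qed

lemma jordan_domain_inside_sphere_image:
  fixes \<phi> :: "complex \<Rightarrow> complex"
  assumes "continuous_on (sphere 0 1) \<phi>" "inj_on \<phi> (sphere 0 1)"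
  shows "jordan_domain (inside (\<phi> ` sphere 0 1))" "frontier (inside (\<phi> ` sphere 0 1)) = \<phi> ` sphere 0 1"
proof -
  define c where "c = \<phi> \<circ> (\<lambda>t. cis (2 * pi * t))"
  have simple: "simple_path c"
    unfolding c_def using assms sphere_loop by (intro simple_path_continuous_image) auto
  have im: "path_image c = \<phi> ` sphere 0 1"
    using sphere_loop(2) by (simp add: c_def path_image_compose)
  have closed: "pathfinish c = pathstart c" by (simp add: c_def pathfinish_def pathstart_def)
  note J = Jordan_inside_outside[OF simple closed]
  show "frontier (inside (\<phi> ` sphere 0 1)) = \<phi> ` sphere 0 1" using J im by simp
  have "inside (path_image c) \<in> components (- path_image c)"
    using J inside_in_components by blast
  then show "jordan_domain (inside (\<phi> ` sphere 0 1))"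
    unfolding jordan_domain_def using simple closed J im by metis
qed

text \<open>
The preimage of \<open>R\<close> is connected and misses the circle.  If it met the disc it would lie inside, and \<open>R\<close> would be
bounded.
\<close>

lemma unbounded_connected_misses_disc_image:
  fixes h g :: "complex \<Rightarrow> complex"
  assumes hg: "homeomorphism UNIV UNIV h g" and R: "connected R" "\<not> bounded R" "R \<inter> h ` sphere 0 1 = {}"
  shows "R \<inter> h ` cball 0 1 = {}"
proof (rule ccontr)
  assume "R \<inter> h ` cball 0 1 \<noteq> {}"
  then obtain z where z: "norm z \<le> 1" "h z \<in> R" by auto
  have h: "continuous_on UNIV h" and g: "continuous_on UNIV g" and gh: "\<And>z. g (h z) = z" and hg': "\<And>z. h (g z) = z"
    using hg by (auto simp: homeomorphism_def)
  have conn: "connected (g ` R)" by (rule connected_continuous_image[OF continuous_on_subset[OF g subset_UNIV] R(1)])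
  have off: "g ` R \<inter> sphere 0 1 = {}" 
  proof -
    have "g w \<notin> sphere 0 1" if "w \<in> R" for w
      using that R(3) hg'[of w] by (metis IntI empty_iff imageI)
    then show ?thesis by blast
  qed
  have "z \<in> g ` R" using z(2) gh by (metis imageI)
  moreover from this have "norm z < 1" using off z(1) by (auto simp: le_less)
  ultimately have "g ` R \<inter> ball 0 1 \<noteq> {}" by auto
  then have "g ` R - ball 0 1 = {}"
    using connected_Int_frontier[OF conn, of "ball 0 1"] off by auto
  then have "g w \<in> cball 0 1" if "w \<in> R" for w using that by force
  then have "R \<subseteq> h ` cball 0 1" using hg' by (metis image_eqI subsetI)
  moreover have "bounded (h ` cball 0 1)"
    by (rule compact_imp_bounded[OF compact_continuous_image[OF continuous_on_subset[OF h subset_UNIV] compact_cball]])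
  ultimately show False using R(2) bounded_subset by blast
qed

lemma vertical_ray:
  assumes "\<sigma> \<noteq> 0"
  shows "connected ((\<lambda>s. Z + complex_of_real (\<sigma> * s) * \<i>) ` {0..})" "\<not> bounded ((\<lambda>s. Z + complex_of_real (\<sigma> * s) * \<i>) ` {0..})"
proof -
  show "connected ((\<lambda>s. Z + complex_of_real (\<sigma> * s) * \<i>) ` {0..})"
    by (intro connected_continuous_image continuous_intros) auto
  show "\<not> bounded ((\<lambda>s. Z + complex_of_real (\<sigma> * s) * \<i>) ` {0..})"
  proof
    assume "bounded ((\<lambda>s. Z + complex_of_real (\<sigma> * s) * \<i>) ` {0..})"
    then obtain B where "\<forall>w\<in>(\<lambda>s. Z + complex_of_real (\<sigma> * s) * \<i>) ` {0..}. norm w \<le> B"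
      unfolding bounded_iff by blast
    then have B: "norm (Z + complex_of_real (\<sigma> * s) * \<i>) \<le> B" if "0 \<le> s" for s using that by simp
    define s where "s = (\<bar>B\<bar> + \<bar>Im Z\<bar> + 1) / \<bar>\<sigma>\<bar>"
    have "\<bar>Im Z + \<sigma> * s\<bar> \<le> B"
      using B[of s] abs_Im_le_cmod[of "Z + complex_of_real (\<sigma> * s) * \<i>"] by (simp add: s_def)
    moreover have "\<bar>\<sigma> * s\<bar> = \<bar>B\<bar> + \<bar>Im Z\<bar> + 1" using assms by (simp add: s_def abs_mult)
    ultimately show False by linarith
  qed
qed

text \<open>
From a point above the upper or below the lower bound a vertical ray leads to infinity without
meeting the curve, since over every abscissa the curve stays within the two bounds of the conclusion.
\<close>

lemma disc_image_in_channel: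
  assumes hg: "homeomorphism UNIV UNIV h g" and h\<phi>: "\<And>z. norm z = 1 \<Longrightarrow> h z = channel_map k z"
    and k: "0 < k" and z: "norm z \<le> 1"
  shows "wave k (Re (h z)) \<le> Im (h z)" "Im (h z) \<le> wave k (Re (h z)) + (8 * Re (h z)) ^ (k + 1)"
proof -
  have curve: "wave k (Re w) \<le> Im w \<and> Im w \<le> wave k (Re w) + (8 * Re w) ^ (k + 1)" if "w \<in> h ` sphere 0 1" for w
  proof -
    from that obtain v where v: "norm v = 1" "w = h v" by auto
    then have "w = Complex (position v) (wave k (position v) + gap k v)" using h\<phi> channel_map_sphere k by simp
    then show ?thesis using gap_nonneg[of k v] gap_le[of v k] v by simp
  qed
  have no: "h z \<notin> R" if "connected R" "\<not> bounded R" "R \<inter> h ` sphere 0 1 = {}" for R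
    using unbounded_connected_misses_disc_image[OF hg that] z by auto
  show "wave k (Re (h z)) \<le> Im (h z)"
  proof (rule ccontr)
    assume a: "\<not> ?thesis"
    let ?R = "(\<lambda>s. h z + complex_of_real (- 1 * s) * \<i>) ` {0..}"
    have "?R \<inter> h ` sphere 0 1 = {}"
    proof (rule equals0I)
      fix w assume w: "w \<in> ?R \<inter> h ` sphere 0 1"
      then obtain s where "w = h z + complex_of_real (- 1 * s) * \<i>" "0 \<le> s" by (auto elim!: IntE imageE)
      then have "Re w = Re (h z)" "Im w \<le> Im (h z)" by simp_all
      moreover have "w \<in> h ` sphere 0 1" using w by blast
      ultimately show False using a curve[of w] by auto
    qed
    then have "h z \<notin> ?R" using vertical_ray[of "- 1" "h z"] by (intro no) auto
    moreover have "h z \<in> ?R" by (rule image_eqI[of _ _ 0]) auto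
    ultimately show False by blast
  qed
  show "Im (h z) \<le> wave k (Re (h z)) + (8 * Re (h z)) ^ (k + 1)"
  proof (rule ccontr)
    assume a: "\<not> ?thesis"
    let ?R = "(\<lambda>s. h z + complex_of_real (1 * s) * \<i>) ` {0..}"
    have "?R \<inter> h ` sphere 0 1 = {}"
    proof (rule equals0I)
      fix w assume w: "w \<in> ?R \<inter> h ` sphere 0 1"
      then obtain s where "w = h z + complex_of_real (1 * s) * \<i>" "0 \<le> s" by (auto elim!: IntE imageE)
      then have "Re w = Re (h z)" "Im w \<ge> Im (h z)" by simp_all
      moreover have "w \<in> h ` sphere 0 1" using w by blast
      ultimately show False using a curve[of w] by auto
    qed
    then have "h z \<notin> ?R" using vertical_ray[of 1 "h z"] by (intro no) auto
    moreover have "h z \<in> ?R" by (rule image_eqI[of _ _ 0]) auto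
    ultimately show False by blast
  qed
qed

text \<open>
The intermediate value theorem applied successively, each time on the interval to the right of the
preceding preimage.
\<close>

lemma monotone_preimages:
  fixes q :: "real \<Rightarrow> real" and c :: "nat \<Rightarrow> real"
  assumes q: "continuous_on {a..b} q" and "a \<le> b" and c: "mono c" "q a \<le> c 0" "\<And>i. c i \<le> q b"
  obtains t where "mono t" "\<And>i. t i \<in> {a..b}" "\<And>i. q (t i) = c i"
proof -
  have "\<exists>t. \<forall>i. (t i \<in> {a..b} \<and> q (t i) = c i) \<and> t i \<le> t (Suc i)"
  proof (rule dependent_nat_choice)
    show "\<exists>x. x \<in> {a..b} \<and> q x = c 0"
      using IVT'[of q a "c 0" b] assms by auto
    fix x i assume x: "x \<in> {a..b} \<and> q x = c i"
    have "continuous_on {x..b} q" by (rule continuous_on_subset[OF q]) (use x in auto)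
    then obtain y where "x \<le> y" "y \<le> b" "q y = c (Suc i)"
      using IVT'[of q x "c (Suc i)" b] x c(1) c(3)[of "Suc i"] by (auto simp: mono_iff_le_Suc)
    then show "\<exists>y. (y \<in> {a..b} \<and> q y = c (Suc i)) \<and> x \<le> y" using x by (intro exI[of _ y]) auto
  qed
  then show thesis using that by (metis mono_iff_le_Suc)
qed

section \<open>Images of chords are long\<close>

lemma wave_turning_point:
  fixes k :: nat
  assumes "0 < j"
  defines "c \<equiv> root (k + 2) (1 / real j)"
  shows "wave k c = (- 1) ^ j * c ^ k"
proof -
  have "c ^ (k + 2) = 1 / real j" unfolding c_def by (rule real_root_pow_pos2) auto
  then have "pi / c ^ (k + 2) = pi * real j" by simp
  then show ?thesis unfolding wave_def by (simp only: cos_npi2 mult.commute)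
qed

text \<open>
At the abscissae \<open>j\<^sup>-\<^sup>1\<^sup>/\<^sup>(\<^sup>k\<^sup>+\<^sup>2\<^sup>)\<close> with \<open>n\<^sup>k\<^sup>+\<^sup>2 \<le> j \<le> (2 n)\<^sup>k\<^sup>+\<^sup>2\<close>, which run from \<open>1 / (2 n)\<close> to \<open>1 / n\<close>, the wave has the values plus and
minus \<open>x\<^sup>k\<close> in turn.  The image of the chord passes over these abscissae in their order.  Each step changes the
height by at least \<open>2 (2 n)\<^sup>-\<^sup>k\<close> minus the width of the channel, and the lower bound on \<open>n\<close> makes this width at
most \<open>(2 n)\<^sup>-\<^sup>k\<close>.
\<close>

lemma chord_image_variation:
  assumes hg: "homeomorphism UNIV UNIV h g" and h\<phi>: "\<And>z. norm z = 1 \<Longrightarrow> h z = channel_map k z"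
    and k: "0 < k" and n: "16 ^ (k + 1) \<le> n" and x: "x \<in> {1 - 2 / real n .. 1 - 1 / real n}"
  shows "\<exists>t::nat \<Rightarrow> real. mono t \<and> (\<forall>i. t i \<in> {-1..1}) \<and>
     (real n)\<^sup>2 / 2 ^ k \<le> (\<Sum>i<(2 * n) ^ (k + 2) - n ^ (k + 2). norm (h (Complex x (t (Suc i))) - h (Complex x (t i))))"
proof -
  define m where "m = k + 2"
  have n16: "16 \<le> n"
  proof -
    have "(16::nat) ^ 1 \<le> 16 ^ (k + 1)" by (intro power_increasing) auto
    from order_trans[OF this n] show ?thesis by simp
  qed
  then have n0: "0 < real n" by simp
  have h: "continuous_on UNIV h" using hg by (simp add: homeomorphism_def)
  have x1: "1 / real n \<le> 1 - x" "1 - x \<le> 2 / real n" using x by auto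
  have n8: "2 / real n \<le> 1 / 8" using n16 by (simp add: field_simps)
  have xb: "0 \<le> x" "x \<le> 1" using x1 n8 zero_less_divide_1_iff[of "real n"] n0 by linarith+
  define r where "r = sqrt (1 - x\<^sup>2)"
  have r: "0 \<le> r" "r \<le> 1" "r\<^sup>2 = 1 - x\<^sup>2"
    using xb by (auto simp: r_def abs_square_le_1)
  have end1: "norm (Complex x r) = 1" and end2: "norm (Complex x (- r)) = 1"
    using r by (auto simp: complex_norm)
  \<comment> \<open>The index decreases from \<open>(2 n)\<^sup>m\<close> to \<open>n\<^sup>m\<close> and stays there, so that the abscissae increase.\<close>
  define j where "j i = max ((2 * n) ^ m - i) (n ^ m)" for i
  define c where "c i = root m (1 / real (j i))" for i
  have nm: "0 < n ^ m" "n ^ m \<le> (2 * n) ^ m" using n16 by (auto intro: power_mono)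
  have j: "0 < j i" "j i \<le> (2 * n) ^ m" "n ^ m \<le> j i" "j (Suc i) \<le> j i" for i
    using nm by (simp_all add: j_def less_max_iff_disj)
  have m0: "0 < m" by (simp add: m_def)
  have cmono: "mono c"
    unfolding mono_iff_le_Suc c_def using j m0 by (auto intro!: frac_le)
  have c_lo: "1 / (2 * real n) \<le> c i" for i
  proof -
    have "1 / (2 * real n) = root m ((1 / (2 * real n)) ^ m)" using m0 n0 by (simp add: real_root_power_cancel)
    also have "\<dots> \<le> c i"
    proof -
      have "real (j i) \<le> real ((2 * n) ^ m)" using j(2) by (simp only: of_nat_le_iff)
      then have "1 / real ((2 * n) ^ m) \<le> 1 / real (j i)" using j(1)[of i] by (intro divide_left_mono) auto
      then show ?thesis unfolding c_def using m0 by (simp add: power_divide power_one_over)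
    qed
    finally show ?thesis .
  qed
  have c_hi: "c i \<le> 1 / real n" for i
  proof -
    have "real (n ^ m) \<le> real (j i)" using j(3) by (simp only: of_nat_le_iff)
    then have "1 / real (j i) \<le> 1 / real (n ^ m)" using nm(1) j(1)[of i] by (intro divide_left_mono mult_pos_pos) auto
    then have "c i \<le> root m ((1 / real n) ^ m)" unfolding c_def using m0 by (simp add: power_one_over)
    also have "\<dots> = 1 / real n" using m0 n0 by (simp add: real_root_power_cancel)
    finally show ?thesis .
  qed
  define q where "q y = Re (h (Complex x y))" for y
  have qc: "continuous_on {- r..r} q"
    unfolding q_def Complex_eq by (intro continuous_intros continuous_on_compose2[OF h]) auto
  have "q (- r) = (1 - x)\<^sup>2 / 2"
    unfolding q_def h\<phi>[OF end2] channel_map_def using r by (simp add: position_lower)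
  also have "\<dots> \<le> (2 / real n)\<^sup>2 / 2" using x1 xb by (intro divide_right_mono power_mono) auto
  also have "\<dots> \<le> 1 / (2 * real n)" using n16 by (simp add: field_simps power2_eq_square)
  finally have q1: "q (- r) \<le> c 0" using c_lo[of 0] by linarith
  have "q r = 1 - x"
    unfolding q_def h\<phi>[OF end1] channel_map_def using r end1 by (simp add: position_upper)
  then have q2: "c i \<le> q r" for i using c_hi[of i] x1 by linarith
  obtain t where t: "mono t" "\<And>i. t i \<in> {- r..r}" "\<And>i. q (t i) = c i"
    using monotone_preimages[OF qc _ cmono q1 q2] r(1) by auto
  define H where "H i = h (Complex x (t i))" for i
  define \<delta> where "\<delta> = (1 / (2 * real n)) ^ k"
  have ReH: "Re (H i) = c i" for i using t(3) by (simp add: H_def q_def)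
  have cd: "\<delta> \<le> c i ^ k" for i unfolding \<delta>_def using c_lo[of i] n0 by (intro power_mono) auto
  have ImH: "wave k (c i) \<le> Im (H i)" "Im (H i) \<le> wave k (c i) + \<delta>" for i
  proof -
    have "(norm (Complex x (t i)))\<^sup>2 \<le> 1"
    proof -
      have "(t i)\<^sup>2 \<le> r\<^sup>2" using t(2)[of i] by (intro abs_le_square_iff[THEN iffD1]) auto
      then show ?thesis using r by (simp add: cmod_power2)
    qed
    then have N: "norm (Complex x (t i)) \<le> 1" by (simp add: abs_square_le_1)
    note B = disc_image_in_channel[OF hg h\<phi> k N, folded H_def, unfolded ReH]
    show "wave k (c i) \<le> Im (H i)" using B(1) by simp
    have "(8 * c i) ^ (k + 1) \<le> (8 / real n) ^ (k + 1)"
      using c_hi[of i] c_lo[of i] n0 by (intro power_mono) (auto intro: order_trans[rotated])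
    also have "\<dots> \<le> \<delta>"
    proof -
      have "8 ^ (k + 1) * 2 ^ k \<le> (16::real) ^ (k + 1)"
      proof -
        have "(8::real) ^ (k + 1) * 2 ^ k \<le> 8 ^ (k + 1) * 2 ^ (k + 1)" by simp
        also have "\<dots> = 16 ^ (k + 1)" unfolding power_mult_distrib[symmetric] by simp
        finally show ?thesis .
      qed
      also have "\<dots> \<le> real n" using n by (metis of_nat_le_iff of_nat_numeral of_nat_power)
      finally have "8 ^ (k + 1) * 2 ^ k * (real n) ^ k \<le> real n * (real n) ^ k" by (intro mult_right_mono) auto
      then show ?thesis
        unfolding \<delta>_def using n0 by (simp add: power_divide power_mult_distrib field_simps)
    qed
    finally show "Im (H i) \<le> wave k (c i) + \<delta>" using B(2) by linarith
  qed
  have wave: "wave k (c i) = (- 1) ^ j i * c i ^ k" for i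
    unfolding c_def m_def using j(1) by (rule wave_turning_point)
  have step: "\<delta> \<le> norm (H (Suc i) - H i)" if "i < (2 * n) ^ m - n ^ m" for i
  proof -
    have "max (a - i) b = Suc (max (a - Suc i) b)" if "i < a - b" for a b i :: nat
    proof -
      have "b \<le> a - i" "b \<le> a - Suc i" "a - i = Suc (a - Suc i)" using that by linarith+
      then show ?thesis by (simp add: max_absorb1)
    qed
    then have "j i = Suc (j (Suc i))" using that unfolding j_def by blast
    then have "\<delta> \<le> \<bar>Im (H (Suc i)) - Im (H i)\<bar>"
      using wave[of i] wave[of "Suc i"] ImH[of i] ImH[of "Suc i"] cd[of i] cd[of "Suc i"]
      by (cases "even (j (Suc i))") auto
    also have "\<dots> \<le> norm (H (Suc i) - H i)" using abs_Im_le_cmod[of "H (Suc i) - H i"] by simp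
    finally show ?thesis .
  qed
  have "(real n)\<^sup>2 / 2 ^ k = real (n ^ m) * \<delta>"
    unfolding \<delta>_def m_def using n0 by (simp add: power_divide power_mult_distrib power_add power2_eq_square)
  also have "\<dots> \<le> real ((2 * n) ^ m - n ^ m) * \<delta>"
  proof (intro mult_right_mono)
    have "2 * n ^ m \<le> (2 * n) ^ m"
      using m0 by (auto simp: power_mult_distrib intro!: mult_right_mono self_le_power)
    then show "real (n ^ m) \<le> real ((2 * n) ^ m - n ^ m)" unfolding of_nat_le_iff by linarith
  qed (simp add: \<delta>_def)
  also have "\<dots> = (\<Sum>i<(2 * n) ^ m - n ^ m. \<delta>)" by simp
  also have "\<dots> \<le> (\<Sum>i<(2 * n) ^ m - n ^ m. norm (H (Suc i) - H i))"
    using step by (intro sum_mono) auto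
  finally have "(real n)\<^sup>2 / 2 ^ k \<le> (\<Sum>i<(2 * n) ^ (k + 2) - n ^ (k + 2). norm (h (Complex x (t (Suc i))) - h (Complex x (t i))))"
    by (simp only: m_def H_def)
  moreover have "t i \<in> {-1..1}" for i using t(2)[of i] r by auto
  ultimately show ?thesis using t(1) by blast
qed

text \<open>
For large \<open>n\<close> the chords with \<open>1 / n \<le> 1 - Re z \<le> 2 / n\<close> carry variation \<open>n\<^sup>2 / 2\<^sup>k\<close> each, so the weak derivative in
the vertical direction would have mass at least a constant times \<open>n\<close>.
\<close>

lemma no_sobolev_homeomorphic_extension:
  assumes hg: "homeomorphism UNIV UNIV h g" and h\<phi>: "\<And>z. norm z = 1 \<Longrightarrow> h z = channel_map k z" and k: "0 < k"
  shows "\<not> in_W1p_loc 1 UNIV h"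
proof
  assume "in_W1p_loc 1 UNIV h"
  moreover have "compact (closure (ball (0::complex) 3))" by simp
  ultimately have "in_W1p 1 (ball 0 3) h" unfolding in_W1p_loc_def by blast
  then obtain v where v: "in_Lp 1 (ball 0 3) v" and weak: "weak_partial_derivative (ball 0 3) h \<i> v"
    unfolding in_W1p_def by (auto simp: Basis_complex_def)
  have "integrable (lebesgue_on (ball 0 3)) (\<lambda>z. norm (v z))" "v \<in> borel_measurable (lebesgue_on (ball 0 3))"
    using v by (simp_all add: in_Lp_def)
  then have vi: "integrable (lebesgue_on (ball 0 3)) v" using integrable_norm_cancel by blast
  have h: "continuous_on UNIV h" using hg by (simp add: homeomorphism_def)
  define B where "B = (smooth_step 1)\<^sup>2 / bump_kernel_mass * (LINT w|lebesgue_on (ball 0 3). norm (v w))"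
  obtain N :: nat where N: "2 ^ k * B < real N" using reals_Archimedean2 by blast
  define n where "n = max N (16 ^ (k + 1))"
  have n: "16 ^ (k + 1) \<le> n" "N \<le> n" by (auto simp: n_def)
  have n16: "16 \<le> n"
  proof -
    have "(16::nat) ^ 1 \<le> 16 ^ (k + 1)" by (intro power_increasing) auto
    from order_trans[OF this n(1)] show ?thesis by simp
  qed
  then have b: "2 / real n \<le> 1" "0 < 1 / real n" by (simp_all add: field_simps)
  have "(real n)\<^sup>2 / 2 ^ k * ((1 - 1 / real n) - (1 - 2 / real n)) \<le> B"
    unfolding B_def
  proof (rule weak_derivative_variation_bound[OF h weak vi])
    show "1 - 2 / real n \<in> {-1..1}" "1 - 1 / real n \<in> {-1..1}" "1 - 2 / real n < 1 - 1 / real n"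
      using b unfolding atLeastAtMost_iff by linarith+
  qed (rule chord_image_variation[OF hg h\<phi> k n(1)])
  moreover have "(real n)\<^sup>2 / 2 ^ k * ((1 - 1 / real n) - (1 - 2 / real n)) = real n / 2 ^ k"
    using n16 by (simp add: field_simps power2_eq_square)
  ultimately have "real n / 2 ^ k \<le> B" by (simp only:)
  then have "real n \<le> 2 ^ k * B" by (simp add: field_simps)
  then show False using N n(2) by linarith
qed

theorem theorem1p2:
  fixes p :: real
  assumes "1 \<le> p"
  shows "\<exists>(Y :: complex set) (\<phi> :: complex \<Rightarrow> complex).
           jordan_domain Y \<and>
           (\<exists>\<psi>. homeomorphism (sphere 0 1) (frontier Y) \<phi> \<psi>) \<and>
           douglas_condition p \<phi> \<and>
           (\<exists>u :: complex \<Rightarrow> complex.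
              continuous_on (cball 0 1) u \<and> (\<forall>x\<in>sphere 0 1. u x = \<phi> x) \<and>
              in_W1p p (ball 0 1) u) \<and>
           \<not> (\<exists>h :: complex \<Rightarrow> complex.
                (\<exists>g. homeomorphism UNIV UNIV h g) \<and>
                (\<forall>x\<in>sphere 0 1. h x = \<phi> x) \<and>
                in_W1p_loc 1 UNIV h)"
proof -
  define k where "k = nat \<lceil>6 * p\<rceil>"
  have k: "6 * p \<le> real k" unfolding k_def by linarith
  then have k0: "0 < k" using assms by (cases k) auto
  let ?\<phi> = "channel_map k"
  let ?Y = "inside (?\<phi> ` sphere 0 1)"
  have cont: "continuous_on (cball 0 1) ?\<phi>" by (rule channel_map_continuous[OF k0])
  then have cont': "continuous_on (sphere 0 1) ?\<phi>" by (rule continuous_on_subset) auto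
  note J = jordan_domain_inside_sphere_image[OF cont' channel_map_inj[OF k0]]
  have homeo: "\<exists>\<psi>. homeomorphism (sphere 0 1) (frontier ?Y) ?\<phi> \<psi>"
    unfolding J(2) using homeomorphism_compact[OF compact_sphere cont' refl channel_map_inj[OF k0]] by blast
  have "douglas_condition p ?\<phi>"
    using channel_map_hoelder[OF assms k] douglas_condition_if_hoelder[OF cont' assms] by metis
  moreover have "in_W1p p (ball 0 1) ?\<phi>" by (rule channel_map_in_W1p[OF assms k])
  moreover have "\<not> (\<exists>h. (\<exists>g. homeomorphism UNIV UNIV h g) \<and> (\<forall>x\<in>sphere 0 1. h x = ?\<phi> x) \<and> in_W1p_loc 1 UNIV h)"
    using no_sobolev_homeomorphic_extension[OF _ _ k0] by (metis mem_sphere_0)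
  ultimately show ?thesis using J(1) homeo cont by blast
qed

end
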